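(* Let $T$ be a tree with the vertex set $[n]$, let $\mathbf{k}=\mathbf{2}=(2,\ldots,2)\in\mathbb{N}^n$, and let $W_T$ be the set of joint vertices of $T$. Then $S/\mathrm{NI}_{\mathbf{k}}(T)$ is Cohen-Macaulay if and only if $|N_T[j]\cap W_T|=1$ for all $1\le j\le n$.
   Context: $K$ is a field, $[n]=\{1,\ldots,n\}$ and $S=K[x_1,\ldots,x_n]$. All graphs are finite, simple and without isolated vertices. $\deg_T(i)$ is the degree and $N_T[i]$ the closed neighborhood of $i$ in $T$; $\mathbf{x}_W=\prod_{j\in W}x_j$ for $W\subseteq[n]$. For $\mathbf{k}=(k_1,\ldots,k_n)$ with $1\le k_i\le\deg_T(i)+1$, the $\mathbf{k}$-neighborhood ideal is $\mathrm{NI}_{\mathbf{k}}(T)=\sum_{i=1}^n(\mathbf{x}_W: W\subseteq N_T[i],\ |W|=k_i)\subseteq S$. A vertex of a tree $T$ is called a joint vertex if it is adjacent to a leaf (degree-one vertex) of $T$.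
   Formalization: The tree with exactly two vertices is excluded: there both vertices are joint vertices, so |N_T[j]∩W_T|=2, yet K[x_1,x_2]/(x_1x_2) is Cohen-Macaulay, so the equivalence as printed fails for it. *)

theory Defs
  imports
    "HOL-Algebra.QuotRing"
    "HOL-Algebra.Ring_Divisibility"
    "HOL-Library.Poly_Mapping"
    "HOL-Library.Extended_Nat"
begin

section \<open>Graphs\<close>

text \<open>A graph is given by its vertex set and its set of edges, each edge being a two-element set
  of vertices.\<close>

definition simple_graph :: "'v set \<Rightarrow> 'v set set \<Rightarrow> bool" where
  "simple_graph V E \<longleftrightarrow> finite V \<and> (\<forall>e\<in>E. e \<subseteq> V \<and> card e = 2)"

definition connected_graph :: "'v set \<Rightarrow> 'v set set \<Rightarrow> bool" where
  "connected_graph V E \<longleftrightarrow> V \<noteq> {} \<and> (\<forall>u\<in>V. \<forall>v\<in>V. (u, v) \<in> {(a, b). {a, b} \<in> E}\<^sup>*)"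

text \<open>A cycle is listed by its vertices in cyclic order, without repeating the first one.\<close>

definition is_cycle :: "'v set set \<Rightarrow> 'v list \<Rightarrow> bool" where
  "is_cycle E vs \<longleftrightarrow> 3 \<le> length vs \<and> distinct vs \<and>
     (\<forall>i<length vs. {vs ! i, vs ! (Suc i mod length vs)} \<in> E)"

definition is_tree :: "'v set \<Rightarrow> 'v set set \<Rightarrow> bool" where
  "is_tree V E \<longleftrightarrow> simple_graph V E \<and> connected_graph V E \<and> \<not> (\<exists>vs. is_cycle E vs)"

definition nbhd :: "'v set set \<Rightarrow> 'v \<Rightarrow> 'v set" where
  "nbhd E i = {j. {i, j} \<in> E}"

definition closed_nbhd :: "'v set set \<Rightarrow> 'v \<Rightarrow> 'v set" where
  "closed_nbhd E i = insert i (nbhd E i)"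

definition vdeg :: "'v set set \<Rightarrow> 'v \<Rightarrow> nat" where
  "vdeg E i = card (nbhd E i)"

definition joint_vertices :: "'v set \<Rightarrow> 'v set set \<Rightarrow> 'v set" where
  "joint_vertices V E = {v\<in>V. \<exists>l\<in>nbhd E v. vdeg E l = 1}"

section \<open>Polynomial rings and neighborhood ideals\<close>

text \<open>Polynomials are finitely supported maps from exponent vectors to coefficients. The type has
  a variable for every element of \<open>'v\<close>; the ring \<open>K[x\<^sub>j : j \<in> X]\<close> is the subring of the polynomials
  in whose monomials only variables from \<open>X\<close> occur.\<close>

definition mpoly_ring :: "'v set \<Rightarrow> (('v \<Rightarrow>\<^sub>0 nat) \<Rightarrow>\<^sub>0 'k::field) ring" where
  "mpoly_ring X = \<lparr>carrier = {p. \<forall>m\<in>Poly_Mapping.keys p. Poly_Mapping.keys m \<subseteq> X},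
     mult = (*), one = 1, zero = 0, add = (+)\<rparr>"

definition mvar :: "'v \<Rightarrow> (('v \<Rightarrow>\<^sub>0 nat) \<Rightarrow>\<^sub>0 'k::field)" where
  "mvar j = Poly_Mapping.single (Poly_Mapping.single j 1) 1"

definition sqfree_monom :: "'v set \<Rightarrow> (('v \<Rightarrow>\<^sub>0 nat) \<Rightarrow>\<^sub>0 'k::field)" where
  "sqfree_monom W = (\<Prod>j\<in>W. mvar j)"

text \<open>The sum of a family of ideals is the smallest ideal containing all of them.\<close>

definition nbhd_ideal ::
    "'v set \<Rightarrow> 'v set set \<Rightarrow> ('v \<Rightarrow> nat) \<Rightarrow> (('v \<Rightarrow>\<^sub>0 nat) \<Rightarrow>\<^sub>0 'k::field) set" where
  "nbhd_ideal V E k =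
     Idl\<^bsub>mpoly_ring V\<^esub> (\<Union>i\<in>V.
       Idl\<^bsub>mpoly_ring V\<^esub> {sqfree_monom W | W. W \<subseteq> closed_nbhd E i \<and> card W = k i})"

lemma cring_mpoly_ring: "cring (mpoly_ring X :: (('v \<Rightarrow>\<^sub>0 nat) \<Rightarrow>\<^sub>0 'k::field) ring)"
proof -
  let ?S = "mpoly_ring X :: (('v \<Rightarrow>\<^sub>0 nat) \<Rightarrow>\<^sub>0 'k::field) ring"
  have add: "p + q \<in> carrier ?S" if "p \<in> carrier ?S" "q \<in> carrier ?S" for p q
    using that Poly_Mapping.keys_add[of p q] unfolding mpoly_ring_def by fastforce
  have mult: "p * q \<in> carrier ?S" if p: "p \<in> carrier ?S" and q: "q \<in> carrier ?S" for p q
  proof -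
    have "Poly_Mapping.keys m \<subseteq> X" if m: "m \<in> Poly_Mapping.keys (p * q)" for m
    proof -
      obtain a b where ab: "m = a + b" "a \<in> Poly_Mapping.keys p" "b \<in> Poly_Mapping.keys q"
        using m keys_mult[of p q] by blast
      then have "Poly_Mapping.keys a \<subseteq> X" "Poly_Mapping.keys b \<subseteq> X"
        using p q unfolding mpoly_ring_def by auto
      then show ?thesis
        using Poly_Mapping.keys_add[of a b] ab(1) by blast
    qed
    then show ?thesis
      unfolding mpoly_ring_def by auto
  qed
  have neg: "- p \<in> carrier ?S" if "p \<in> carrier ?S" for p
    using that unfolding mpoly_ring_def by simp
  have zero: "0 \<in> carrier ?S" and one: "1 \<in> carrier ?S"
    unfolding mpoly_ring_def by auto
  have eqs: "mult ?S = (*)" "one ?S = 1" "ring.zero ?S = 0" "ring.add ?S = (+)"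
    unfolding mpoly_ring_def by simp_all
  show ?thesis
  proof (rule cringI)
    show "abelian_group ?S"
    proof (rule abelian_groupI)
      fix p assume p: "p \<in> carrier ?S"
      show "\<exists>q\<in>carrier ?S. q \<oplus>\<^bsub>?S\<^esub> p = \<zero>\<^bsub>?S\<^esub>"
        using neg[OF p] by (intro bexI[of _ "- p"]) (simp_all add: eqs)
    qed (use add zero in \<open>simp_all add: eqs algebra_simps\<close>)
    show "comm_monoid ?S"
      by (rule comm_monoidI) (use mult one in \<open>simp_all add: eqs algebra_simps\<close>)
  qed (simp_all add: eqs algebra_simps)
qed

section \<open>Cohen--Macaulay rings\<close>

text \<open>The last condition says that \<open>xs ! i\<close> is a nonzerodivisor on the quotient of \<open>R\<close> by the ideal
  generated by the preceding members.\<close>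

definition regular_sequence :: "('a, 'b) ring_scheme \<Rightarrow> 'a list \<Rightarrow> bool" where
  "regular_sequence R xs \<longleftrightarrow>
     set xs \<subseteq> carrier R \<and>
     Idl\<^bsub>R\<^esub> (set xs) \<noteq> carrier R \<and>
     (\<forall>i<length xs. \<forall>a\<in>carrier R.
        xs ! i \<otimes>\<^bsub>R\<^esub> a \<in> Idl\<^bsub>R\<^esub> (set (take i xs)) \<longrightarrow> a \<in> Idl\<^bsub>R\<^esub> (set (take i xs)))"

definition ideal_depth :: "('a, 'b) ring_scheme \<Rightarrow> 'a set \<Rightarrow> enat" where
  "ideal_depth R I = (SUP xs\<in>{xs. regular_sequence R xs \<and> set xs \<subseteq> I}. enat (length xs))"

definition prime_chain :: "('a, 'b) ring_scheme \<Rightarrow> 'a set list \<Rightarrow> bool" where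
  "prime_chain R ps \<longleftrightarrow> (\<forall>p\<in>set ps. primeideal p R) \<and> sorted_wrt (\<subset>) ps"

text \<open>The length of a chain is its number of strict inclusions.\<close>

definition prime_height :: "('a, 'b) ring_scheme \<Rightarrow> 'a set \<Rightarrow> enat" where
  "prime_height R P =
     (SUP ps\<in>{ps. prime_chain R ps \<and> ps \<noteq> [] \<and> last ps = P}. enat (length ps - 1))"

text \<open>This is the definition in Eisenbud, \<^emph>\<open>Commutative Algebra\<close>, Section 18.2 (and in Kaplansky,
  \<^emph>\<open>Commutative Rings\<close>, Section 3-1): depth and height agree at every maximal ideal. The depth of a
  maximal ideal \<open>P\<close> and its height are the depth and the dimension of the localization at \<open>P\<close>, so
  this is also the definition by Cohen--Macaulay localizations.\<close>

definition cohen_macaulay :: "('a, 'b) ring_scheme \<Rightarrow> bool" where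
  "cohen_macaulay R \<longleftrightarrow> cring R \<and> noetherian_ring R \<and>
     (\<forall>P. maximalideal P R \<longrightarrow> ideal_depth R P = prime_height R P)"

end

theory Submission
  imports Defs "HOL-Computational_Algebra.Polynomial"
begin

text \<open>
  Call two distinct vertices of the tree near if some closed neighborhood contains both, that is, if
  their distance is at most two. For \<open>k = 2\<close> the neighborhood ideal \<open>I\<close> is generated by the products
  \<open>x\<^sub>a x\<^sub>b\<close> of near vertices, so it is the edge ideal of the square of the tree. Its minimal primes are
  generated by the complements of the maximal independent sets \<open>X\<close> (no two members near), and the
  quotient by such a prime is a polynomial ring in \<open>card X\<close> variables.

  \<^bold>\<open>Cohen--Macaulay implies the condition.\<close> Look at the origin. Killing the variables of an independent
  set \<open>X\<close> one by one is a chain of primes, so the height of the origin is at least \<open>card X\<close>. Its depth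
  is at most \<open>card Y\<close> for every maximal independent \<open>Y\<close>: a regular sequence is algebraically
  independent modulo the annihilator of the monomial \<open>x\<^sub>Y\<close>, and this annihilator contains all variables
  outside \<open>Y\<close> (\<open>regular_seq_imp_tower\<close>, \<open>tower_length_le\<close>). Hence all maximal independent sets have the
  same cardinality, and in a tree this forces the condition on joint vertices: two joint vertices with
  a common closed neighbor, or a vertex far from all joint vertices, allow an exchange that
  replaces one member of a maximal independent set by two (\<open>unmixed_imp_card_joint\<close>).

  \<^bold>\<open>The condition implies Cohen--Macaulay.\<close> The closed neighborhoods of the joint vertices \<open>w\<close> now
  partition the vertices into cliques of the nearness relation, and each clique contains a leaf that
  is near to nothing outside it. Let \<open>\<theta>\<^sub>w\<close> be the sum of the variables of such a clique. By Zariski's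
  lemma (\<open>zariski\<close>) a maximal ideal contains \<open>q\<^sub>w(\<theta>\<^sub>w)\<close> for some nonzero polynomials \<open>q\<^sub>w\<close> in one variable,
  and these elements are a regular sequence (\<open>regular_mod_nbhd_sum\<close>). An independent set has at most
  one member in each clique, so counting monomials shows that no chain of primes is longer. In every
  ring the depth of a prime is at most its height (\<open>regular_seq_imp_prime_tower\<close>), so depth and height agree.

  The commutative algebra is done with ideals of a whole ring type. The quotient ring of the theorem is
  reached from the type of all polynomials by a surjection whose kernel also contains
  the variables that are not vertices.
\<close>

section \<open>Ideals, primes and subrings of a ring type\<close>

global_interpretation ideals: Modules.module "(*) :: 'a::comm_ring_1 \<Rightarrow> 'a \<Rightarrow> 'a"
  by standard (simp_all add: algebra_simps)

\<comment> \<open>As a rewrite rule this is associativity in the direction opposite to that of \<open>algebra_simps\<close>; together they loop.\<close>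
declare ideals.scale_scale [simp del]

abbreviation is_ideal :: "'a::comm_ring_1 set \<Rightarrow> bool" where
  "is_ideal \<equiv> Modules.module.subspace (*)"

abbreviation ideal_span :: "'a::comm_ring_1 set \<Rightarrow> 'a set" where
  "ideal_span \<equiv> Modules.module.span (*)"

definition prime_set :: "'a::comm_ring_1 set \<Rightarrow> bool" where
  "prime_set P \<longleftrightarrow> is_ideal P \<and> 1 \<notin> P \<and> (\<forall>a b. a * b \<in> P \<longrightarrow> a \<in> P \<or> b \<in> P)"

lemma prime_set_ideal: "prime_set P \<Longrightarrow> is_ideal P"
  and prime_set_one: "prime_set P \<Longrightarrow> 1 \<notin> P"
  and prime_setD: "prime_set P \<Longrightarrow> a * b \<in> P \<Longrightarrow> a \<in> P \<or> b \<in> P"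
  by (auto simp: prime_set_def)

lemmas is_ideal_zero = ideals.subspace_0
  and is_ideal_add = ideals.subspace_add
  and is_ideal_diff = ideals.subspace_diff
  and is_ideal_sum = ideals.subspace_sum
  and is_ideal_span = ideals.subspace_span

lemma is_ideal_mult: "is_ideal J \<Longrightarrow> x \<in> J \<Longrightarrow> c * x \<in> J" 
  by (rule ideals.subspace_scale)

lemma is_ideal_mult_right: "is_ideal J \<Longrightarrow> x \<in> J \<Longrightarrow> x * c \<in> J" 
  using ideals.subspace_scale[of J x c] by (simp add: mult.commute)

lemma prime_set_power: "prime_set P \<Longrightarrow> a ^ k \<in> P \<Longrightarrow> a \<in> P"
  by (induction k) (auto dest: prime_setD simp: prime_set_one)

definition subring_set :: "'a::comm_ring_1 set \<Rightarrow> bool" where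
  "subring_set A \<longleftrightarrow> 1 \<in> A \<and> (\<forall>a\<in>A. \<forall>b\<in>A. a - b \<in> A \<and> a * b \<in> A)"

lemma subring_set_one: "subring_set A \<Longrightarrow> 1 \<in> A"
  and subring_set_diff: "subring_set A \<Longrightarrow> a \<in> A \<Longrightarrow> b \<in> A \<Longrightarrow> a - b \<in> A"
  and subring_set_mult: "subring_set A \<Longrightarrow> a \<in> A \<Longrightarrow> b \<in> A \<Longrightarrow> a * b \<in> A"
  by (auto simp: subring_set_def)

lemma subring_set_zero: "subring_set A \<Longrightarrow> 0 \<in> A"
  using subring_set_diff[of A 1 1] subring_set_one[of A] by simp

lemma subring_set_neg: "subring_set A \<Longrightarrow> a \<in> A \<Longrightarrow> - a \<in> A"
  using subring_set_diff[of A 0 a] subring_set_zero[of A] by simp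

lemma subring_set_add: "subring_set A \<Longrightarrow> a \<in> A \<Longrightarrow> b \<in> A \<Longrightarrow> a + b \<in> A"
  using subring_set_diff[of A a "- b"] subring_set_neg[of A b] by simp

lemma subring_set_sum: "subring_set A \<Longrightarrow> (\<And>i. i \<in> I \<Longrightarrow> f i \<in> A) \<Longrightarrow> sum f I \<in> A"
  by (induction I rule: infinite_finite_induct) (auto intro: subring_set_add simp: subring_set_zero)

lemma subring_set_power: "subring_set A \<Longrightarrow> a \<in> A \<Longrightarrow> a ^ k \<in> A"
  by (induction k) (auto intro: subring_set_mult simp: subring_set_one)

lemmas subring_set_intros = subring_set_one subring_set_zero subring_set_diff subring_set_neg
  subring_set_add subring_set_mult subring_set_sum subring_set_power

text \<open>
  Gaussian elimination without division: it applies over a domain, here presented as a subring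
  modulo a prime, without passing to the field of fractions.
\<close>

lemma dependent_mod_prime:
  fixes v :: "'i \<Rightarrow> 'j \<Rightarrow> 'a::comm_ring_1"
  assumes "finite J" "finite I" "card J < card I" and A: "subring_set A" and P: "prime_set P"
    and "\<And>i j. i \<in> I \<Longrightarrow> j \<in> J \<Longrightarrow> v i j \<in> A"
  shows "\<exists>c. (\<forall>i\<in>I. c i \<in> A) \<and> (\<exists>i\<in>I. c i \<notin> P) \<and> (\<forall>j\<in>J. (\<Sum>i\<in>I. c i * v i j) \<in> P)"
  using assms(1,2,3,6)
proof (induction J arbitrary: I v)
  case empty
  then have "I \<noteq> {}" by auto
  then show ?case
    using subring_set_one[OF A] prime_set_one[OF P] by (intro exI[of _ "\<lambda>_. 1"]) auto
next
  case (insert j J)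
  have Pi: "is_ideal P" using P by (rule prime_set_ideal)
  show ?case
  proof (cases "\<forall>i\<in>I. v i j \<in> P")
    case True
    have "card J < card I" using insert by simp
    then obtain c where c: "\<forall>i\<in>I. c i \<in> A" "\<exists>i\<in>I. c i \<notin> P" "\<forall>j\<in>J. (\<Sum>i\<in>I. c i * v i j) \<in> P"
      using insert.IH[OF \<open>finite I\<close>, of v] insert.prems by blast
    have "(\<Sum>i\<in>I. c i * v i j) \<in> P"
      using True by (intro is_ideal_sum[OF Pi] is_ideal_mult[OF Pi]) auto
    then show ?thesis using c by (intro exI[of _ c]) auto
  next
    case False
    then obtain p where p: "p \<in> I" "v p j \<notin> P" by auto
    define I' where "I' = I - {p}"
    define v' where "v' i k = v p j * v i k - v i j * v p k" for i k
    have I': "finite I'" "card J < card I'" "p \<notin> I'" "I = insert p I'"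
      using insert p by (auto simp: I'_def)
    have "v' i k \<in> A" if "i \<in> I'" "k \<in> J" for i k
      unfolding v'_def using that p insert.prems(3) I'_def by (intro subring_set_intros A) auto
    then obtain c where c: "\<forall>i\<in>I'. c i \<in> A" "\<exists>i\<in>I'. c i \<notin> P" "\<forall>k\<in>J. (\<Sum>i\<in>I'. c i * v' i k) \<in> P"
      using insert.IH[OF I'(1,2), of v'] by blast
    define d where "d i = (if i = p then - (\<Sum>i\<in>I'. c i * v i j) else c i * v p j)" for i
    have sum_d: "(\<Sum>i\<in>I. d i * v i k) = (\<Sum>i\<in>I'. c i * v' i k)" for k
    proof -
      have "(\<Sum>i\<in>I. d i * v i k) = d p * v p k + (\<Sum>i\<in>I'. d i * v i k)"
        using I' by simp
      also have "(\<Sum>i\<in>I'. d i * v i k) = (\<Sum>i\<in>I'. c i * v p j * v i k)"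
        using I'(3) by (intro sum.cong) (auto simp: d_def)
      also have "d p * v p k = - (\<Sum>i\<in>I'. c i * v i j * v p k)"
        by (simp add: d_def sum_distrib_right)
      finally show ?thesis
        by (simp add: v'_def algebra_simps sum_subtractf)
    qed
    show ?thesis
    proof (intro exI[of _ d] conjI ballI)
      fix i assume "i \<in> I"
      then show "d i \<in> A"
        unfolding d_def using c(1) insert.prems(3) p I'_def by (auto intro!: subring_set_intros A)
    next
      obtain i where "i \<in> I'" "c i \<notin> P" using c(2) by auto
      then show "\<exists>i\<in>I. d i \<notin> P"
        using p(2) prime_setD[OF P, of "c i" "v p j"] I' by (intro bexI[of _ i]) (auto simp: d_def)
    next
      fix k assume "k \<in> insert j J"
      then show "(\<Sum>i\<in>I. d i * v i k) \<in> P"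
        unfolding sum_d
      proof
        assume "k = j"
        then show "(\<Sum>i\<in>I'. c i * v' i k) \<in> P"
          by (simp add: v'_def mult.commute is_ideal_zero[OF Pi])
      qed (use c(3) in auto)
    qed
  qed
qed

section \<open>Zariski's lemma\<close>

definition polys_in :: "'a::comm_ring_1 set \<Rightarrow> 'a poly set" where
  "polys_in A = {f. \<forall>k. coeff f k \<in> A}"

lemma polys_inD: "f \<in> polys_in A \<Longrightarrow> coeff f k \<in> A"
  by (simp add: polys_in_def)

lemma subring_polys_in:
  assumes "subring_set A" shows "subring_set (polys_in A)"
  unfolding subring_set_def polys_in_def using assms
  by (auto simp: coeff_mult coeff_1 intro!: subring_set_intros)

lemma ideal_polys_in:
  assumes "is_ideal P" shows "is_ideal (polys_in P)"
  unfolding polys_in_def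
  by (rule ideals.subspaceI) (auto simp: coeff_mult intro!: is_ideal_zero[OF assms] 
       is_ideal_add[OF assms] is_ideal_sum[OF assms] is_ideal_mult[OF assms])

lemma monom_polys_in: "0 \<in> A \<Longrightarrow> a \<in> A \<Longrightarrow> monom a n \<in> polys_in A"
  by (auto simp: polys_in_def)

lemma smult_polys_in: "subring_set A \<Longrightarrow> a \<in> A \<Longrightarrow> f \<in> polys_in A \<Longrightarrow> smult a f \<in> polys_in A"
  by (auto simp: polys_in_def intro: subring_set_intros)

lemma poly_polys_in_subring:
  assumes "subring_set A" "f \<in> polys_in A" "x \<in> A" shows "poly f x \<in> A"
  unfolding poly_altdef using assms by (auto intro!: subring_set_intros simp: polys_inD)

lemma poly_polys_in_ideal:
  assumes "is_ideal P" "f \<in> polys_in P" shows "poly f x \<in> P"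
  unfolding poly_altdef using assms
  by (auto intro!: is_ideal_sum is_ideal_mult_right simp: polys_inD)

definition adjoin :: "'a::comm_ring_1 set \<Rightarrow> 'a \<Rightarrow> 'a set" where
  "adjoin A x = (\<lambda>f. poly f x) ` polys_in A"

lemma subring_adjoin:
  assumes "subring_set A" shows "subring_set (adjoin A x)"
  unfolding subring_set_def
proof (intro conjI ballI)
  note B = subring_polys_in[OF assms]
  show "1 \<in> adjoin A x"
    unfolding adjoin_def using subring_set_one[OF B] by (intro image_eqI[of _ _ 1]) auto
  fix a b assume "a \<in> adjoin A x" "b \<in> adjoin A x"
  then obtain f g where "f \<in> polys_in A" "g \<in> polys_in A" and ab: "a = poly f x" "b = poly g x"
    by (auto simp: adjoin_def)
  then have "f - g \<in> polys_in A" "f * g \<in> polys_in A"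
    by (auto intro: subring_set_intros B)
  then show "a - b \<in> adjoin A x" "a * b \<in> adjoin A x"
    unfolding adjoin_def ab poly_diff[symmetric] poly_mult[symmetric] by blast+
qed

lemma subset_adjoin: "subring_set A \<Longrightarrow> A \<subseteq> adjoin A x"
  unfolding adjoin_def
  by (auto intro!: image_eqI[of _ _ "[:_:]"] simp: polys_in_def coeff_pCons subring_set_zero split: nat.splits)

lemma in_adjoin: "subring_set A \<Longrightarrow> x \<in> adjoin A x"
  unfolding adjoin_def
  by (auto intro!: image_eqI[of _ _ "[:0, 1:]"] simp: polys_in_def coeff_pCons subring_set_zero subring_set_one split: nat.splits)

text \<open>
  Modulo the prime \<open>P\<close>, the ring \<open>A\<close> becomes a field after inverting the
  single element \<open>a\<close>. Such domains are Goldman domains (G-domains).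
\<close>

definition goldman :: "'a::comm_ring_1 set \<Rightarrow> 'a set \<Rightarrow> bool" where
  "goldman P A \<longleftrightarrow> (\<exists>a\<in>A. a \<notin> P \<and> (\<forall>b\<in>A. b \<notin> P \<longrightarrow> (\<exists>c\<in>A. \<exists>k. b * c - a ^ k \<in> P)))"

lemma ex_top_coeff:
  assumes "f \<notin> polys_in P" "0 \<in> P"
  shows "\<exists>d. coeff f d \<notin> P \<and> (\<forall>i>d. coeff f i \<in> P)"
proof -
  let ?S = "{i. coeff f i \<notin> P}"
  have fin: "finite ?S"
    using assms(2) by (intro finite_subset[of ?S "{..degree f}"]) (auto intro: le_degree)
  have ne: "?S \<noteq> {}" using assms(1) by (auto simp: polys_in_def)
  have "Max ?S \<in> ?S" using Max_in[OF fin ne] .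
  moreover have "i \<le> Max ?S" if "i \<in> ?S" for i using Max_ge[OF fin that] .
  ultimately show ?thesis by (intro exI[of _ "Max ?S"]) force
qed

lemma top_coeff_mult:
  assumes J: "is_ideal J" and f: "\<And>i. i > d \<Longrightarrow> coeff f i \<in> J" and g: "\<And>i. i > e \<Longrightarrow> coeff g i \<in> J"
  shows "coeff (f * g) (d + e) - coeff f d * coeff g e \<in> J"
proof -
  have "coeff (f * g) (d + e) - coeff f d * coeff g e = (\<Sum>i\<in>{..d+e} - {d}. coeff f i * coeff g (d + e - i))"
    unfolding coeff_mult by (subst sum.remove[of _ d]) auto
  also have "\<dots> \<in> J"
  proof (rule is_ideal_sum[OF J])
    fix i assume i: "i \<in> {..d+e} - {d}"
    show "coeff f i * coeff g (d + e - i) \<in> J"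
    proof (cases "i > d")
      case True
      then show ?thesis using f by (intro is_ideal_mult_right[OF J])
    next
      case False
      then show ?thesis using i g by (intro is_ideal_mult[OF J]) auto
    qed
  qed
  finally show ?thesis .
qed

text \<open>
  The factor \<open>1 + X f\<close> has positive degree modulo \<open>P\<close>, and degrees add
  up over a domain, so no multiple of it is a nonzero constant.
\<close>

lemma not_unit_mod_prime:
  fixes f g :: "'a::comm_ring_1 poly"
  assumes P: "prime_set P" and f: "f \<notin> polys_in P" and c: "c \<notin> P"
  shows "(1 + pCons 0 f) * g - [:c:] \<notin> polys_in P"
proof
  note Pi = prime_set_ideal[OF P] and P0 = is_ideal_zero[OF prime_set_ideal[OF P]]
  let ?h = "1 + pCons 0 f"
  assume *: "?h * g - [:c:] \<in> polys_in P"
  have "g \<notin> polys_in P"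
  proof
    assume "g \<in> polys_in P"
    then have "[:c:] \<in> polys_in P"
      using * is_ideal_diff[OF ideal_polys_in[OF Pi], of "?h * g" "?h * g - [:c:]"]
        is_ideal_mult[OF ideal_polys_in[OF Pi]] by auto
    then show False using c polys_inD[of "[:c:]" P 0] by auto
  qed
  then obtain e where e: "coeff g e \<notin> P" "\<And>i. i > e \<Longrightarrow> coeff g i \<in> P"
    using ex_top_coeff P0 by blast
  obtain d where d: "coeff f d \<notin> P" "\<And>i. i > d \<Longrightarrow> coeff f i \<in> P"
    using ex_top_coeff[OF f P0] by blast
  have "coeff ?h (Suc d) * coeff g e \<notin> P"
    using d(1) e(1) prime_setD[OF P] by auto
  moreover have "\<And>i. i > Suc d \<Longrightarrow> coeff ?h i \<in> P"
    using d P0 by (auto simp: coeff_pCons coeff_1 split: nat.splits)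
  from top_coeff_mult[OF Pi this e(2)]
  have "coeff (?h * g) (Suc d + e) - coeff ?h (Suc d) * coeff g e \<in> P" by blast
  ultimately have "coeff (?h * g) (Suc d + e) \<notin> P"
    using is_ideal_diff[OF Pi] by fastforce
  moreover have "coeff (?h * g) (Suc d + e) = coeff (?h * g - [:c:]) (Suc d + e)"
    by (simp only: coeff_diff) simp
  ultimately show False using polys_inD[OF *, of "Suc d + e"] by simp
qed

text \<open>
  This is Euclid's argument for the infinity of primes: if \<open>x\<close> were transcendental
  over \<open>A\<close> and inverting \<open>u(x)\<close> made \<open>A[x]\<close> a field, then
  \<open>1 + x u(x)\<close> would divide a power of \<open>u(x)\<close>; being coprime to it, it
  would be a unit.
\<close>

lemma goldman_imp_algebraic:
  assumes A: "subring_set A" and P: "prime_set P" and "goldman P (adjoin A x)"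
  shows "\<exists>f\<in>polys_in A. f \<notin> polys_in P \<and> poly f x \<in> P"
proof (rule ccontr)
  note Pi = prime_set_ideal[OF P] and Ax = subring_polys_in[OF A]
  note PXi = ideal_polys_in[OF Pi]
  assume "\<not> ?thesis"
  then have tr: "f \<in> polys_in P" if "f \<in> polys_in A" "poly f x \<in> P" for f
    using that by blast
  obtain u where u: "u \<in> polys_in A" "poly u x \<notin> P"
    "\<And>b. b \<in> adjoin A x \<Longrightarrow> b \<notin> P \<Longrightarrow> \<exists>c\<in>adjoin A x. \<exists>k. b * c - poly u x ^ k \<in> P"
    using assms(3) by (auto simp: goldman_def adjoin_def)
  have uP: "u \<notin> polys_in P" using u poly_polys_in_ideal[OF Pi] by blast
  define h where "h = 1 + pCons 0 u"
  have "pCons 0 u \<in> polys_in A"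
    using u(1) subring_set_zero[OF A] by (auto simp: polys_in_def coeff_pCons split: nat.splits)
  then have hA: "h \<in> polys_in A"
    unfolding h_def by (intro subring_set_intros Ax)
  have "coeff h 0 = 1" by (simp add: h_def)
  then have "h \<notin> polys_in P" using prime_set_one[OF P] by (metis polys_inD)
  then have "poly h x \<notin> P" using tr hA by blast
  moreover have "poly h x \<in> adjoin A x" using hA by (auto simp: adjoin_def)
  ultimately obtain w k where w: "w \<in> polys_in A" "poly h x * poly w x - poly u x ^ k \<in> P"
    using u(3) by (force simp: adjoin_def)
  have "h * w - u ^ k \<in> polys_in P"
    using w hA u(1) by (intro tr subring_set_intros Ax) (auto simp: poly_power)
  then have 1: "monom 1 k * (h * w - u ^ k) \<in> polys_in P"
    by (rule is_ideal_mult[OF PXi])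
  have "h - 1 = monom 1 1 * u" by (simp add: h_def monom_Suc)
  then have hk: "monom 1 k * u ^ k = (h - 1) ^ k"
    by (simp add: power_mult_distrib monom_power)
  \<comment> \<open>Modulo \<open>h\<close> the element \<open>X u\<close> is \<open>-1\<close>, so the power of \<open>u\<close> that \<open>h\<close> divides is a unit modulo \<open>h\<close>.\<close>
  have "h dvd (h - 1) ^ k - (- 1) ^ k"
    using power_diff_sumr2[of "h - 1" k "-1"] by auto
  then obtain g where g: "(h - 1) ^ k - (- 1) ^ k = h * g" by blast
  have "(- 1 :: 'a poly) = [:-1:]" by (simp add: one_pCons)
  then have "(- 1 :: 'a poly) ^ k = [:(-1) ^ k:]" by (simp only: poly_const_pow)
  moreover have "(h - 1) ^ k = h * g + (- 1) ^ k" using g by (metis diff_add_cancel)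
  moreover have "monom 1 k * (h * w - u ^ k) = h * (monom 1 k * w) - monom 1 k * u ^ k"
    by (simp only: right_diff_distrib mult.left_commute)
  ultimately have "monom 1 k * (h * w - u ^ k) = h * (monom 1 k * w - g) - [:(-1) ^ k:]"
    using hk by (simp only: right_diff_distrib diff_diff_eq)
  with 1 have *: "h * (monom 1 k * w - g) - [:(-1) ^ k:] \<in> polys_in P" by (simp only:)
  have "(-1) ^ k \<notin> P"
  proof
    assume "(-1) ^ k \<in> P"
    then have "- 1 \<in> P" by (rule prime_set_power[OF P])
    from ideals.subspace_neg[OF Pi this] show False using prime_set_one[OF P] by simp
  qed
  from not_unit_mod_prime[OF P uP this] * show False unfolding h_def by (rule notE)
qed

text \<open>
  Let \<open>r\<close> be a relation of least degree \<open>m\<close> for \<open>x\<close> over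
  \<open>A\<close>, with leading coefficient \<open>l\<close>. Up to powers of \<open>l\<close>
  every element of \<open>A[x]\<close> is a combination of \<open>1, x, \<dots>,
  x\<^sup>m\<^sup>-\<^sup>1\<close>, and these are independent over \<open>A\<close>. If
  \<open>a\<close> is the element to invert in \<open>A[x]\<close>, then it divides some \<open>e
  \<in> A\<close>. A divisor \<open>b \<in> A\<close> of a power of \<open>e\<close> in
  \<open>A[x]\<close> divides it, up to a power of \<open>l\<close>, already in \<open>A\<close>:
  compare the coefficients of \<open>1\<close>. So inverting \<open>l e\<close> suffices.
\<close>

lemma goldman_adjoin_imp_goldman:
  assumes A: "subring_set A" and P: "prime_set P" and G: "goldman P (adjoin A x)"
  shows "goldman P A"
proof -
  note Pi = prime_set_ideal[OF P] and Ax = subring_polys_in[OF A]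
  note PXi = ideal_polys_in[OF Pi] and P0 = is_ideal_zero[OF prime_set_ideal[OF P]]
  note A0 = subring_set_zero[OF A] and Padd = is_ideal_add[OF Pi] and Pdiff = is_ideal_diff[OF Pi]
  define Rel where "Rel f \<longleftrightarrow> f \<in> polys_in A \<and> f \<notin> polys_in P \<and> poly f x \<in> P" for f
  have "\<exists>f. Rel f" using goldman_imp_algebraic[OF assms] by (auto simp: Rel_def)
  define r where "r = (ARG_MIN degree f. Rel f)"
  have r: "Rel r" and rmin: "\<And>f. Rel f \<Longrightarrow> degree r \<le> degree f"
    unfolding r_def using \<open>\<exists>f. Rel f\<close> by (auto intro: arg_min_natI arg_min_nat_le)
  define m where "m = degree r"
  define l where "l = lead_coeff r"
  have rA: "r \<in> polys_in A" and rP: "r \<notin> polys_in P" and rx: "poly r x \<in> P"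
    using r by (auto simp: Rel_def)
  have lA: "l \<in> A" using rA by (simp add: l_def polys_inD)
  have low: "f \<in> polys_in P" if "f \<in> polys_in A" "poly f x \<in> P" "\<And>j. j \<ge> m \<Longrightarrow> coeff f j = 0" "m > 0" for f
  proof (rule ccontr)
    assume "f \<notin> polys_in P"
    then have "Rel f" using that by (auto simp: Rel_def)
    then have "m \<le> degree f" unfolding m_def by (rule rmin)
    then have "lead_coeff f = 0" using that by blast
    then have "f = 0" by simp
    then show False using \<open>f \<notin> polys_in P\<close> P0 by (auto simp: polys_in_def)
  qed
  have m: "m > 0"
  proof (rule ccontr)
    assume "\<not> m > 0"
    then obtain c where c: "r = [:c:]" using degree_eq_zeroE[of r] by (auto simp: m_def)
    then have "c \<in> P" using rx by simp
    then show False using rP monom_polys_in[OF P0, of c 0] by (simp add: c monom_0)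
  qed
  have lP: "l \<notin> P"
  proof
    assume l: "l \<in> P"
    define f where "f = r - monom l m"
    have "f \<in> polys_in A" unfolding f_def using rA lA A0 by (intro subring_set_intros A Ax monom_polys_in)
    moreover have "poly f x \<in> P"
      unfolding f_def using rx l by (auto simp: poly_monom intro!: Pdiff is_ideal_mult_right[OF Pi])
    moreover have "coeff f j = 0" if "j \<ge> m" for j
      using that by (cases "j = m") (auto simp: f_def l_def m_def coeff_eq_0)
    ultimately have "f \<in> polys_in P" using low m by blast
    then have "f + monom l m \<in> polys_in P"
      using l P0 by (intro is_ideal_add[OF PXi] monom_polys_in)
    then show False using rP by (simp add: f_def)
  qed
  have reduce: "\<exists>N. \<exists>f\<in>polys_in A. (\<forall>j\<ge>m. coeff f j = 0) \<and> l ^ N * poly g x - poly f x \<in> P"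
    if "g \<in> polys_in A" "\<forall>j\<ge>n. coeff g j = 0" for g n
    using that
  proof (induction n arbitrary: g)
    case 0
    then have "g = 0" by (auto simp: poly_eq_iff)
    then show ?case using P0 by (intro exI[of _ 0] bexI[of _ 0]) (auto simp: polys_in_def A0)
  next
    case (Suc n)
    show ?case
    proof (cases "n < m")
      case True
      then show ?thesis using Suc.prems P0 by (intro exI[of _ 0] bexI[of _ g]) auto
    next
      case False
      define q where "q = monom (coeff g n) (n - m) * r"
      define g' where "g' = smult l g - q"
      have gA: "g' \<in> polys_in A"
        unfolding g'_def q_def using Suc.prems(1) lA rA A0
        by (intro subring_set_intros A Ax monom_polys_in smult_polys_in A) (auto simp: polys_inD)
      have coeff_q: "coeff q j = coeff g n * coeff r (j - (n - m))" if "j \<ge> n" for j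
        using that False by (simp add: q_def coeff_monom_mult)
      have "coeff g' j = 0" if "j \<ge> n" for j
      proof (cases "j = n")
        case True
        then show ?thesis using False by (simp add: g'_def coeff_q l_def m_def)
      next
        case 2: False
        then have "coeff r (j - (n - m)) = 0" using that False by (intro coeff_eq_0) (auto simp: m_def)
        then show ?thesis using 2 that Suc.prems(2) by (simp add: g'_def coeff_q)
      qed
      then obtain N f where f: "f \<in> polys_in A" "\<forall>j\<ge>m. coeff f j = 0" "l ^ N * poly g' x - poly f x \<in> P"
        using Suc.IH[OF gA] by blast
      have "l ^ N * (poly (monom (coeff g n) (n - m)) x * poly r x) \<in> P"
        using rx by (intro is_ideal_mult[OF Pi])
      from Padd[OF f(3) this] have "l ^ Suc N * poly g x - poly f x \<in> P"
        by (simp add: g'_def q_def algebra_simps)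
      then show ?thesis using f by blast
    qed
  qed
  have reduce': "\<exists>N. \<exists>f\<in>polys_in A. (\<forall>j\<ge>m. coeff f j = 0) \<and> l ^ N * y - poly f x \<in> P"
    if y: "y \<in> adjoin A x" for y
  proof -
    obtain g where "g \<in> polys_in A" "y = poly g x" using y by (auto simp: adjoin_def)
    then show ?thesis using reduce[of g "Suc (degree g)"] by (auto simp: coeff_eq_0)
  qed
  note Bx = subring_adjoin[OF A, of x]
  obtain a where a: "a \<in> adjoin A x" "a \<notin> P"
    "\<And>b. b \<in> adjoin A x \<Longrightarrow> b \<notin> P \<Longrightarrow> \<exists>c\<in>adjoin A x. \<exists>k. b * c - a ^ k \<in> P"
    using G by (auto simp: goldman_def)
  have "\<forall>i. \<exists>N. \<exists>f\<in>polys_in A. (\<forall>j\<ge>m. coeff f j = 0) \<and> l ^ N * a ^ i - poly f x \<in> P"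
    using a(1) by (intro allI reduce' subring_set_intros Bx)
  then obtain N F where F: "\<And>i. F i \<in> polys_in A" "\<And>i j. j \<ge> m \<Longrightarrow> coeff (F i) j = 0"
    "\<And>i. l ^ N i * a ^ i - poly (F i) x \<in> P"
    by metis
  have polyF: "poly (F i) x = (\<Sum>j<m. coeff (F i) j * x ^ j)" for i
  proof -
    have "degree (F i) < m" using F(2) m by (metis degree_0 leading_coeff_0_iff not_le)
    then show ?thesis
      unfolding poly_altdef by (intro sum.mono_neutral_left) (auto simp: coeff_eq_0)
  qed
  \<comment> \<open>The \<open>m + 1\<close> powers of \<open>a\<close> have only \<open>m\<close> coordinates, so they are dependent over \<open>A\<close>.\<close>
  have "\<exists>c. (\<forall>i\<in>{..m}. c i \<in> A) \<and> (\<exists>i\<in>{..m}. c i \<notin> P) \<and> (\<forall>j\<in>{..<m}. (\<Sum>i\<in>{..m}. c i * coeff (F i) j) \<in> P)"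
    by (rule dependent_mod_prime[OF _ _ _ A P]) (auto simp: polys_inD[OF F(1)])
  then obtain c where c: "\<And>i. i \<le> m \<Longrightarrow> c i \<in> A" "\<exists>i\<le>m. c i \<notin> P" "\<And>j. j < m \<Longrightarrow> (\<Sum>i\<le>m. c i * coeff (F i) j) \<in> P"
    by auto
  have rel_a: "(\<Sum>i\<le>m. (c i * l ^ N i) * a ^ i) \<in> P"
  proof -
    have "(\<Sum>i\<le>m. c i * poly (F i) x) = (\<Sum>j<m. (\<Sum>i\<le>m. c i * coeff (F i) j) * x ^ j)"
      unfolding polyF sum_distrib_left sum_distrib_right by (subst sum.swap) (simp add: mult_ac)
    also have "\<dots> \<in> P"
      by (rule is_ideal_sum[OF Pi], rule is_ideal_mult_right[OF Pi], rule c(3)) simp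
    finally have 1: "(\<Sum>i\<le>m. c i * poly (F i) x) \<in> P" .
    have "(\<Sum>i\<le>m. c i * (l ^ N i * a ^ i - poly (F i) x)) \<in> P"
      by (intro is_ideal_sum[OF Pi] is_ideal_mult[OF Pi] F(3))
    from Padd[OF this 1] show ?thesis by (simp add: algebra_simps sum_subtractf)
  qed
  define d where "d i = c i * l ^ N i" for i
  have dA: "d i \<in> A" if "i \<le> m" for i
    unfolding d_def using c(1)[OF that] lA by (intro subring_set_intros A)
  have "\<exists>i\<le>m. d i \<notin> P"
    using c(2) lP unfolding d_def by (meson P prime_setD prime_set_power)
  then obtain i0 where i0: "i0 \<le> m" "d i0 \<notin> P" "\<And>i. i < i0 \<Longrightarrow> d i \<in> P"
    using exists_least_iff[of "\<lambda>i. i \<le> m \<and> d i \<notin> P"] by (metis less_le_trans less_imp_le)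
  \<comment> \<open>The lowest coefficient outside \<open>P\<close> of a relation for \<open>a\<close> is a multiple of \<open>a\<close> modulo \<open>P\<close>.\<close>
  define e where "e = d i0"
  define z where "z = (\<Sum>i\<in>{i0<..m}. d i * a ^ (i - Suc i0))"
  have zB: "z \<in> adjoin A x"
    unfolding z_def using dA a(1) subset_adjoin[OF A, of x] by (intro subring_set_intros Bx) auto
  have ez: "e + a * z \<in> P"
  proof -
    have split: "(\<Sum>i\<le>m. d i * a ^ i) = (\<Sum>i<i0. d i * a ^ i) + (\<Sum>i\<in>{i0..m}. d i * a ^ i)"
      using i0(1) by (subst sum.union_disjoint[symmetric]) (auto intro!: sum.cong)
    have "(\<Sum>i<i0. d i * a ^ i) \<in> P"
      using i0 by (intro is_ideal_sum[OF Pi] is_ideal_mult_right[OF Pi]) auto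
    moreover have "(\<Sum>i\<le>m. d i * a ^ i) \<in> P" using rel_a by (simp only: d_def)
    ultimately have "(\<Sum>i\<in>{i0..m}. d i * a ^ i) \<in> P"
      using Pdiff unfolding split by fastforce
    also have "(\<Sum>i\<in>{i0..m}. d i * a ^ i) = (\<Sum>i\<in>{i0..m}. a ^ i0 * (d i * a ^ (i - i0)))"
      by (intro sum.cong) (auto simp: power_add[symmetric] mult.left_commute)
    also have "\<dots> = a ^ i0 * (\<Sum>i\<in>{i0..m}. d i * a ^ (i - i0))"
      by (simp add: sum_distrib_left)
    also have "{i0..m} = insert i0 {i0<..m}" using i0(1) by auto
    also have "(\<Sum>i\<in>insert i0 {i0<..m}. d i * a ^ (i - i0)) = e + (\<Sum>i\<in>{i0<..m}. d i * a ^ (i - i0))"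
      by (simp add: e_def)
    also have "(\<Sum>i\<in>{i0<..m}. d i * a ^ (i - i0)) = a * z"
      unfolding z_def sum_distrib_left
    proof (intro sum.cong refl)
      fix i assume "i \<in> {i0<..m}"
      then have "i - i0 = Suc (i - Suc i0)" by auto
      then show "d i * a ^ (i - i0) = a * (d i * a ^ (i - Suc i0))"
        by (simp only: power_Suc mult.left_commute)
    qed
    finally show ?thesis using prime_setD[OF P] prime_set_power[OF P] a(2) by blast
  qed
  have eP: "e \<notin> P" and eA: "e \<in> A" using i0 dA by (auto simp: e_def)
  show ?thesis
    unfolding goldman_def
  proof (rule bexI[of _ "l * e"], intro conjI ballI impI)
    show "l * e \<in> A" using lA eA by (intro subring_set_intros A)
    show "l * e \<notin> P" using prime_setD[OF P] lP eP by blast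
    fix b assume b: "b \<in> A" "b \<notin> P"
    then obtain w k where w: "w \<in> adjoin A x" "b * w - a ^ k \<in> P"
      using a(3) subset_adjoin[OF A, of x] by blast
    define w' where "w' = (- z) ^ k * w"
    have "w' \<in> adjoin A x" unfolding w'_def using zB w by (intro subring_set_intros Bx)
    then obtain M f where f: "f \<in> polys_in A" "\<And>j. j \<ge> m \<Longrightarrow> coeff f j = 0" "l ^ M * w' - poly f x \<in> P"
      using reduce' by blast
    have "e ^ k - (a * (- z)) ^ k = (e + a * z) * (\<Sum>i<k. e ^ i * (a * (-z)) ^ (k - Suc i))"
      using power_diff_sumr2[of e k "a * (-z)"] by (simp add: mult.commute)
    then have "e ^ k - (a * (- z)) ^ k \<in> P" using ez is_ideal_mult_right[OF Pi] by auto
    then have 1: "l ^ M * (e ^ k - (a * (- z)) ^ k) \<in> P" by (rule is_ideal_mult[OF Pi])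
    have 2: "l ^ M * (- z) ^ k * (b * w - a ^ k) \<in> P" using w(2) by (rule is_ideal_mult[OF Pi])
    have 3: "b * (l ^ M * w' - poly f x) \<in> P" using f(3) by (rule is_ideal_mult[OF Pi])
    have "b * poly f x - l ^ M * e ^ k =
        l ^ M * (- z) ^ k * (b * w - a ^ k) - b * (l ^ M * w' - poly f x) - l ^ M * (e ^ k - (a * (- z)) ^ k)"
      unfolding w'_def power_mult_distrib[of a "- z" k] by (simp add: algebra_simps)
    also have "\<dots> \<in> P" by (intro Pdiff 1 2 3)
    finally have "poly (smult b f - [:l ^ M * e ^ k:]) x \<in> P" by simp
    moreover have "smult b f - [:l ^ M * e ^ k:] \<in> polys_in A"
      using b f lA eA by (intro subring_set_intros A Ax smult_polys_in A)
        (auto simp: polys_in_def coeff_pCons A0 intro!: subring_set_intros A split: nat.splits)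
    moreover have "coeff (smult b f - [:l ^ M * e ^ k:]) j = 0" if "j \<ge> m" for j
      using that m f(2) by (auto simp: coeff_pCons split: nat.splits)
    ultimately have "smult b f - [:l ^ M * e ^ k:] \<in> polys_in P" using low m by blast
    from polys_inD[OF this, of 0] have "b * coeff f 0 - l ^ M * e ^ k \<in> P" by simp
    then have "(b * coeff f 0 - l ^ M * e ^ k) * (l ^ k * e ^ M) \<in> P" by (rule is_ideal_mult_right[OF Pi])
    then have "b * (coeff f 0 * (l ^ k * e ^ M)) - (l * e) ^ (M + k) \<in> P"
      by (simp add: algebra_simps power_add power_mult_distrib)
    moreover have "coeff f 0 * (l ^ k * e ^ M) \<in> A"
      using f(1) lA eA by (intro subring_set_intros A) (auto simp: polys_inD)
    ultimately show "\<exists>c\<in>A. \<exists>k. b * c - (l * e) ^ k \<in> P" by blast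
  qed
qed

fun adjoin_list :: "'a::comm_ring_1 set \<Rightarrow> 'a list \<Rightarrow> 'a set" where
  "adjoin_list A [] = A"
| "adjoin_list A (x # xs) = adjoin_list (adjoin A x) xs"

lemma subring_adjoin_list: "subring_set A \<Longrightarrow> subring_set (adjoin_list A xs)"
  by (induction xs arbitrary: A) (auto intro: subring_adjoin)

lemma subset_adjoin_list: "subring_set A \<Longrightarrow> A \<subseteq> adjoin_list A xs"
  by (induction xs arbitrary: A) (auto dest: subring_adjoin subset_adjoin)

lemma set_subset_adjoin_list: "subring_set A \<Longrightarrow> set xs \<subseteq> adjoin_list A xs"
proof (induction xs arbitrary: A)
  case (Cons x xs)
  then show ?case
    using in_adjoin[OF Cons.prems] subring_adjoin[OF Cons.prems] subset_adjoin_list by fastforce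
qed auto

lemma adjoin_list_mono: "A \<subseteq> A' \<Longrightarrow> adjoin_list A xs \<subseteq> adjoin_list A' xs"
proof (induction xs arbitrary: A A')
  case (Cons x xs)
  then have "adjoin A x \<subseteq> adjoin A' x"
    unfolding adjoin_def polys_in_def by (intro image_mono) auto
  then show ?case using Cons.IH by simp
qed simp

lemma goldman_adjoin_list:
  "subring_set A \<Longrightarrow> prime_set P \<Longrightarrow> goldman P (adjoin_list A xs) \<Longrightarrow> goldman P A"
  by (induction xs arbitrary: A) (auto intro: subring_adjoin goldman_adjoin_imp_goldman)

text \<open>
  The residue field at \<open>P\<close> is finitely generated over \<open>A\<close>, hence over
  \<open>A[t]\<close>, and a field is a Goldman domain. Removing the generators one at a time
  shows that \<open>A[t]\<close> is one, so \<open>t\<close> is algebraic.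
\<close>

lemma zariski:
  assumes A: "subring_set A" and P: "prime_set P"
    and inv: "\<And>y. y \<notin> P \<Longrightarrow> \<exists>z. y * z - 1 \<in> P"
    and gen: "\<And>y. \<exists>b\<in>adjoin_list A xs. y - b \<in> P"
  shows "\<exists>f\<in>polys_in A. f \<notin> polys_in P \<and> poly f t \<in> P"
proof (rule goldman_imp_algebraic[OF A P])
  note Pi = prime_set_ideal[OF P]
  note At = subring_adjoin[OF A, of t]
  let ?B = "adjoin_list A (t # xs)"
  have sub: "adjoin_list A xs \<subseteq> ?B"
    using adjoin_list_mono[OF subset_adjoin[OF A]] by simp
  have "goldman P ?B"
    unfolding goldman_def
  proof (rule bexI[of _ 1], intro conjI ballI impI)
    fix b assume "b \<in> ?B" "b \<notin> P"
    then obtain z where z: "b * z - 1 \<in> P" using inv by blast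
    obtain c where c: "c \<in> ?B" "z - c \<in> P" using gen sub by blast
    have "b * z - 1 - b * (z - c) \<in> P"
      by (intro is_ideal_diff[OF Pi] z is_ideal_mult[OF Pi] c)
    then show "\<exists>c\<in>?B. \<exists>k. b * c - 1 ^ k \<in> P" using c by (intro bexI[of _ c]) (auto simp: algebra_simps)
  next
    show "1 \<in> ?B" by (intro subring_set_one subring_adjoin_list A)
    show "1 \<notin> P" by (rule prime_set_one[OF P])
  qed
  then show "goldman P (adjoin A t)"
    using goldman_adjoin_list[OF At P] by simp
qed

section \<open>Hilbert's basis theorem\<close>

definition ideal_of :: "'a::comm_ring_1 set \<Rightarrow> 'a set \<Rightarrow> bool" where
  "ideal_of A J \<longleftrightarrow> J \<subseteq> A \<and> 0 \<in> J \<and> (\<forall>a\<in>J. \<forall>b\<in>J. a + b \<in> J) \<and> (\<forall>a\<in>J. \<forall>c\<in>A. c * a \<in> J)"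

text \<open>
  Finite generation is expressed by minimality among the ideals that contain \<open>G\<close>. So
  the proof of the basis theorem compares two ideals instead of manipulating linear combinations.
\<close>

definition noetherian_set :: "'a::comm_ring_1 set \<Rightarrow> bool" where
  "noetherian_set A \<longleftrightarrow> (\<forall>J. ideal_of A J \<longrightarrow>
     (\<exists>G. finite G \<and> G \<subseteq> J \<and> (\<forall>J'. ideal_of A J' \<longrightarrow> G \<subseteq> J' \<longrightarrow> J \<subseteq> J')))"

text \<open>
  For each degree \<open>d\<close> the leading coefficients of the members of \<open>J\<close>
  form an ideal \<open>L J d\<close> of \<open>A\<close>. These ideals increase and become
  stationary at some \<open>n\<close>. Polynomials that realize generators of \<open>L J 0,
  \<dots>, L J n\<close> generate \<open>J\<close>: in an ideal \<open>J' \<subseteq> J\<close>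
  that contains them the leading coefficients are the same in each degree, so lowering the degree
  step by step leads from \<open>J\<close> into \<open>J'\<close>.
\<close>

lemma noetherian_adjoin:
  assumes A: "subring_set A" and N: "noetherian_set A"
  shows "noetherian_set (adjoin A x)"
  unfolding noetherian_set_def
proof (intro allI impI)
  note Ax = subring_polys_in[OF A] and A0 = subring_set_zero[OF A]
  fix J assume J: "ideal_of (adjoin A x) J"
  define L where "L J d = {coeff f d | f. f \<in> polys_in A \<and> degree f \<le> d \<and> poly f x \<in> J}" for J d
  have L_ideal: "ideal_of A (L J d)" if J: "ideal_of (adjoin A x) J" for J d
    unfolding ideal_of_def
  proof (intro conjI ballI)
    show "L J d \<subseteq> A" by (auto simp: L_def polys_inD)
    show "0 \<in> L J d"
      using J subring_set_zero[OF Ax] by (auto simp: L_def ideal_of_def intro!: exI[of _ 0])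
    fix a assume "a \<in> L J d"
    then obtain f where f: "f \<in> polys_in A" "degree f \<le> d" "poly f x \<in> J" "a = coeff f d"
      by (auto simp: L_def)
    { fix b assume "b \<in> L J d"
      then obtain g where g: "g \<in> polys_in A" "degree g \<le> d" "poly g x \<in> J" "b = coeff g d"
        by (auto simp: L_def)
      have "f + g \<in> polys_in A" "degree (f + g) \<le> d" "poly (f + g) x \<in> J"
        using f g J by (auto intro: subring_set_intros A Ax degree_add_le simp: ideal_of_def)
      then show "a + b \<in> L J d" unfolding L_def using f g by (auto intro!: exI[of _ "f + g"]) }
    { fix c assume "c \<in> A"
      then have "smult c f \<in> polys_in A" "degree (smult c f) \<le> d" "poly (smult c f) x \<in> J"
        using f J subset_adjoin[OF A, of x] degree_smult_le[of c f]
        by (auto intro: smult_polys_in A simp: ideal_of_def)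
      then show "c * a \<in> L J d" unfolding L_def using f by (auto intro!: exI[of _ "smult c f"]) }
  qed
  have L_Suc: "L J d \<subseteq> L J (Suc d)" if J: "ideal_of (adjoin A x) J" for J d
  proof
    fix a assume "a \<in> L J d"
    then obtain f where f: "f \<in> polys_in A" "degree f \<le> d" "poly f x \<in> J" "a = coeff f d"
      by (auto simp: L_def)
    have "pCons 0 f \<in> polys_in A"
      using f A0 by (auto simp: polys_in_def coeff_pCons split: nat.splits)
    moreover have "degree (pCons 0 f) \<le> Suc d" using f by (metis Suc_le_mono degree_pCons_le le_trans)
    moreover have "poly (pCons 0 f) x \<in> J"
      using J f in_adjoin[OF A, of x] by (auto simp: ideal_of_def)
    ultimately show "a \<in> L J (Suc d)"
      unfolding L_def using f by (auto intro!: exI[of _ "pCons 0 f"])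
  qed
  have L_mono: "L J d \<subseteq> L J e" if "d \<le> e" "ideal_of (adjoin A x) J" for J d e
    using that(1) by (induction e rule: dec_induct) (use L_Suc[OF that(2)] in auto)
  define U where "U = (\<Union>d. L J d)"
  have "ideal_of A U"
    unfolding ideal_of_def
  proof (intro conjI ballI)
    show "U \<subseteq> A" "0 \<in> U" using L_ideal[OF J] unfolding U_def ideal_of_def by blast+
    fix a assume "a \<in> U"
    then obtain d where d: "a \<in> L J d" by (auto simp: U_def)
    { fix b assume "b \<in> U"
      then obtain e where e: "b \<in> L J e" by (auto simp: U_def)
      have "a \<in> L J (max d e)" "b \<in> L J (max d e)"
        using d e L_mono[OF _ J, of d "max d e"] L_mono[OF _ J, of e "max d e"] by auto
      then have "a + b \<in> L J (max d e)" using L_ideal[OF J] by (auto simp: ideal_of_def)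
      then show "a + b \<in> U" by (auto simp: U_def) }
    { fix c assume "c \<in> A"
      then have "c * a \<in> L J d" using d L_ideal[OF J] by (auto simp: ideal_of_def)
      then show "c * a \<in> U" by (auto simp: U_def) }
  qed
  then obtain G where G: "finite G" "G \<subseteq> U" "\<And>J'. ideal_of A J' \<Longrightarrow> G \<subseteq> J' \<Longrightarrow> U \<subseteq> J'"
    using N by (auto simp: noetherian_set_def)
  have "\<exists>n. G \<subseteq> L J n"
    using G(1,2)
  proof (induction G)
    case (insert g G)
    then obtain n where n: "G \<subseteq> L J n" by auto
    obtain e where e: "g \<in> L J e" using insert.prems by (auto simp: U_def)
    have "insert g G \<subseteq> L J (max n e)"
      using n e L_mono[OF _ J, of n "max n e"] L_mono[OF _ J, of e "max n e"] by auto
    then show ?case by blast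
  qed auto
  then obtain n where n: "G \<subseteq> L J n" by auto
  have stab: "L J d \<subseteq> L J n" for d
    using G(3)[OF L_ideal[OF J] n] by (auto simp: U_def)
  have "\<forall>d. \<exists>H. finite H \<and> H \<subseteq> L J d \<and> (\<forall>J'. ideal_of A J' \<longrightarrow> H \<subseteq> J' \<longrightarrow> L J d \<subseteq> J')"
    using N L_ideal[OF J] by (auto simp: noetherian_set_def)
  then obtain H where H: "\<And>d. finite (H d)" "\<And>d. H d \<subseteq> L J d"
    "\<And>d J'. ideal_of A J' \<Longrightarrow> H d \<subseteq> J' \<Longrightarrow> L J d \<subseteq> J'"
    by metis
  have "\<forall>d g. \<exists>f. g \<in> H d \<longrightarrow> f \<in> polys_in A \<and> degree f \<le> d \<and> poly f x \<in> J \<and> coeff f d = g"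
    using H(2) by (fastforce simp: L_def)
  then obtain F where F: "\<And>d g. g \<in> H d \<Longrightarrow> F d g \<in> polys_in A \<and> degree (F d g) \<le> d \<and> poly (F d g) x \<in> J \<and> coeff (F d g) d = g"
    by metis
  define K where "K = (\<Union>d\<in>{..n}. (\<lambda>g. poly (F d g) x) ` H d)"
  show "\<exists>G. finite G \<and> G \<subseteq> J \<and> (\<forall>J'. ideal_of (adjoin A x) J' \<longrightarrow> G \<subseteq> J' \<longrightarrow> J \<subseteq> J')"
  proof (intro exI[of _ K] conjI allI impI)
    show "finite K" using H by (auto simp: K_def)
    show KJ: "K \<subseteq> J" using F by (auto simp: K_def)
    fix J1 assume J1: "ideal_of (adjoin A x) J1" "K \<subseteq> J1"
    define J' where "J' = J \<inter> J1"
    have J': "ideal_of (adjoin A x) J'" using J J1 by (auto simp: J'_def ideal_of_def)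
    have HL: "L J d \<subseteq> L J' d" if "d \<le> n" for d
    proof (rule H(3)[OF L_ideal[OF J']], rule subsetI)
      fix g assume g: "g \<in> H d"
      then have "poly (F d g) x \<in> J'" using KJ J1 that by (auto simp: K_def J'_def)
      then show "g \<in> L J' d" unfolding L_def using F[OF g] by (auto intro!: exI[of _ "F d g"])
    qed
    have LL: "L J d \<subseteq> L J' d" for d
    proof (cases "d \<le> n")
      case False
      then show ?thesis using stab[of d] HL[of n] L_mono[OF _ J', of n d] by auto
    qed (rule HL)
    have "poly f x \<in> J'" if "f \<in> polys_in A" "degree f < d" "poly f x \<in> J" for f d
      using that
    proof (induction d arbitrary: f)
      case (Suc d)
      then have "coeff f d \<in> L J d" by (auto simp: L_def)
      then obtain g where g: "g \<in> polys_in A" "degree g \<le> d" "poly g x \<in> J'" "coeff f d = coeff g d"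
        using LL[of d] by (auto simp: L_def)
      have fg: "f - g \<in> polys_in A" "degree (f - g) \<le> d"
        using Suc.prems g by (auto intro: subring_set_intros A Ax degree_diff_le)
      have "poly (f - g) x = poly f x + (-1) * poly g x" by simp
      also have "\<dots> \<in> J"
        using J Suc.prems(3) g(3) subring_set_neg[OF subring_adjoin[OF A] subring_set_one[OF subring_adjoin[OF A]], of x]
        unfolding J'_def ideal_of_def by blast
      finally have fgJ: "poly (f - g) x \<in> J" .
      have "poly (f - g) x \<in> J'"
      proof (cases "f = g")
        case True
        then show ?thesis using J' by (auto simp: ideal_of_def)
      next
        case False
        have "coeff (f - g) d = 0" using g by simp
        then have "degree (f - g) < d" using fg(2) False
          by (metis eq_iff_diff_eq_0 le_neq_implies_less leading_coeff_0_iff)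
        then show ?thesis using Suc.IH fg fgJ by blast
      qed
      then have "poly (f - g) x + poly g x \<in> J'" using J' g(3) unfolding ideal_of_def by blast
      then show ?case by simp
    qed simp
    then have "J \<subseteq> J'" using J unfolding ideal_of_def adjoin_def by blast
    then show "J \<subseteq> J1" by (auto simp: J'_def)
  qed
qed

lemma noetherian_adjoin_list:
  "subring_set A \<Longrightarrow> noetherian_set A \<Longrightarrow> noetherian_set (adjoin_list A xs)"
  by (induction xs arbitrary: A) (auto intro: subring_adjoin noetherian_adjoin)

lemma noetherian_set_field:
  assumes "\<And>a. a \<in> A \<Longrightarrow> a \<noteq> 0 \<Longrightarrow> \<exists>b\<in>A. b * a = 1"
  shows "noetherian_set A"
  unfolding noetherian_set_def
proof (intro allI impI)
  fix J assume J: "ideal_of A J"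
  show "\<exists>G. finite G \<and> G \<subseteq> J \<and> (\<forall>J'. ideal_of A J' \<longrightarrow> G \<subseteq> J' \<longrightarrow> J \<subseteq> J')"
  proof (cases "J = {0}")
    case True
    then show ?thesis by (intro exI[of _ "{}"]) (auto simp: ideal_of_def)
  next
    case False
    moreover have "0 \<in> J" using J by (simp add: ideal_of_def)
    ultimately obtain a where a: "a \<in> J" "a \<noteq> 0" by blast
    have "a \<in> A" using a J by (auto simp: ideal_of_def)
    from assms[OF this a(2)] obtain b where b: "b \<in> A" "b * a = 1" by blast
    have "y \<in> J'" if "ideal_of A J'" "a \<in> J'" "y \<in> J" for y J'
    proof -
      have "1 \<in> J'" using that b by (auto simp: ideal_of_def b(2)[symmetric])
      moreover have "y \<in> A" using that(3) J by (auto simp: ideal_of_def)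
      ultimately have "y * 1 \<in> J'" using that(1) unfolding ideal_of_def by blast
      then show ?thesis by simp
    qed
    then show ?thesis using a(1) by (intro exI[of _ "{a}"]) (simp, blast)
  qed
qed

section \<open>Regular sequences and chains of primes\<close>

definition regular_mod :: "'a::comm_ring_1 \<Rightarrow> 'a set \<Rightarrow> bool" where
  "regular_mod x J \<longleftrightarrow> (\<forall>a. x * a \<in> J \<longrightarrow> a \<in> J)"

fun regular_seq :: "'a::comm_ring_1 set \<Rightarrow> 'a list \<Rightarrow> bool" where
  "regular_seq G [] \<longleftrightarrow> 1 \<notin> ideal_span G"
| "regular_seq G (x # xs) \<longleftrightarrow> regular_mod x (ideal_span G) \<and> regular_seq (insert x G) xs"

text \<open>
  An ideal that is maximal among those disjoint from a multiplicative set is prime.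
\<close>

lemma prime_set_avoiding:
  assumes J: "is_ideal J" and M1: "1 \<in> M" and M2: "\<And>a b. a \<in> M \<Longrightarrow> b \<in> M \<Longrightarrow> a * b \<in> M" and JM: "J \<inter> M = {}"
  shows "\<exists>P. prime_set P \<and> J \<subseteq> P \<and> P \<inter> M = {}"
proof -
  define C where "C = {I. is_ideal I \<and> J \<subseteq> I \<and> I \<inter> M = {}}"
  have "\<exists>P\<in>C. \<forall>X\<in>C. P \<subseteq> X \<longrightarrow> X = P"
  proof (rule subset_Zorn_nonempty)
    show "C \<noteq> {}" using J JM by (auto simp: C_def)
    fix D assume D: "D \<noteq> {}" "subset.chain C D"
    have mem: "I \<in> C" if "I \<in> D" for I using D(2) that by (auto simp: subset.chain_def)
    have lin: "I \<subseteq> I' \<or> I' \<subseteq> I" if "I \<in> D" "I' \<in> D" for I I'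
      using D(2) that unfolding subset.chain_def by blast
    have "is_ideal (\<Union> D)"
    proof (rule ideals.subspaceI)
      show "0 \<in> \<Union> D" using D(1) mem is_ideal_zero by (auto simp: C_def)
    next
      fix x y assume "x \<in> \<Union> D" "y \<in> \<Union> D"
      then obtain I I' where I: "I \<in> D" "I' \<in> D" "x \<in> I" "y \<in> I'" by blast
      then obtain I'' where "I'' \<in> D" "x \<in> I''" "y \<in> I''" using lin[of I I'] by blast
      then show "x + y \<in> \<Union> D" using mem[of I''] is_ideal_add[of I''] by (auto simp: C_def)
    next
      fix c x assume "x \<in> \<Union> D"
      then obtain I where "I \<in> D" "x \<in> I" by blast
      then show "c * x \<in> \<Union> D" using mem[of I] is_ideal_mult[of I] by (auto simp: C_def)
    qed
    then show "\<Union> D \<in> C" using D(1) mem by (auto simp: C_def)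
  qed
  then obtain P where P: "P \<in> C" "\<And>X. X \<in> C \<Longrightarrow> P \<subseteq> X \<Longrightarrow> X = P" by blast
  have Pi: "is_ideal P" and JP: "J \<subseteq> P" and PM: "P \<inter> M = {}" using P(1) by (auto simp: C_def)
  have ext: "\<exists>m\<in>M. \<exists>k. m - k * a \<in> P" if "a \<notin> P" for a
  proof (rule ccontr)
    assume *: "\<not> ?thesis"
    have "ideal_span P = P" using Pi by simp
    then have "ideal_span (insert a P) \<inter> M = {}"
      using * by (simp only: ideals.span_insert) blast
    moreover have "P \<subseteq> ideal_span (insert a P)" "a \<in> ideal_span (insert a P)"
      by (auto intro: ideals.span_base)
    ultimately have "ideal_span (insert a P) = P"
      using JP by (intro P(2)) (auto simp: C_def)
    then show False using \<open>a \<in> ideal_span (insert a P)\<close> that by simp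
  qed
  have "prime_set P"
    unfolding prime_set_def
  proof (intro conjI allI impI Pi)
    show "1 \<notin> P" using M1 PM by blast
    fix a b assume ab: "a * b \<in> P"
    show "a \<in> P \<or> b \<in> P"
    proof (rule ccontr)
      assume "\<not> (a \<in> P \<or> b \<in> P)"
      then obtain m k m' k' where m: "m \<in> M" "m - k * a \<in> P" "m' \<in> M" "m' - k' * b \<in> P"
        using ext by blast
      have "m * m' = m * (m' - k' * b) + k' * b * (m - k * a) + k * k' * (a * b)"
        by (simp add: algebra_simps)
      also have "\<dots> \<in> P"
        by (intro is_ideal_add[OF Pi] is_ideal_mult[OF Pi] m ab)
      finally show False using M2[OF m(1,3)] PM by blast
    qed
  qed
  then show ?thesis using JP PM by blast
qed

text \<open>
  The products \<open>f\<^sup>k s\<close> with \<open>s \<notin> P\<close> form a multiplicative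
  set that contains \<open>f\<close> and the complement of \<open>P\<close>. It is disjoint from
  \<open>J\<close> because \<open>f\<close> can be cancelled modulo \<open>J\<close>.
\<close>

lemma regular_imp_smaller_prime:
  assumes P: "prime_set P" and J: "is_ideal J" "J \<subseteq> P" and f: "f \<in> P" "regular_mod f J"
  shows "\<exists>P'. prime_set P' \<and> J \<subseteq> P' \<and> P' \<subset> P"
proof -
  define M where "M = {f ^ k * s | k s. s \<notin> P}"
  note one = prime_set_one[OF P]
  have "\<exists>P'. prime_set P' \<and> J \<subseteq> P' \<and> P' \<inter> M = {}"
  proof (rule prime_set_avoiding[OF J(1)])
    show "1 \<in> M" unfolding M_def using one by (intro CollectI exI[of _ 0] exI[of _ 1]) auto
    show "a * b \<in> M" if ab: "a \<in> M" "b \<in> M" for a b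
    proof -
      obtain k s k' s' where *: "a = f ^ k * s" "b = f ^ k' * s'" "s \<notin> P" "s' \<notin> P"
        using ab by (auto simp: M_def)
      have "a * b = f ^ (k + k') * (s * s')" unfolding * by (simp add: algebra_simps power_add)
      then show ?thesis unfolding M_def using * prime_setD[OF P, of s s'] by blast
    qed
    have "s \<in> J" if "f ^ k * s \<in> J" for k s
      using that f(2) by (induction k) (auto simp: regular_mod_def mult.assoc)
    then show "J \<inter> M = {}" using J(2) by (auto simp: M_def)
  qed
  then obtain P' where P': "prime_set P'" "J \<subseteq> P'" "P' \<inter> M = {}" by blast
  have "s \<in> M" if "s \<notin> P" for s
    unfolding M_def using that by (intro CollectI exI[of _ 0] exI[of _ s]) auto
  then have "P' \<subseteq> P" using P'(3) by blast
  moreover have "f \<in> M" unfolding M_def using one by (intro CollectI exI[of _ 1]) auto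
  ultimately show ?thesis using P' f(1) by blast
qed

definition prime_tower :: "'a::comm_ring_1 set list \<Rightarrow> bool" where
  "prime_tower ps \<longleftrightarrow> (\<forall>P\<in>set ps. prime_set P) \<and> sorted_wrt (\<subset>) ps"

lemma regular_seq_snoc:
  "regular_seq G (xs @ [x]) \<Longrightarrow> regular_mod x (ideal_span (set xs \<union> G))"
proof (induction xs arbitrary: G)
  case (Cons a xs)
  then show ?case using Cons.IH[of "insert a G"] by simp
qed simp

lemma regular_seq_butlast:
  "regular_seq G (xs @ [x]) \<Longrightarrow> 1 \<notin> ideal_span G' \<Longrightarrow> set xs \<union> G \<subseteq> G' \<Longrightarrow> regular_seq G xs"
proof (induction xs arbitrary: G)
  case Nil
  then show ?case by (auto dest: ideals.span_mono)
qed auto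

text \<open>
  Depth is at most height: the last member of the sequence yields a smaller prime, which contains
  the others.
\<close>

lemma regular_seq_imp_prime_tower:
  assumes "prime_set P" "G \<subseteq> P" "set fs \<subseteq> P" "regular_seq G fs"
  shows "\<exists>ps. prime_tower (ps @ [P]) \<and> length ps = length fs \<and> (\<forall>Q\<in>set ps. G \<subseteq> Q)"
  using assms
proof (induction fs arbitrary: P rule: rev_induct)
  case Nil
  then show ?case by (intro exI[of _ "[]"]) (auto simp: prime_tower_def)
next
  case (snoc f fs)
  let ?J = "ideal_span (set fs \<union> G)"
  have "\<exists>P'. prime_set P' \<and> ?J \<subseteq> P' \<and> P' \<subset> P"
  proof (rule regular_imp_smaller_prime)
    show "?J \<subseteq> P"
      using snoc.prems by (intro ideals.span_minimal) (auto simp: prime_set_ideal)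
    show "regular_mod f ?J" by (rule regular_seq_snoc[OF snoc.prems(4)])
  qed (use snoc.prems in auto)
  then obtain P' where P': "prime_set P'" "?J \<subseteq> P'" "P' \<subset> P" by blast
  have sub: "set fs \<union> G \<subseteq> P'" using P'(2) ideals.span_superset by blast
  have "1 \<notin> ideal_span P'" using P' by (metis ideals.span_eq_iff prime_set_ideal prime_set_one)
  then have "regular_seq G fs" using regular_seq_butlast[OF snoc.prems(4)] sub by blast
  then obtain ps where ps: "prime_tower (ps @ [P'])" "length ps = length fs" "\<forall>Q\<in>set ps. G \<subseteq> Q"
    using snoc.IH[of P'] P' sub by blast
  have "Q \<subset> P" if "Q \<in> set ps" for Q using ps(1) that P'(3) by (auto simp: prime_tower_def sorted_wrt_append)
  then have "prime_tower ((ps @ [P']) @ [P])"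
    using ps(1) P' snoc.prems(1) by (auto simp: prime_tower_def sorted_wrt_append)
  then show ?case using ps sub by (intro exI[of _ "ps @ [P']"]) auto
qed

section \<open>Towers of ideals\<close>

text \<open>
  A tower makes its elements algebraically independent modulo the lowest ideal. Both chains of
  primes and regular sequences give rise to towers, so one count bounds the lengths of both.
\<close>

fun tower :: "'a::comm_ring_1 set \<Rightarrow> 'a list \<Rightarrow> bool" where
  "tower Q [] \<longleftrightarrow> is_ideal Q \<and> 1 \<notin> Q"
| "tower Q (y # ys) \<longleftrightarrow> is_ideal Q \<and> regular_mod y Q \<and> (\<exists>Q'. Q \<subseteq> Q' \<and> y \<in> Q' \<and> tower Q' ys)"

lemma tower_ideal: "tower Q ys \<Longrightarrow> is_ideal Q"
  by (cases ys) auto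

lemma prime_tower_imp_tower:
  assumes "prime_tower (P # ps)"
  shows "\<exists>ys. length ys = length ps \<and> tower P ys"
  using assms
proof (induction ps arbitrary: P)
  case Nil
  then show ?case by (intro exI[of _ "[]"]) (auto simp: prime_tower_def prime_set_ideal prime_set_one)
next
  case (Cons P' ps)
  then have "prime_tower (P' # ps)" "prime_set P" "P \<subset> P'" by (auto simp: prime_tower_def)
  then obtain ys where ys: "length ys = length ps" "tower P' ys" using Cons.IH by blast
  obtain y where "y \<in> P'" "y \<notin> P" using \<open>P \<subset> P'\<close> by blast
  then have "tower P (y # ys)"
    using ys \<open>prime_set P\<close> \<open>P \<subset> P'\<close> by (auto simp: prime_set_ideal regular_mod_def dest: prime_setD)
  then show ?case using ys by (intro exI[of _ "y # ys"]) auto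
qed

text \<open>
  This is the ascending chain condition for ideals above \<open>G\<close>, in the form in which
  Krull's argument uses it.
\<close>

definition noetherian_over :: "'a::comm_ring_1 set \<Rightarrow> bool" where
  "noetherian_over G \<longleftrightarrow> (\<forall>v :: nat \<Rightarrow> 'a. \<exists>k. v k \<in> ideal_span (G \<union> v ` {..<k}))"

lemma noetherian_over_mono: "noetherian_over G \<Longrightarrow> G \<subseteq> G' \<Longrightarrow> noetherian_over G'"
  unfolding noetherian_over_def
  by (meson Un_mono ideals.span_mono order_refl subsetD)

text \<open>
  Krull's intersection theorem at the prime \<open>P\<close>: an element \<open>u\<close> that is
  nonzero in the localization at \<open>P\<close> is not divisible there by all powers of \<open>f
  \<in> P\<close>. If \<open>s\<^sub>k u = f\<^sup>k v\<^sub>k\<close> for all \<open>k\<close>,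
  then some \<open>v\<^sub>k\<close> is a combination of its predecessors. Multiplying by
  \<open>f\<^sup>k\<close> turns this into \<open>s\<^sub>k u = f z u\<close>, and
  \<open>s\<^sub>k - f z\<close> is outside \<open>P\<close>. Taking out the highest power of
  \<open>f\<close> leaves \<open>v\<close>, which is nonzero also modulo \<open>f\<close>.
\<close>

lemma krull_divisibility:
  assumes G: "noetherian_over G" and P: "prime_set P" "f \<in> P"
    and u: "\<And>s. s \<notin> P \<Longrightarrow> s * u \<notin> ideal_span G"
  shows "\<exists>k s v. s \<notin> P \<and> s * u - f ^ k * v \<in> ideal_span G \<and> (\<forall>s. s \<notin> P \<longrightarrow> s * v \<notin> ideal_span (insert f G))"
proof -
  note Gi = is_ideal_span[of G] and Pi = prime_set_ideal[OF P(1)]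
  define quotient_at where "quotient_at k v s \<longleftrightarrow> s \<notin> P \<and> s * u - f ^ k * v \<in> ideal_span G" for k v s
  have "\<not> (\<forall>k. \<exists>v s. quotient_at k v s)"
  proof
    assume "\<forall>k. \<exists>v s. quotient_at k v s"
    then obtain v s where vs: "\<And>k. quotient_at k (v k) (s k)" by metis
    obtain k where k: "v k \<in> ideal_span (G \<union> v ` {..<k})"
      using G by (auto simp: noetherian_over_def)
    have "\<exists>c. x - (\<Sum>i<k. c i * v i) \<in> ideal_span G" if "x \<in> ideal_span (G \<union> v ` {..<k})" for x k
      using that
    proof (induction k arbitrary: x)
      case (Suc k)
      have "G \<union> v ` {..<Suc k} = insert (v k) (G \<union> v ` {..<k})" by (auto simp: less_Suc_eq)
      then obtain d where "x - d * v k \<in> ideal_span (G \<union> v ` {..<k})"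
        using Suc.prems by (auto simp: ideals.span_insert)
      then obtain c where c: "x - d * v k - (\<Sum>i<k. c i * v i) \<in> ideal_span G" using Suc.IH by blast
      have "(\<Sum>i<Suc k. (c(k := d)) i * v i) = (\<Sum>i<k. c i * v i) + d * v k" by simp
      then show ?case using c by (intro exI[of _ "c(k := d)"]) (auto simp: algebra_simps)
    qed auto
    then obtain c where c: "v k - (\<Sum>i<k. c i * v i) \<in> ideal_span G" using k by blast
    define z where "z = (\<Sum>i<k. c i * f ^ (k - Suc i) * s i)"
    have "f ^ k * (\<Sum>i<k. c i * v i) = (\<Sum>i<k. c i * f ^ (k - i) * (f ^ i * v i))"
      by (auto simp: sum_distrib_left power_add[symmetric] mult_ac intro!: sum.cong)
    then have fzu: "f * z * u - f ^ k * (\<Sum>i<k. c i * v i) = (\<Sum>i<k. c i * f ^ (k - i) * (s i * u - f ^ i * v i))"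
    proof -
      have "f * (c i * f ^ (k - Suc i) * s i) * u = c i * f ^ (k - i) * (s i * u)" if "i < k" for i
      proof -
        have "f ^ (k - i) = f * f ^ (k - Suc i)" using that by (metis Suc_diff_Suc power_Suc)
        then show ?thesis by (simp add: mult_ac)
      qed
      then have "f * z * u = (\<Sum>i<k. c i * f ^ (k - i) * (s i * u))"
        unfolding z_def sum_distrib_left sum_distrib_right by (intro sum.cong) auto
      then show ?thesis
        using \<open>f ^ k * (\<Sum>i<k. c i * v i) = _\<close> by (simp only: right_diff_distrib sum_subtractf)
    qed
    note fzu
    also have "(\<Sum>i<k. c i * f ^ (k - i) * (s i * u - f ^ i * v i)) \<in> ideal_span G"
      using vs by (intro is_ideal_sum[OF Gi] is_ideal_mult[OF Gi]) (auto simp: quotient_at_def)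
    finally have 1: "f * z * u - f ^ k * (\<Sum>i<k. c i * v i) \<in> ideal_span G" .
    have 2: "f ^ k * (v k - (\<Sum>i<k. c i * v i)) \<in> ideal_span G"
      by (rule is_ideal_mult[OF Gi c])
    have 3: "s k * u - f ^ k * v k \<in> ideal_span G" using vs by (auto simp: quotient_at_def)
    have "(s k - f * z) * u = (s k * u - f ^ k * v k) + f ^ k * (v k - (\<Sum>i<k. c i * v i))
        - (f * z * u - f ^ k * (\<Sum>i<k. c i * v i))"
      by (simp add: algebra_simps)
    also have "\<dots> \<in> ideal_span G"
      by (intro is_ideal_diff[OF Gi] is_ideal_add[OF Gi] 1 2 3)
    finally have "s k - f * z \<in> P" using u by blast
    then have "s k - f * z + f * z \<in> P"
      by (rule is_ideal_add[OF Pi]) (rule is_ideal_mult_right[OF Pi P(2)])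
    then show False using vs[of k] by (simp add: quotient_at_def)
  qed
  then obtain k0 where k0: "\<not> (\<exists>v s. quotient_at k0 v s)" by blast
  have "quotient_at 0 u 1"
    using prime_set_one[OF P(1)] is_ideal_zero[OF Gi] by (simp add: quotient_at_def)
  then have "\<exists>k. (\<exists>v s. quotient_at k v s) \<and> \<not> (\<exists>v s. quotient_at (Suc k) v s)"
    using k0 by (induction k0) blast+
  then obtain k v s where k: "quotient_at k v s" "\<And>v s. \<not> quotient_at (Suc k) v s" by blast
  have "s' * v \<notin> ideal_span (insert f G)" if s': "s' \<notin> P" for s'
  proof
    assume "s' * v \<in> ideal_span (insert f G)"
    then obtain w where w: "s' * v - w * f \<in> ideal_span G" by (auto simp: ideals.span_insert)
    have "s' * (s * u - f ^ k * v) + f ^ k * (s' * v - w * f) \<in> ideal_span G"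
      using k(1) w by (intro is_ideal_add[OF Gi] is_ideal_mult[OF Gi]) (auto simp: quotient_at_def)
    then have "s' * s * u - f ^ Suc k * w \<in> ideal_span G" by (simp add: algebra_simps)
    moreover have "s' * s \<notin> P" using k(1) s' prime_setD[OF P(1)] by (auto simp: quotient_at_def)
    ultimately show False using k(2)[of w "s' * s"] by (simp add: quotient_at_def)
  qed
  then show ?thesis using k(1) by (auto simp: quotient_at_def)
qed

text \<open>
  The annihilator of \<open>u\<close> modulo the ideal of \<open>G\<close>, computed in the
  localization at \<open>P\<close> and pulled back.
\<close>

definition local_annihilator :: "'a::comm_ring_1 set \<Rightarrow> 'a set \<Rightarrow> 'a \<Rightarrow> 'a set" where
  "local_annihilator P G u = {v. \<exists>s. s \<notin> P \<and> s * v * u \<in> ideal_span G}"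

lemma local_annihilatorI: "s \<notin> P \<Longrightarrow> s * v * u \<in> ideal_span G \<Longrightarrow> v \<in> local_annihilator P G u"
  by (auto simp: local_annihilator_def)

lemma local_annihilatorE:
  assumes "v \<in> local_annihilator P G u"
  obtains s where "s \<notin> P" "s * v * u \<in> ideal_span G"
  using assms by (auto simp: local_annihilator_def)

lemma ideal_local_annihilator:
  assumes P: "prime_set P" shows "is_ideal (local_annihilator P G u)"
proof (rule ideals.subspaceI)
  note Gi = is_ideal_span[of G]
  show "0 \<in> local_annihilator P G u"
    by (rule local_annihilatorI[OF prime_set_one[OF P]]) (simp add: ideals.span_zero)
  fix v c assume "v \<in> local_annihilator P G u"
  then obtain s where s: "s \<notin> P" "s * v * u \<in> ideal_span G" by (rule local_annihilatorE)
  have "s * (c * v) * u \<in> ideal_span G"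
    using is_ideal_mult[OF Gi s(2), of c] by (simp add: mult_ac)
  then show "c * v \<in> local_annihilator P G u" by (rule local_annihilatorI[OF s(1)])
  fix w assume "w \<in> local_annihilator P G u"
  then obtain t where t: "t \<notin> P" "t * w * u \<in> ideal_span G" by (rule local_annihilatorE)
  have "s * t * (v + w) * u = t * (s * v * u) + s * (t * w * u)" by (simp add: algebra_simps)
  also have "\<dots> \<in> ideal_span G" by (intro is_ideal_add[OF Gi] is_ideal_mult[OF Gi] s t)
  finally show "v + w \<in> local_annihilator P G u"
    using s(1) t(1) prime_setD[OF P] by (blast intro: local_annihilatorI)
qed

text \<open>
  Before passing to the ring modulo \<open>f\<close>, divide \<open>u\<close> by the highest
  possible power of \<open>f\<close>. The annihilator can only grow, it acquires \<open>f\<close>,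
  and it stays proper.
\<close>

lemma regular_seq_imp_tower:
  assumes "noetherian_over G" and P: "prime_set P" and "set fs \<subseteq> P" "regular_seq G fs"
    and "\<And>s. s \<notin> P \<Longrightarrow> s * u \<notin> ideal_span G"
  shows "tower (local_annihilator P G u) fs"
  using assms(1,3-5)
proof (induction fs arbitrary: G u)
  case Nil
  then show ?case
    using ideal_local_annihilator[OF P] by (auto simp: local_annihilator_def)
next
  case (Cons f fs)
  note Gi = is_ideal_span[of G]
  let ?Q = "local_annihilator P G u"
  have f: "f \<in> P" "regular_mod f (ideal_span G)" using Cons.prems by auto
  have freg: "a \<in> ideal_span G" if "f ^ k * a \<in> ideal_span G" for a k
    using that f(2) by (induction k) (auto simp: regular_mod_def mult.assoc)
  obtain k s v where k: "s \<notin> P" "s * u - f ^ k * v \<in> ideal_span G"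
      "\<And>s. s \<notin> P \<Longrightarrow> s * v \<notin> ideal_span (insert f G)"
    using krull_divisibility[OF Cons.prems(1) P f(1) Cons.prems(4)] by blast
  let ?Q' = "local_annihilator P (insert f G) v"
  have "tower ?Q' fs"
    using Cons.prems k(3) by (intro Cons.IH noetherian_over_mono[OF Cons.prems(1)]) auto
  moreover have "f \<in> ?Q'"
    using is_ideal_mult_right[OF is_ideal_span ideals.span_base, of f "insert f G" v]
    by (intro local_annihilatorI[OF prime_set_one[OF P]]) auto
  moreover have "?Q \<subseteq> ?Q'"
  proof
    fix w assume "w \<in> ?Q"
    then obtain t where t: "t \<notin> P" "t * w * u \<in> ideal_span G" by (rule local_annihilatorE)
    have "f ^ k * (t * w * v) = s * (t * w * u) - t * w * (s * u - f ^ k * v)"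
      by (simp add: algebra_simps)
    also have "\<dots> \<in> ideal_span G"
      by (intro is_ideal_diff[OF Gi] is_ideal_mult[OF Gi] t k)
    finally have "t * w * v \<in> ideal_span G" by (rule freg)
    then have "t * w * v \<in> ideal_span (insert f G)" using ideals.span_mono[of G "insert f G"] by auto
    then show "w \<in> ?Q'" by (rule local_annihilatorI[OF t(1)])
  qed
  moreover have "regular_mod f ?Q"
    unfolding regular_mod_def
  proof (intro allI impI)
    fix a assume "f * a \<in> ?Q"
    then obtain t where t: "t \<notin> P" "t * (f * a) * u \<in> ideal_span G" by (rule local_annihilatorE)
    then have "f * (t * a * u) \<in> ideal_span G" by (simp add: mult_ac)
    then have "t * a * u \<in> ideal_span G" using f(2) by (auto simp: regular_mod_def)
    then show "a \<in> ?Q" by (rule local_annihilatorI[OF t(1)])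
  qed
  ultimately show ?case using ideal_local_annihilator[OF P] by auto
qed

section \<open>Polynomial rings\<close>

type_synonym ('v, 'k) mpol = "('v \<Rightarrow>\<^sub>0 nat) \<Rightarrow>\<^sub>0 'k"

definition const :: "'k::field \<Rightarrow> ('v, 'k) mpol" where
  "const c = Poly_Mapping.single 0 c"

lemma const_simps: "const 0 = 0" "const 1 = 1" "const (a + b) = const a + const b" "const (a * b) = const a * const b"
  by (simp_all add: const_def single_add mult_single)

lemma const_neg: "const (- a) = - const a"
  by (simp add: const_def single_uminus)

lemma const_unit: "c \<noteq> 0 \<Longrightarrow> const (inverse c) * const c = 1"
  by (simp add: const_simps[symmetric])

lemma const_in_ideal: "is_ideal Q \<Longrightarrow> 1 \<notin> Q \<Longrightarrow> const c \<in> Q \<Longrightarrow> c = 0"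
  using const_unit[of c] is_ideal_mult[of Q "const c" "const (inverse c)"] by metis

definition mono_eval :: "('v \<Rightarrow> 'b::comm_ring_1) \<Rightarrow> ('v \<Rightarrow>\<^sub>0 nat) \<Rightarrow> 'b" where
  "mono_eval f m = (\<Prod>j\<in>Poly_Mapping.keys m. f j ^ Poly_Mapping.lookup m j)"

lemma mono_eval_superset:
  assumes "finite J" "Poly_Mapping.keys m \<subseteq> J"
  shows "mono_eval f m = (\<Prod>j\<in>J. f j ^ Poly_Mapping.lookup m j)"
  unfolding mono_eval_def using assms
  by (intro prod.mono_neutral_left) (auto simp: in_keys_iff)

lemma mono_eval_add: "mono_eval f (a + b) = mono_eval f a * mono_eval f b"
proof -
  let ?J = "Poly_Mapping.keys a \<union> Poly_Mapping.keys b"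
  have "mono_eval f (a + b) = (\<Prod>j\<in>?J. f j ^ Poly_Mapping.lookup (a + b) j)"
    using Poly_Mapping.keys_add[of a b] by (intro mono_eval_superset) auto
  also have "\<dots> = (\<Prod>j\<in>?J. f j ^ Poly_Mapping.lookup a j) * (\<Prod>j\<in>?J. f j ^ Poly_Mapping.lookup b j)"
    by (simp add: lookup_add power_add prod.distrib)
  also have "\<dots> = mono_eval f a * mono_eval f b"
    by (simp add: mono_eval_superset[of ?J])
  finally show ?thesis .
qed

lemma sum_singles: "(\<Sum>m\<in>Poly_Mapping.keys p. Poly_Mapping.single m (Poly_Mapping.lookup p m)) = p"
  by (rule poly_mapping_eqI) (auto simp: lookup_sum lookup_single when_def in_keys_iff sum.delta)

text \<open>
  The evaluation homomorphism with values \<open>f\<close> of the variables and \<open>h\<close>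
  on the coefficients.
\<close>

definition psubst :: "('k::field \<Rightarrow> 'b::comm_ring_1) \<Rightarrow> ('v \<Rightarrow> 'b) \<Rightarrow> ('v, 'k) mpol \<Rightarrow> 'b" where
  "psubst h f p = (\<Sum>m\<in>Poly_Mapping.keys p. h (Poly_Mapping.lookup p m) * mono_eval f m)"

definition ring_map :: "('a::comm_ring_1 \<Rightarrow> 'b::comm_ring_1) \<Rightarrow> bool" where
  "ring_map h \<longleftrightarrow> h 1 = 1 \<and> (\<forall>a b. h (a + b) = h a + h b \<and> h (a * b) = h a * h b)"

lemma ring_map_simps:
  assumes "ring_map h"
  shows "h 1 = 1" "h (a + b) = h a + h b" "h (a * b) = h a * h b" "h 0 = 0" "h (- a) = - h a" "h (a - b) = h a - h b"
proof -
  show 1: "h 1 = 1" and 2: "\<And>a b. h (a + b) = h a + h b" and "h (a * b) = h a * h b"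
    using assms by (auto simp: ring_map_def)
  interpret additive h by standard (rule 2)
  show "h 0 = 0" "h (- a) = - h a" "h (a - b) = h a - h b" by (rule zero minus diff)+
qed

lemma ring_map_sum: "ring_map h \<Longrightarrow> h (sum g A) = (\<Sum>x\<in>A. h (g x))"
  by (induction A rule: infinite_finite_induct) (auto simp: ring_map_simps)

lemma ring_map_prod: "ring_map h \<Longrightarrow> h (prod g A) = (\<Prod>x\<in>A. h (g x))"
  by (induction A rule: infinite_finite_induct) (auto simp: ring_map_simps)

lemma ring_map_power: "ring_map h \<Longrightarrow> h (x ^ n) = h x ^ n"
  by (induction n) (auto simp: ring_map_simps)

lemma ring_map_const: "ring_map const"
  by (simp add: ring_map_def const_simps)

lemma psubst_superset:
  assumes "ring_map h" "finite M" "Poly_Mapping.keys p \<subseteq> M"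
  shows "psubst h f p = (\<Sum>m\<in>M. h (Poly_Mapping.lookup p m) * mono_eval f m)"
  unfolding psubst_def using assms
  by (intro sum.mono_neutral_left) (auto simp: in_keys_iff ring_map_simps)

lemma psubst_add:
  assumes "ring_map h" shows "psubst h f (p + q) = psubst h f p + psubst h f q"
proof -
  let ?M = "Poly_Mapping.keys p \<union> Poly_Mapping.keys q"
  have "psubst h f (p + q) = (\<Sum>m\<in>?M. h (Poly_Mapping.lookup (p + q) m) * mono_eval f m)"
    using Poly_Mapping.keys_add[of p q] by (intro psubst_superset assms) auto
  also have "\<dots> = psubst h f p + psubst h f q"
    by (simp add: psubst_superset[of h ?M] assms lookup_add ring_map_simps distrib_right sum.distrib)
  finally show ?thesis .
qed

lemma psubst_single:
  assumes "ring_map h" shows "psubst h f (Poly_Mapping.single m c) = h c * mono_eval f m"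
  by (subst psubst_superset[OF assms, of "{m}"]) auto

lemma ring_map_psubst:
  assumes h: "ring_map h" shows "ring_map (psubst h f)"
proof -
  let ?s = "psubst h f"
  interpret additive ?s by standard (rule psubst_add[OF h])
  have "?s (p * q) = ?s p * ?s q" for p q
  proof -
    let ?S = "\<lambda>p. \<Sum>m\<in>Poly_Mapping.keys p. Poly_Mapping.single m (Poly_Mapping.lookup p m)"
    have "?s (p * q) = ?s (?S p * ?S q)" by (simp add: sum_singles)
    also have "\<dots> = (\<Sum>m\<in>Poly_Mapping.keys p. \<Sum>m'\<in>Poly_Mapping.keys q.
        h (Poly_Mapping.lookup p m) * mono_eval f m * (h (Poly_Mapping.lookup q m') * mono_eval f m'))"
      by (simp add: sum_product sum mult_single psubst_single[OF h] ring_map_simps[OF h] mono_eval_add mult_ac)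
    also have "\<dots> = ?s p * ?s q" by (simp add: psubst_def sum_product)
    finally show ?thesis .
  qed
  moreover have "?s 1 = 1"
    using psubst_single[OF h, of f 0 1] by (simp add: ring_map_simps[OF h] mono_eval_def)
  ultimately show ?thesis by (simp add: ring_map_def psubst_add[OF h])
qed

lemma psubst_const: "ring_map h \<Longrightarrow> psubst h f (const c) = h c"
  by (simp add: const_def psubst_single mono_eval_def)

lemma psubst_mvar: "ring_map h \<Longrightarrow> psubst h f (mvar j) = f j"
  by (simp add: mvar_def psubst_single mono_eval_def ring_map_simps)

lemma mono_eval_mvar: "mono_eval mvar m = (Poly_Mapping.single m 1 :: ('v, 'k::field) mpol)"
proof -
  have pow: "mvar j ^ n = (Poly_Mapping.single (Poly_Mapping.single j n) 1 :: ('v, 'k) mpol)" for j n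
    by (induction n) (auto simp: mvar_def mult_single single_add[symmetric])
  have "(\<Prod>j\<in>J. Poly_Mapping.single (g j) 1) = (Poly_Mapping.single (sum g J) 1 :: ('v, 'k) mpol)" for J and g :: "'v \<Rightarrow> _"
    by (induction J rule: infinite_finite_induct) (auto simp: mult_single)
  then show ?thesis by (simp add: mono_eval_def pow sum_singles)
qed

lemma single_eq: "Poly_Mapping.single m c = const c * mono_eval mvar m"
  by (simp add: mono_eval_mvar const_def mult_single)

lemma mpol_induct [case_names const mvar add mult]:
  fixes p :: "('v, 'k::field) mpol"
  assumes "\<And>c. P (const c)" "\<And>j. P (mvar j)" "\<And>p q. P p \<Longrightarrow> P q \<Longrightarrow> P (p + q)" "\<And>p q. P p \<Longrightarrow> P q \<Longrightarrow> P (p * q)"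
  shows "P p"
proof -
  have 1: "P 1" and 0: "P 0" using assms(1)[of 1] assms(1)[of 0] by (simp_all add: const_simps)
  have pow: "P (q ^ n)" if "P q" for q n using that by (induction n) (auto intro: assms 1)
  have prod: "P (prod g J)" if "\<And>j. P (g j)" for g and J :: "'v set"
    using that by (induction J rule: infinite_finite_induct) (auto intro: assms 1)
  have "P (Poly_Mapping.single m c)" for m c
    unfolding single_eq mono_eval_def by (intro assms prod pow)
  then have "P (\<Sum>m\<in>M. Poly_Mapping.single m (Poly_Mapping.lookup p m))" for M
    by (induction M rule: infinite_finite_induct) (auto intro: assms 0)
  from this[of "Poly_Mapping.keys p"] show ?thesis by (simp add: sum_singles)
qed

text \<open>
  Setting the variables outside \<open>X\<close> to zero is a retraction of the type of all
  polynomials onto the polynomial ring with variable set \<open>X\<close>.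
\<close>

definition restr :: "'v set \<Rightarrow> ('v, 'k::field) mpol \<Rightarrow> ('v, 'k) mpol" where
  "restr X = psubst const (\<lambda>j. if j \<in> X then mvar j else 0)"

lemma ring_map_restr: "ring_map (restr X)"
  unfolding restr_def by (intro ring_map_psubst ring_map_const)

lemmas restr_simps = ring_map_simps[OF ring_map_restr]

lemma restr_const [simp]: "restr X (const c) = const c"
  by (simp add: restr_def psubst_const ring_map_const)

lemma restr_mvar [simp]: "restr X (mvar j) = (if j \<in> X then mvar j else 0)"
  by (simp add: restr_def psubst_mvar ring_map_const)

lemma restr_restr: "restr X (restr Y p) = restr (X \<inter> Y) p"
  by (induction p rule: mpol_induct) (auto simp: restr_simps)

lemma diff_restr: "p - restr X p \<in> ideal_span (mvar ` (- X))"
proof (induction p rule: mpol_induct)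
  note Gi = is_ideal_span[of "mvar ` (- X) :: ('a, 'b) mpol set"]
  case (add p q)
  have "p + q - restr X (p + q) = (p - restr X p) + (q - restr X q)" by (simp add: restr_simps)
  then show ?case using is_ideal_add[OF Gi] add by metis
next
  note Gi = is_ideal_span[of "mvar ` (- X) :: ('a, 'b) mpol set"]
  case (mult p q)
  have "p * q - restr X (p * q) = q * (p - restr X p) + restr X p * (q - restr X q)"
    by (simp add: restr_simps algebra_simps)
  then show ?case using is_ideal_add[OF Gi] is_ideal_mult[OF Gi] mult by metis
qed (auto intro: ideals.span_base ideals.span_zero)

lemma restr_in_carrier: "restr X p \<in> carrier (mpoly_ring X)"
proof (induction p rule: mpol_induct)
  case (const c)
  show ?case unfolding restr_const by (auto simp: mpoly_ring_def const_def split: if_splits)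
next
  case (mvar j)
  show ?case unfolding restr_mvar by (auto simp: mpoly_ring_def mvar_def split: if_splits)
next
  case (add p q)
  interpret cring "mpoly_ring X :: ('a, 'b) mpol ring" by (rule cring_mpoly_ring)
  show ?case using a_closed[OF add] by (simp add: mpoly_ring_def restr_simps)
next
  case (mult p q)
  interpret cring "mpoly_ring X :: ('a, 'b) mpol ring" by (rule cring_mpoly_ring)
  show ?case using m_closed[OF mult] by (simp add: mpoly_ring_def restr_simps)
qed

lemma restr_id: "p \<in> carrier (mpoly_ring X) \<Longrightarrow> restr X p = p"
proof -
  assume p: "p \<in> carrier (mpoly_ring X)"
  have "restr X p = (\<Sum>m\<in>Poly_Mapping.keys p. const (Poly_Mapping.lookup p m) * mono_eval mvar m)"
    unfolding restr_def psubst_def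
  proof (intro sum.cong refl arg_cong2[where f = "(*)"])
    fix m assume "m \<in> Poly_Mapping.keys p"
    then have "Poly_Mapping.keys m \<subseteq> X" using p by (auto simp: mpoly_ring_def)
    then show "mono_eval (\<lambda>j. if j \<in> X then mvar j else 0) m = mono_eval mvar m"
      unfolding mono_eval_def by (intro prod.cong) auto
  qed
  then show ?thesis by (simp add: single_eq[symmetric] sum_singles)
qed

text \<open>
  The ideal of the coordinate subspace of \<open>X\<close>, generated by the variables outside
  \<open>X\<close>.
\<close>

definition vanish :: "'v set \<Rightarrow> ('v, 'k::field) mpol set" where
  "vanish X = {p. restr X p = 0}"

lemma prime_vanish: "prime_set (vanish X :: ('v::linorder, 'k::field) mpol set)"
  unfolding prime_set_def vanish_def
  by (auto simp: restr_simps intro!: ideals.subspaceI)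

lemma vanish_mono: "X \<subseteq> Y \<Longrightarrow> vanish Y \<subseteq> vanish X"
  unfolding vanish_def using restr_restr[of X Y] restr_simps(4)[of X] by (metis (mono_tags, lifting) Int_absorb2 mem_Collect_eq subsetI)

lemma mvar_neq_0 [simp]: "(mvar j :: ('v, 'k::field) mpol) \<noteq> 0"
  by (metis lookup_single_eq lookup_zero mvar_def one_neq_zero)

lemma mvar_in_vanish: "mvar j \<in> vanish X \<longleftrightarrow> j \<notin> X"
  by (auto simp: vanish_def)

lemma restr_empty: "\<exists>c. restr {} p = const c"
proof (induction p rule: mpol_induct)
  case (mvar j)
  show ?case using const_simps(1) by (auto intro: exI[of _ 0])
next
  case (add p q)
  then show ?case by (metis restr_simps(2) const_simps(3))
next
  case (mult p q)
  then show ?case by (metis restr_simps(3) const_simps(4))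
qed auto

text \<open>
  A polynomial read as a polynomial in the variable \<open>i\<close> whose coefficients involve
  the other variables.
\<close>

definition isolate :: "'v \<Rightarrow> ('v, 'k::field) mpol \<Rightarrow> ('v, 'k) mpol poly" where
  "isolate i = psubst (\<lambda>c. [:const c:]) (\<lambda>j. if j = i then [:0, 1:] else [:mvar j:])"

lemma ring_map_const_poly: "ring_map (\<lambda>c. [:const c:])"
  by (simp add: ring_map_def const_simps one_pCons)

lemma ring_map_isolate: "ring_map (isolate i)"
  unfolding isolate_def by (intro ring_map_psubst ring_map_const_poly)

lemmas isolate_simps = ring_map_simps[OF ring_map_isolate]

lemma isolate_const: "isolate i (const c) = [:const c:]"
  by (simp add: isolate_def psubst_const ring_map_const_poly)

lemma isolate_mvar: "isolate i (mvar j) = (if j = i then [:0, 1:] else [:mvar j:])"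
  by (simp add: isolate_def psubst_mvar ring_map_const_poly)

lemma poly_isolate: "poly (isolate i p) (mvar i) = p"
  by (induction p rule: mpol_induct) (auto simp: isolate_simps isolate_const isolate_mvar)

definition free_of :: "'v \<Rightarrow> ('v, 'k::field) mpol set" where
  "free_of i = {p. isolate i p = [:p:]}"

lemma subring_free_of: "subring_set (free_of i)"
  by (auto simp: subring_set_def free_of_def isolate_simps one_pCons)

lemma const_free_of: "const c \<in> free_of i"
  by (simp add: free_of_def isolate_const)

lemma mvar_free_of: "j \<noteq> i \<Longrightarrow> mvar j \<in> free_of i"
  by (simp add: free_of_def isolate_mvar)

lemma subring_range_const: "subring_set (range const)"
  unfolding subring_set_def
  by (auto simp: image_iff intro: exI[of _ 1] exI[of _ "_ - _"] exI[of _ "_ * _"] simp: const_simps)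
     (metis const_neg const_simps(3) diff_conv_add_uminus)

lemma isolate_poly_const:
  assumes "q \<in> polys_in (range const)"
  shows "isolate i (poly q (mvar i)) = q"
proof -
  have "isolate i (poly q (mvar i)) = (\<Sum>k\<le>degree q. isolate i (coeff q k) * [:0, 1:] ^ k)"
    unfolding poly_altdef
    by (simp add: ring_map_sum[OF ring_map_isolate] ring_map_power[OF ring_map_isolate] isolate_simps isolate_mvar)
  also have "\<dots> = (\<Sum>k\<le>degree q. monom (coeff q k) k)"
  proof (intro sum.cong refl)
    fix k
    obtain c where "coeff q k = const c" using polys_inD[OF assms, of k] by auto
    then show "isolate i (coeff q k) * [:0, 1:] ^ k = monom (coeff q k) k"
      by (simp add: isolate_const monom_altdef)
  qed
  finally show ?thesis by (simp add: poly_as_sum_of_monoms)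
qed

text \<open>
  The generators are constants with respect to the variable \<open>i\<close>, so membership can be
  tested coefficient by coefficient.
\<close>

lemma isolate_span:
  assumes "G \<subseteq> free_of i"
  shows "b \<in> ideal_span G \<longleftrightarrow> isolate i b \<in> polys_in (ideal_span G)"
proof
  note Bi = is_ideal_span[of G]
  note PBi = ideal_polys_in[OF Bi]
  show "isolate i b \<in> polys_in (ideal_span G) \<Longrightarrow> b \<in> ideal_span G"
    using poly_polys_in_ideal[OF Bi, of "isolate i b" "mvar i"] by (simp add: poly_isolate)
  have "ideal_span G \<subseteq> {b. isolate i b \<in> polys_in (ideal_span G)}"
  proof (rule ideals.span_minimal)
    show "G \<subseteq> {b. isolate i b \<in> polys_in (ideal_span G)}"
    proof
      fix g assume "g \<in> G"
      then have "isolate i g = [:g:]" "g \<in> ideal_span G"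
        using assms by (auto simp: free_of_def intro: ideals.span_base)
      then show "g \<in> {b. isolate i b \<in> polys_in (ideal_span G)}"
        by (auto simp: polys_in_def coeff_pCons ideals.span_zero split: nat.splits)
    qed
    show "is_ideal {b. isolate i b \<in> polys_in (ideal_span G)}"
      using is_ideal_zero[OF PBi] is_ideal_add[OF PBi] is_ideal_mult[OF PBi]
      by (intro ideals.subspaceI) (auto simp: isolate_simps)
  qed
  then show "b \<in> ideal_span G \<Longrightarrow> isolate i b \<in> polys_in (ideal_span G)" by blast
qed

text \<open>
  The leading coefficient of \<open>q\<close> is a unit. So in a product \<open>q f\<close> the
  coefficient in the degree where \<open>q\<close> meets the highest coefficient of
  \<open>f\<close> outside the ideal stays outside the ideal.
\<close>

lemma regular_mod_free_of:
  assumes G: "G \<subseteq> free_of i" and q: "q \<in> polys_in (range const)" "q \<noteq> 0"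
  shows "regular_mod (poly q (mvar i)) (ideal_span G)"
  unfolding regular_mod_def
proof (intro allI impI, rule ccontr)
  note Bi = is_ideal_span[of G]
  fix b assume b: "poly q (mvar i) * b \<in> ideal_span G" "b \<notin> ideal_span G"
  define f where "f = isolate i b"
  have qf: "q * f \<in> polys_in (ideal_span G)"
    using b(1) unfolding isolate_span[OF G] f_def by (simp add: isolate_simps isolate_poly_const[OF q(1)])
  have "f \<notin> polys_in (ideal_span G)"
    using b(2) unfolding isolate_span[OF G] f_def by simp
  then obtain e where e: "coeff f e \<notin> ideal_span G" "\<And>k. k > e \<Longrightarrow> coeff f k \<in> ideal_span G"
    using ex_top_coeff ideals.span_zero by blast
  define d where "d = degree q"
  have "coeff (q * f) (d + e) - coeff q d * coeff f e \<in> ideal_span G"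
    using e(2) by (intro top_coeff_mult Bi) (auto simp: d_def coeff_eq_0 ideals.span_zero)
  from is_ideal_diff[OF Bi polys_inD[OF qf, of "d + e"] this]
  have 1: "coeff q d * coeff f e \<in> ideal_span G" by simp
  obtain c where c: "coeff q d = const c" using polys_inD[OF q(1), of d] by auto
  have "c \<noteq> 0" using q(2) c by (auto simp: d_def const_simps)
  have "const (inverse c) * (const c * coeff f e) \<in> ideal_span G"
    using 1 unfolding c by (rule is_ideal_mult[OF Bi])
  then show False using const_unit[OF \<open>c \<noteq> 0\<close>] e(1) by (metis mult.assoc mult_1)
qed

section \<open>Counting monomials\<close>

fun mon :: "'a::comm_ring_1 list \<Rightarrow> nat list \<Rightarrow> 'a" where
  "mon (y # ys) (a # as) = y ^ a * mon ys as"
| "mon _ _ = 1"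

definition exps :: "nat \<Rightarrow> nat \<Rightarrow> nat list set" where
  "exps h N = {as. set as \<subseteq> {..<N} \<and> length as = h}"

lemma finite_exps: "finite (exps h N)" and card_exps: "card (exps h N) = N ^ h"
  unfolding exps_def using finite_lists_length_eq[of "{..<N}" h] card_lists_length_eq[of "{..<N}" h] by auto

lemma sum_exps_Suc: "(\<Sum>as\<in>exps (Suc h) N. g as) = (\<Sum>k<N. \<Sum>as\<in>exps h N. g (k # as))"
proof -
  have "exps (Suc h) N = (\<lambda>(k, as). k # as) ` ({..<N} \<times> exps h N)"
    by (auto simp: exps_def image_iff length_Suc_conv)
  moreover have "inj_on (\<lambda>(k, as). k # as) ({..<N} \<times> exps h N)" by (auto simp: inj_on_def)
  ultimately show ?thesis by (simp add: sum.reindex sum.cartesian_product case_prod_unfold)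
qed

text \<open>
  Sort the terms of a relation by the exponent of the first member \<open>y\<close>. The lowest
  power of \<open>y\<close> that occurs can be cancelled because \<open>y\<close> is regular
  modulo \<open>Q\<close>, and what remains is, modulo \<open>y \<in> Q'\<close>, a relation
  between the other members.
\<close>

lemma tower_monomials_independent:
  fixes c :: "nat list \<Rightarrow> 'k::field"
  assumes "tower Q ys" "(\<Sum>as\<in>exps (length ys) N. const (c as) * mon ys as) \<in> Q" "as \<in> exps (length ys) N"
  shows "c as = 0"
  using assms
proof (induction ys arbitrary: Q c as)
  case Nil
  have "exps 0 N = {[]}" by (auto simp: exps_def)
  then show ?case using Nil const_in_ideal[of Q "c []"] by auto
next
  case (Cons y ys)
  obtain Q' where Q': "Q \<subseteq> Q'" "y \<in> Q'" "tower Q' ys" using Cons.prems(1) by auto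
  have Qi: "is_ideal Q" "is_ideal Q'" using tower_ideal Cons.prems(1) Q'(3) by auto
  have reg: "regular_mod y Q" using Cons.prems(1) by simp
  let ?E = "exps (length ys) N"
  define S where "S k = (\<Sum>as\<in>?E. const (c (k # as)) * mon ys as)" for k
  have "c (k # as) = 0" if "k < N" "as \<in> ?E" for k as
    using that
  proof (induction k arbitrary: as rule: less_induct)
    case (less k)
    have S0: "S l = 0" if "l < k" for l
      unfolding S_def using less that by (intro sum.neutral) (auto simp: const_simps)
    have "(\<Sum>as\<in>exps (length (y # ys)) N. const (c as) * mon (y # ys) as) = (\<Sum>l<N. y ^ l * S l)"
      by (simp add: sum_exps_Suc S_def sum_distrib_left mult_ac)
    also have "\<dots> = (\<Sum>l\<in>{k..<N}. y ^ l * S l)"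
      using S0 by (intro sum.mono_neutral_right) auto
    also have "\<dots> = (\<Sum>l\<in>{k..<N}. y ^ k * (y ^ (l - k) * S l))"
      by (intro sum.cong) (auto simp: power_add[symmetric] mult.assoc[symmetric])
    also have "\<dots> = y ^ k * (\<Sum>l\<in>{k..<N}. y ^ (l - k) * S l)"
      by (simp add: sum_distrib_left)
    also have "{k..<N} = insert k {k<..<N}" using less.prems by auto
    also have "(\<Sum>l\<in>insert k {k<..<N}. y ^ (l - k) * S l) = S k + (\<Sum>l\<in>{k<..<N}. y ^ (l - k) * S l)"
      by simp
    finally have "y ^ k * (S k + (\<Sum>l\<in>{k<..<N}. y ^ (l - k) * S l)) \<in> Q"
      using Cons.prems(2) by simp
    moreover have "a \<in> Q" if "y ^ k * a \<in> Q" for a k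
      using that reg by (induction k) (auto simp: regular_mod_def mult.assoc)
    ultimately have 1: "S k + (\<Sum>l\<in>{k<..<N}. y ^ (l - k) * S l) \<in> Q'" using Q'(1) by blast
    have "(\<Sum>l\<in>{k<..<N}. y ^ (l - k) * S l) \<in> Q'"
    proof (rule is_ideal_sum[OF Qi(2)])
      fix l assume "l \<in> {k<..<N}"
      then have "y ^ (l - k) = y * y ^ (l - Suc k)" by (auto simp: power_Suc[symmetric] Suc_diff_Suc simp del: power_Suc)
      then show "y ^ (l - k) * S l \<in> Q'" using Q'(2) by (simp add: is_ideal_mult_right[OF Qi(2)])
    qed
    from is_ideal_diff[OF Qi(2) 1 this] have "S k \<in> Q'" by simp
    then show ?case
      using Cons.IH[OF Q'(3), of "\<lambda>as. c (k # as)"] less.prems by (simp add: S_def)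
  qed
  moreover obtain k bs where "as = k # bs" "k < N" "bs \<in> ?E"
    using Cons.prems(3) by (auto simp: exps_def length_Suc_conv)
  ultimately show ?case by simp
qed

definition exp_bounded :: "nat \<Rightarrow> ('v, 'k::field) mpol set" where
  "exp_bounded B = {p. \<forall>m\<in>Poly_Mapping.keys p. \<forall>j. Poly_Mapping.lookup m j \<le> B}"

lemma exp_bounded_mult:
  assumes "p \<in> exp_bounded A" "q \<in> exp_bounded B" shows "p * q \<in> exp_bounded (A + B)"
  unfolding exp_bounded_def
proof (intro CollectI ballI allI)
  fix m j assume "m \<in> Poly_Mapping.keys (p * q)"
  then obtain a b where "m = a + b" "a \<in> Poly_Mapping.keys p" "b \<in> Poly_Mapping.keys q"
    using keys_mult[of p q] by blast
  then show "Poly_Mapping.lookup m j \<le> A + B"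
    using assms by (auto simp: exp_bounded_def lookup_add intro!: add_mono)
qed

lemma exp_bounded_one: "1 \<in> exp_bounded B"
  by (auto simp: exp_bounded_def)

lemma exp_bounded_mono: "A \<le> B \<Longrightarrow> exp_bounded A \<subseteq> exp_bounded B"
  unfolding exp_bounded_def using le_trans by blast

lemma exp_bounded_power: "p \<in> exp_bounded B \<Longrightarrow> p ^ n \<in> exp_bounded (n * B)"
  by (induction n) (auto intro: exp_bounded_one exp_bounded_mult)

lemma ex_exp_bounded: "\<exists>B. p \<in> exp_bounded B"
proof -
  have "finite (\<Union>m\<in>Poly_Mapping.keys p. Poly_Mapping.lookup m ` Poly_Mapping.keys m)" by auto
  then obtain B where B: "\<forall>x\<in>(\<Union>m\<in>Poly_Mapping.keys p. Poly_Mapping.lookup m ` Poly_Mapping.keys m). x \<le> B"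
    using finite_nat_set_iff_bounded_le by meson
  have "Poly_Mapping.lookup m j \<le> B" if "m \<in> Poly_Mapping.keys p" for m j
    using B that by (cases "j \<in> Poly_Mapping.keys m") (auto simp: in_keys_iff)
  then show ?thesis by (auto simp: exp_bounded_def)
qed

lemma ex_exp_bounded_list: "\<exists>B. set ps \<subseteq> exp_bounded B"
proof (induction ps)
  case (Cons p ps)
  then obtain B A where "set ps \<subseteq> exp_bounded B" "p \<in> exp_bounded A" using ex_exp_bounded[of p] by blast
  then have "set (p # ps) \<subseteq> exp_bounded (max A B)"
    using exp_bounded_mono[of A "max A B"] exp_bounded_mono[of B "max A B"] by auto
  then show ?case by blast
qed auto

lemma exp_bounded_mon:
  assumes "set ys \<subseteq> exp_bounded B" "as \<in> exps (length ys) N"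
  shows "mon ys as \<in> exp_bounded (length ys * (N * B))"
  using assms
proof (induction ys arbitrary: as)
  case Nil
  then show ?case by (simp add: exp_bounded_one)
next
  case (Cons y ys)
  obtain a bs where as: "as = a # bs" "a < N" "bs \<in> exps (length ys) N"
    using Cons.prems(2) by (auto simp: exps_def length_Suc_conv)
  have "y ^ a \<in> exp_bounded (a * B)" using Cons.prems by (intro exp_bounded_power) auto
  moreover have "a * B \<le> N * B" using as by simp
  ultimately have "y ^ a \<in> exp_bounded (N * B)" using exp_bounded_mono by blast
  then show ?case using exp_bounded_mult Cons.IH[OF _ as(3)] Cons.prems as by fastforce
qed

lemma card_bounded_exponents:
  assumes "finite F"
  shows "finite {m :: 'v \<Rightarrow>\<^sub>0 nat. Poly_Mapping.keys m \<subseteq> F \<and> (\<forall>j. Poly_Mapping.lookup m j \<le> B)}" (is "finite ?M")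
    and "card {m :: 'v \<Rightarrow>\<^sub>0 nat. Poly_Mapping.keys m \<subseteq> F \<and> (\<forall>j. Poly_Mapping.lookup m j \<le> B)} \<le> Suc B ^ card F"
proof -
  let ?g = "\<lambda>m. restrict (Poly_Mapping.lookup m) F"
  have inj: "inj_on ?g ?M"
  proof (rule inj_onI, rule poly_mapping_eqI)
    fix m m' :: "'v \<Rightarrow>\<^sub>0 nat" and j assume m: "m \<in> ?M" "m' \<in> ?M" "?g m = ?g m'"
    show "Poly_Mapping.lookup m j = Poly_Mapping.lookup m' j"
    proof (cases "j \<in> F")
      case True
      then show ?thesis using fun_cong[OF m(3), of j] by simp
    next
      case False
      then have "j \<notin> Poly_Mapping.keys m" "j \<notin> Poly_Mapping.keys m'" using m by auto
      then show ?thesis by (simp add: in_keys_iff)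
    qed
  qed
  have sub: "?g ` ?M \<subseteq> F \<rightarrow>\<^sub>E {..B}" by auto
  have fin: "finite (F \<rightarrow>\<^sub>E {..B})" using assms by (intro finite_PiE) auto
  show "finite ?M" using inj sub fin by (rule inj_on_finite)
  have "card ?M \<le> card (F \<rightarrow>\<^sub>E {..B})" using inj sub fin by (rule card_inj_on_le)
  then show "card ?M \<le> Suc B ^ card F" using assms by (simp add: card_PiE)
qed

lemma restr_mon: "restr X (mon ys as) = mon (map (restr X) ys) as"
  by (induction ys as rule: mon.induct) (auto simp: restr_simps ring_map_power[OF ring_map_restr])

lemma prime_set_zero: "prime_set {0 :: 'a::idom}"
  by (auto simp: prime_set_def)

text \<open>
  Modulo \<open>Q\<close> only the variables in \<open>F\<close> matter. With \<open>h\<close>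
  elements there are \<open>N\<^sup>h\<close> monomials with exponents below \<open>N\<close>.
  Their exponents in the \<open>d\<close> variables of \<open>F\<close> grow only linearly with
  \<open>N\<close>, so they span a space of dimension at most a constant times
  \<open>N\<^sup>d\<close>. If \<open>h > d\<close>, the monomials are dependent for large
  \<open>N\<close>.
\<close>

theorem tower_length_le:
  fixes Q :: "('v, 'k::field) mpol set"
  assumes F: "finite F" and Q: "tower Q ys" "\<And>j. j \<notin> F \<Longrightarrow> mvar j \<in> Q"
  shows "length ys \<le> card F"
proof (rule ccontr)
  assume "\<not> length ys \<le> card F"
  define h where "h = length ys"
  define d where "d = card F"
  have hd: "h \<ge> Suc d" using \<open>\<not> length ys \<le> card F\<close> by (simp add: h_def d_def)
  define zs where "zs = map (restr F) ys"
  obtain B where B: "set zs \<subseteq> exp_bounded B" using ex_exp_bounded_list by blast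
  \<comment> \<open>The choice of \<open>N\<close> makes \<open>(h N B + 1)\<^sup>d \<le> N\<^sup>d (h B + 1)\<^sup>d\<close> smaller than \<open>N\<^sup>d\<^sup>+\<^sup>1\<close>.\<close>
  define N where "N = Suc ((h * B + 1) ^ d)"
  define M where "M = {m :: 'v \<Rightarrow>\<^sub>0 nat. Poly_Mapping.keys m \<subseteq> F \<and> (\<forall>j. Poly_Mapping.lookup m j \<le> h * (N * B))}"
  have "finite M" and cM: "card M \<le> Suc (h * (N * B)) ^ d"
    using card_bounded_exponents[OF F] by (auto simp: M_def d_def)
  have "Suc (h * (N * B)) \<le> N * (h * B + 1)" by (simp add: N_def algebra_simps)
  then have "card M \<le> (N * (h * B + 1)) ^ d" using cM power_mono le_trans by blast
  also have "\<dots> < N ^ d * N"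
    unfolding power_mult_distrib by (intro mult_strict_left_mono) (auto simp: N_def)
  also have "\<dots> = N ^ Suc d" by simp
  also have "\<dots> \<le> N ^ h" using hd by (intro power_increasing) (auto simp: N_def)
  finally have less: "card M < card (exps h N)" by (simp add: card_exps)
  obtain c :: "nat list \<Rightarrow> 'k" where c: "\<exists>as\<in>exps h N. c as \<noteq> 0"
    "\<forall>m\<in>M. (\<Sum>as\<in>exps h N. c as * Poly_Mapping.lookup (mon zs as) m) = 0"
    using dependent_mod_prime[OF \<open>finite M\<close> finite_exps less _ prime_set_zero, of UNIV "\<lambda>as. Poly_Mapping.lookup (mon zs as)"]
    by (auto simp: subring_set_def)
  have keys_mon: "Poly_Mapping.keys (mon zs as) \<subseteq> M" if "as \<in> exps h N" for as
  proof -
    have "mon zs as \<in> exp_bounded (h * (N * B))"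
      using exp_bounded_mon[OF B, of as N] that by (simp add: zs_def h_def)
    moreover have "mon zs as \<in> carrier (mpoly_ring F)"
      unfolding zs_def restr_mon[symmetric] by (rule restr_in_carrier)
    ultimately show ?thesis by (auto simp: M_def exp_bounded_def mpoly_ring_def)
  qed
  define s where "s = (\<Sum>as\<in>exps h N. const (c as) * mon ys as)"
  have "restr F s = (\<Sum>as\<in>exps h N. const (c as) * mon zs as)"
    by (simp add: s_def ring_map_sum[OF ring_map_restr] restr_simps restr_mon zs_def)
  also have "\<dots> = 0"
  proof (rule poly_mapping_eqI)
    fix m
    have lk: "Poly_Mapping.lookup (const a * p) m = a * Poly_Mapping.lookup p m" for a :: 'k and p :: "('v, 'k) mpol"
      unfolding const_def mult_map_scale_conv_mult[symmetric] by (simp add: Poly_Mapping.map.rep_eq when_def)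
    have "Poly_Mapping.lookup (\<Sum>as\<in>exps h N. const (c as) * mon zs as) m
        = (\<Sum>as\<in>exps h N. c as * Poly_Mapping.lookup (mon zs as) m)"
      by (simp add: lookup_sum lk)
    also have "\<dots> = 0"
    proof (cases "m \<in> M")
      case False
      then have "Poly_Mapping.lookup (mon zs as) m = 0" if "as \<in> exps h N" for as
        using keys_mon[OF that] by (auto simp: in_keys_iff)
      then show ?thesis by simp
    qed (use c(2) in auto)
    finally show "Poly_Mapping.lookup (\<Sum>as\<in>exps h N. const (c as) * mon zs as) m = Poly_Mapping.lookup 0 m" by simp
  qed
  finally have "s \<in> ideal_span (mvar ` (- F))" using diff_restr[of s F] by simp
  moreover have "ideal_span (mvar ` (- F)) \<subseteq> Q"
    using Q by (intro ideals.span_minimal tower_ideal) auto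
  ultimately have "s \<in> Q" by blast
  then have "c as = 0" if "as \<in> exps h N" for as
    using tower_monomials_independent[OF Q(1)] that unfolding s_def h_def by blast
  then show False using c(1) by blast
qed

section \<open>Rings presented as quotients of a ring type\<close>

text \<open>
  The quotient of the ring type by the ideal that \<open>G\<close> generates, up to isomorphism.
  Ideals, primes and regular sequences of \<open>R\<close> correspond to those of the type above
  \<open>G\<close>, which frees the arguments of carrier conditions.
\<close>

locale presented_ring = cring R for R (structure) +
  fixes pr :: "'c::comm_ring_1 \<Rightarrow> 'a" and G :: "'c set"
  assumes pr_add: "pr (a + b) = pr a \<oplus> pr b"
    and pr_mult: "pr (a * b) = pr a \<otimes> pr b"
    and pr_one: "pr 1 = \<one>"
    and pr_range: "range pr = carrier R"
    and pr_zero_iff: "pr a = \<zero> \<longleftrightarrow> a \<in> ideal_span G"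
begin

lemma pr_closed [simp]: "pr a \<in> carrier R"
  using pr_range by blast

lemma pr_zero: "pr 0 = \<zero>"
  by (simp add: pr_zero_iff ideals.span_zero)

lemma pr_neg: "pr (- a) = \<ominus> pr a"
proof -
  have "pr (- a) \<oplus> pr a = \<zero>" by (simp add: pr_add[symmetric] pr_zero)
  then show ?thesis by (simp add: minus_equality)
qed

lemma pr_eq_iff: "pr a = pr b \<longleftrightarrow> a - b \<in> ideal_span G"
proof -
  have "pr (a - b) = pr a \<oplus> \<ominus> pr b" using pr_add[of a "- b"] by (simp add: pr_neg)
  then show ?thesis unfolding pr_zero_iff[symmetric]
    by (metis pr_closed a_minus_def r_right_minus_eq)
qed

lemma pr_cases: "x \<in> carrier R \<Longrightarrow> \<exists>a. x = pr a"
  using pr_range by blast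

lemma pr_vimage_ideal:
  assumes "ideal Q R" shows "is_ideal (pr -` Q)" "ideal_span G \<subseteq> pr -` Q"
proof -
  interpret ideal Q R by fact
  show "is_ideal (pr -` Q)"
    by (rule ideals.subspaceI) (auto simp: pr_zero pr_add pr_mult I_l_closed)
  have "\<zero> \<in> Q" using additive_subgroup.zero_closed[OF ideal.axioms(1)[OF assms]] .
  then show "ideal_span G \<subseteq> pr -` Q" using pr_zero_iff by (metis subsetI vimageI2)
qed

lemma pr_image_ideal:
  assumes J: "is_ideal J" shows "ideal (pr ` J) R"
proof (rule idealI[OF ring_axioms])
  show "subgroup (pr ` J) (add_monoid R)"
  proof (rule add.subgroupI)
    show "pr ` J \<subseteq> carrier R" by auto
    show "pr ` J \<noteq> {}" using is_ideal_zero[OF J] by auto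
    fix x assume "x \<in> pr ` J"
    then obtain a where a: "a \<in> J" "x = pr a" by auto
    show "\<ominus> x \<in> pr ` J"
      using ideals.subspace_neg[OF J a(1)] a(2) pr_neg by (metis imageI)
    fix y assume "y \<in> pr ` J"
    then obtain b where b: "b \<in> J" "y = pr b" by auto
    show "x \<oplus> y \<in> pr ` J"
      using is_ideal_add[OF J a(1) b(1)] a b pr_add by (metis imageI)
  qed
  fix x y assume x: "x \<in> pr ` J" and y: "y \<in> carrier R"
  obtain a b where ab: "a \<in> J" "x = pr a" "y = pr b" using x pr_cases[OF y] by auto
  have ba: "b * a \<in> J" "a * b \<in> J" using is_ideal_mult[OF J ab(1)] is_ideal_mult_right[OF J ab(1)] by auto
  show "y \<otimes> x \<in> pr ` J" using ba(1) ab pr_mult[of b a] by (metis imageI)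
  show "x \<otimes> y \<in> pr ` J" using ba(2) ab pr_mult[of a b] by (metis imageI)
qed

lemma pr_vimage_image:
  assumes J: "is_ideal J" "G \<subseteq> J" shows "pr -` (pr ` J) = J"
proof
  have sub: "ideal_span G \<subseteq> J" using J by (intro ideals.span_minimal)
  show "pr -` (pr ` J) \<subseteq> J"
  proof
    fix x assume "x \<in> pr -` (pr ` J)"
    then obtain a where a: "a \<in> J" "pr x = pr a" by auto
    then have "x - a \<in> J" using pr_eq_iff sub by blast
    from is_ideal_add[OF J(1) this a(1)] show "x \<in> J" by simp
  qed
qed auto

lemma pr_image_vimage: "Q \<subseteq> carrier R \<Longrightarrow> pr ` (pr -` Q) = Q"
  by (simp add: image_vimage_eq pr_range Int_absorb2)

lemma ideal_subset_carrier: "ideal Q R \<Longrightarrow> Q \<subseteq> carrier R"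
  by (simp add: additive_subgroup.a_subset ideal.axioms(1))

lemma pr_vimage_Idl: "pr -` (Idl (pr ` X)) = ideal_span (X \<union> G)"
proof
  have "ideal (Idl (pr ` X)) R" by (intro genideal_ideal) auto
  moreover have "pr ` X \<subseteq> Idl (pr ` X)" by (intro genideal_self) auto
  ultimately show "ideal_span (X \<union> G) \<subseteq> pr -` (Idl (pr ` X))"
    using pr_vimage_ideal ideals.span_superset[of G] by (intro ideals.span_minimal) blast+
  have "Idl (pr ` X) \<subseteq> pr ` ideal_span (X \<union> G)"
    by (intro genideal_minimal pr_image_ideal is_ideal_span image_mono) (auto intro: ideals.span_base)
  then have "pr -` (Idl (pr ` X)) \<subseteq> pr -` (pr ` ideal_span (X \<union> G))" by auto
  also have "\<dots> = ideal_span (X \<union> G)"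
    by (intro pr_vimage_image is_ideal_span) (auto intro: ideals.span_base)
  finally show "pr -` (Idl (pr ` X)) \<subseteq> ideal_span (X \<union> G)" .
qed

lemma pr_vimage_prime:
  assumes "primeideal Q R" shows "prime_set (pr -` Q)" "G \<subseteq> pr -` Q"
proof -
  interpret primeideal Q R by fact
  have Q: "ideal Q R" by (rule is_ideal)
  show "G \<subseteq> pr -` Q" using pr_vimage_ideal(2)[OF Q] ideals.span_superset by blast
  have "\<one> \<notin> Q" using I_notcarr one_imp_carrier by blast
  then show "prime_set (pr -` Q)"
    unfolding prime_set_def using pr_vimage_ideal(1)[OF Q] I_prime by (auto simp: pr_one pr_mult)
qed

lemma pr_image_prime:
  assumes P: "prime_set P" and G: "G \<subseteq> P" shows "primeideal (pr ` P) R"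
proof (rule primeidealI)
  note vi = pr_vimage_image[OF prime_set_ideal[OF P] G]
  show "ideal (pr ` P) R" by (rule pr_image_ideal[OF prime_set_ideal[OF P]])
  show "cring R" by (rule is_cring)
  show "carrier R \<noteq> pr ` P"
  proof
    assume "carrier R = pr ` P"
    then have "1 \<in> pr -` (pr ` P)" using pr_closed[of 1] by simp
    then show False unfolding vi using prime_set_one[OF P] by blast
  qed
  fix x y assume xy: "x \<in> carrier R" "y \<in> carrier R" "x \<otimes> y \<in> pr ` P"
  obtain a b where ab: "x = pr a" "y = pr b" using pr_cases xy by meson
  have "a * b \<in> pr -` (pr ` P)" using xy ab by (simp add: pr_mult)
  then show "x \<in> pr ` P \<or> y \<in> pr ` P" unfolding vi using prime_setD[OF P] ab by blast
qed

text \<open>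
  The recursive form suits inductions, the indexed one is the form of the textbook definition.
\<close>

lemma regular_seq_iff:
  "regular_seq H fs \<longleftrightarrow> 1 \<notin> ideal_span (set fs \<union> H) \<and>
     (\<forall>i<length fs. regular_mod (fs ! i) (ideal_span (set (take i fs) \<union> H)))"
proof (induction fs arbitrary: H)
  case (Cons f fs)
  have "(\<forall>i<length (f # fs). regular_mod ((f # fs) ! i) (ideal_span (set (take i (f # fs)) \<union> H))) \<longleftrightarrow>
    regular_mod f (ideal_span H) \<and> (\<forall>i<length fs. regular_mod (fs ! i) (ideal_span (set (take i fs) \<union> insert f H)))"
    by (simp add: All_less_Suc2)
  then show ?case using Cons.IH[of "insert f H"] by auto
qed simp

lemma regular_sequence_iff: "regular_sequence R (map pr fs) \<longleftrightarrow> regular_seq G fs"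
proof -
  have vim: "pr a \<in> Idl (pr ` X) \<longleftrightarrow> a \<in> ideal_span (X \<union> G)" for a X
    using pr_vimage_Idl by blast
  have 1: "Idl (set (map pr fs)) \<noteq> carrier R \<longleftrightarrow> 1 \<notin> ideal_span (set fs \<union> G)"
  proof -
    have id: "ideal (Idl (pr ` set fs)) R" by (intro genideal_ideal) auto
    have "Idl (pr ` set fs) = carrier R \<longleftrightarrow> \<one> \<in> Idl (pr ` set fs)"
      using ideal.one_imp_carrier[OF id] by auto
    then show ?thesis using vim[of 1 "set fs"] by (simp add: pr_one)
  qed
  have 2: "(\<forall>a\<in>carrier R. map pr fs ! i \<otimes> a \<in> Idl (set (take i (map pr fs))) \<longrightarrow> a \<in> Idl (set (take i (map pr fs))))
     \<longleftrightarrow> regular_mod (fs ! i) (ideal_span (set (take i fs) \<union> G))" if "i < length fs" for i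
  proof -
    have "set (take i (map pr fs)) = pr ` set (take i fs)" by (simp add: take_map)
    moreover have "(\<forall>a\<in>carrier R. P a) \<longleftrightarrow> (\<forall>a. P (pr a))" for P by (metis pr_cases pr_closed)
    ultimately show ?thesis
      using that by (simp add: regular_mod_def vim pr_mult[symmetric])
  qed
  have 3: "set (map pr fs) \<subseteq> carrier R" by auto
  show ?thesis
    unfolding regular_sequence_def regular_seq_iff using 1 2 3 by simp
qed

lemma list_in_image: "set xs \<subseteq> carrier R \<Longrightarrow> \<exists>fs. xs = map pr fs"
  using ex_map_conv[of xs pr] pr_cases by blast

lemma prime_chain_imp_tower:
  assumes "prime_chain R ps"
  shows "prime_tower (map ((-`) pr) ps)" "\<forall>Q\<in>set ps. G \<subseteq> pr -` Q"
proof -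
  have pr: "primeideal Q R" if "Q \<in> set ps" for Q using assms that by (auto simp: prime_chain_def)
  show "\<forall>Q\<in>set ps. G \<subseteq> pr -` Q" using pr_vimage_prime pr by blast
  have strict: "pr -` Q \<subset> pr -` Q'" if "Q \<in> set ps" "Q' \<in> set ps" "Q \<subset> Q'" for Q Q'
  proof -
    have "pr ` (pr -` Q) = Q" "pr ` (pr -` Q') = Q'"
      using that pr_image_vimage[OF ideal_subset_carrier[OF primeideal.axioms(1)[OF pr]]] by simp_all
    then show ?thesis using that(3) by (metis psubsetE psubsetI vimage_mono)
  qed
  have "sorted_wrt (\<lambda>Q Q'. pr -` Q \<subset> pr -` Q') ps"
    using assms strict unfolding prime_chain_def by (metis (mono_tags, lifting) sorted_wrt_mono_rel)
  then show "prime_tower (map ((-`) pr) ps)"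
    unfolding prime_tower_def sorted_wrt_map using pr_vimage_prime pr by auto
qed

lemma prime_tower_imp_chain:
  assumes "prime_tower ps" "\<forall>P\<in>set ps. G \<subseteq> P"
  shows "prime_chain R (map ((`) pr) ps)"
proof -
  have id: "is_ideal P" if "P \<in> set ps" for P using assms that by (auto simp: prime_tower_def prime_set_ideal)
  have strict: "pr ` P \<subset> pr ` P'" if "P \<in> set ps" "P' \<in> set ps" "P \<subset> P'" for P P'
  proof -
    have "pr -` (pr ` P) = P" "pr -` (pr ` P') = P'"
      using that pr_vimage_image[OF id] assms(2) by simp_all
    then show ?thesis using that(3) by (metis psubsetE psubsetI image_mono)
  qed
  have "sorted_wrt (\<lambda>P P'. pr ` P \<subset> pr ` P') ps"
    using assms strict unfolding prime_tower_def by (metis (mono_tags, lifting) sorted_wrt_mono_rel)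
  then show ?thesis
    unfolding prime_chain_def sorted_wrt_map using pr_image_prime assms by (auto simp: prime_tower_def)
qed

lemma prime_height_ge:
  assumes "prime_tower (ps @ [P])" "\<forall>Q\<in>set (ps @ [P]). G \<subseteq> Q"
  shows "enat (length ps) \<le> prime_height R (pr ` P)"
  unfolding prime_height_def
  using prime_tower_imp_chain[OF assms]
  by (intro SUP_upper2[of "map ((`) pr) (ps @ [P])"]) auto

lemma prime_height_le:
  assumes "\<And>P ps. prime_tower (P # ps) \<Longrightarrow> G \<subseteq> P \<Longrightarrow> length ps \<le> d"
  shows "prime_height R Q \<le> enat d"
  unfolding prime_height_def
proof (rule SUP_least)
  fix ps assume "ps \<in> {ps. prime_chain R ps \<and> ps \<noteq> [] \<and> last ps = Q}"
  then obtain P qs where ps: "ps = P # qs" "prime_chain R (P # qs)" by (auto simp: neq_Nil_conv)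
  then show "enat (length ps - 1) \<le> enat d"
    using assms[of "pr -` P" "map ((-`) pr) qs"] prime_chain_imp_tower[OF ps(2)] by simp
qed

lemma ideal_depth_ge:
  assumes "regular_seq G fs" "set fs \<subseteq> pr -` Q"
  shows "enat (length fs) \<le> ideal_depth R Q"
  unfolding ideal_depth_def
  using assms by (intro SUP_upper2[of "map pr fs"]) (auto simp: regular_sequence_iff)

lemma ideal_depth_le:
  assumes "\<And>fs. regular_seq G fs \<Longrightarrow> set fs \<subseteq> pr -` Q \<Longrightarrow> enat (length fs) \<le> d"
  shows "ideal_depth R Q \<le> d"
  unfolding ideal_depth_def
proof (rule SUP_least)
  fix xs assume "xs \<in> {xs. regular_sequence R xs \<and> set xs \<subseteq> Q}"
  then have xs: "regular_sequence R xs" "set xs \<subseteq> Q" by auto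
  have "set xs \<subseteq> carrier R" using xs(1) unfolding regular_sequence_def by blast
  then obtain fs where "xs = map pr fs" using list_in_image by blast
  then show "enat (length xs) \<le> d" using assms[of fs] xs by (auto simp: regular_sequence_iff)
qed

lemma ideal_depth_le_prime_height:
  assumes Q: "primeideal Q R"
  shows "ideal_depth R Q \<le> prime_height R Q"
proof (rule ideal_depth_le)
  note P = pr_vimage_prime[OF Q]
  fix fs assume fs: "regular_seq G fs" "set fs \<subseteq> pr -` Q"
  obtain ps where ps: "prime_tower (ps @ [pr -` Q])" "length ps = length fs" "\<forall>P\<in>set ps. G \<subseteq> P"
    using regular_seq_imp_prime_tower[OF P fs(2,1)] by blast
  have "enat (length ps) \<le> prime_height R (pr ` (pr -` Q))"
    using ps P by (intro prime_height_ge) auto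
  then show "enat (length fs) \<le> prime_height R Q"
    using ps(2) pr_image_vimage[OF ideal_subset_carrier[OF primeideal.axioms(1)[OF Q]]] by simp
qed

lemma pr_vimage_maximal:
  assumes "maximalideal Q R"
  shows "prime_set (pr -` Q)" "G \<subseteq> pr -` Q" "y \<notin> pr -` Q \<Longrightarrow> \<exists>z. y * z - 1 \<in> pr -` Q"
proof -
  interpret Q: maximalideal Q R by fact
  have Qp: "primeideal Q R" using maximalideal_prime[OF assms] .
  show "prime_set (pr -` Q)" "G \<subseteq> pr -` Q" using pr_vimage_prime[OF Qp] by auto
  note vi = pr_vimage_ideal[OF Q.is_ideal]
  assume y: "y \<notin> pr -` Q"
  let ?J = "ideal_span (insert y (pr -` Q))"
  have sub: "insert y (pr -` Q) \<subseteq> ?J" by (rule ideals.span_superset)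
  have Ji: "ideal (pr ` ?J) R" by (intro pr_image_ideal is_ideal_span)
  have "Q \<subseteq> pr ` ?J"
    using sub pr_image_vimage[OF ideal_subset_carrier[OF Q.is_ideal]] by blast
  then consider "pr ` ?J = Q" | "pr ` ?J = carrier R"
    using Q.I_maximal[OF Ji] ideal_subset_carrier[OF Ji] by blast
  then show "\<exists>z. y * z - 1 \<in> pr -` Q"
  proof cases
    case 1
    then have "pr y \<in> Q" using sub by blast
    then show ?thesis using y by simp
  next
    case 2
    have vJ: "pr -` (pr ` ?J) = ?J"
      using sub \<open>G \<subseteq> pr -` Q\<close> by (intro pr_vimage_image is_ideal_span) auto
    have "1 \<in> pr -` (pr ` ?J)" using 2 by simp
    then have "1 \<in> ?J" unfolding vJ .
    then obtain k where "1 - k * y \<in> ideal_span (pr -` Q)" by (auto simp: ideals.span_insert)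
    moreover have "ideal_span (pr -` Q) = pr -` Q" using vi(1) by simp
    ultimately have k: "1 - k * y \<in> pr -` Q" by (simp only:)
    from ideals.subspace_neg[OF vi(1) this] show ?thesis by (intro exI[of _ k]) (simp only: minus_diff_eq mult.commute)
  qed
qed

lemma pr_image_maximal:
  assumes P: "prime_set P" "G \<subseteq> P" and inv: "\<And>y. y \<notin> P \<Longrightarrow> \<exists>z. y * z - 1 \<in> P"
  shows "maximalideal (pr ` P) R"
proof (rule maximalidealI)
  interpret P: primeideal "pr ` P" R by (rule pr_image_prime[OF P])
  note vi = pr_vimage_image[OF prime_set_ideal[OF P(1)] P(2)]
  show "ideal (pr ` P) R" by (rule P.is_ideal)
  show "carrier R \<noteq> pr ` P" by (rule P.I_notcarr)
  fix J assume J: "ideal J R" "pr ` P \<subseteq> J" "J \<subseteq> carrier R"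
  note vJ = pr_vimage_ideal[OF J(1)]
  show "J = pr ` P \<or> J = carrier R"
  proof (cases "J \<subseteq> pr ` P")
    case False
    then obtain x where x: "x \<in> J" "x \<notin> pr ` P" by blast
    obtain y where y: "x = pr y" using x J(3) pr_cases by blast
    have "y \<notin> P" using x y by blast
    then obtain z where "y * z - 1 \<in> P" using inv by blast
    then have yz1: "y * z - 1 \<in> pr -` J" using J(2) by blast
    have "y * z \<in> pr -` J" using x(1) y by (intro is_ideal_mult_right[OF vJ(1)]) auto
    from is_ideal_diff[OF vJ(1) this yz1] have "\<one> \<in> J" by (simp add: pr_one)
    then show ?thesis using ideal.one_imp_carrier[OF J(1)] by blast
  qed (use J in blast)
qed

text \<open>
  The union of the ascending chain is finitely generated, and its generators already lie in one
  member of the chain.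
\<close>

lemma noetherian_imp_noetherian_over:
  assumes "noetherian_ring R" shows "noetherian_over G"
  unfolding noetherian_over_def
proof
  fix v :: "nat \<Rightarrow> 'c"
  let ?J = "\<lambda>k. ideal_span (G \<union> v ` {..<k})"
  have mono: "?J k \<subseteq> ?J l" if "k \<le> l" for k l
    using that by (intro ideals.span_mono) auto
  define U where "U = (\<Union>k. ?J k)"
  have "is_ideal U"
  proof (rule ideals.subspaceI)
    show "0 \<in> U" by (auto simp: U_def ideals.span_zero)
    fix x assume "x \<in> U"
    then obtain k where k: "x \<in> ?J k" by (auto simp: U_def)
    then show "c * x \<in> U" for c using ideals.span_scale by (auto simp: U_def)
    fix y assume "y \<in> U"
    then obtain l where l: "y \<in> ?J l" by (auto simp: U_def)
    have "x \<in> ?J (max k l)" "y \<in> ?J (max k l)" using mono[of k "max k l"] mono[of l "max k l"] k l by auto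
    from ideals.span_add[OF this] show "x + y \<in> U" by (auto simp: U_def)
  qed
  from noetherian_ring.finetely_gen[OF assms pr_image_ideal[OF this]]
  obtain A where A: "A \<subseteq> carrier R" "finite A" "pr ` U = Idl A" by blast
  have "A \<subseteq> pr ` U" using genideal_self[OF A(1)] A(3) by simp
  with A(2) have "\<exists>k. A \<subseteq> pr ` ?J k"
  proof (induction A)
    case (insert a A)
    then obtain k where k: "A \<subseteq> pr ` ?J k" by auto
    obtain l where l: "a \<in> pr ` ?J l" using insert.prems by (auto simp: U_def)
    have "insert a A \<subseteq> pr ` ?J (max k l)"
      using k l image_mono[OF mono[of k "max k l"], of pr] image_mono[OF mono[of l "max k l"], of pr] by auto
    then show ?case by blast
  qed auto
  then obtain k where k: "A \<subseteq> pr ` ?J k" by blast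
  have "Idl A \<subseteq> pr ` ?J k"
    by (intro genideal_minimal pr_image_ideal is_ideal_span k)
  then have "U \<subseteq> pr -` (pr ` ?J k)" using A(3) by blast
  also have "\<dots> = ?J k"
    by (intro pr_vimage_image is_ideal_span) (auto intro: ideals.span_base)
  finally have "U \<subseteq> ?J k" .
  moreover have "v k \<in> ?J (Suc k)" by (intro ideals.span_base) auto
  ultimately show "\<exists>k. v k \<in> ?J k" unfolding U_def by blast
qed

lemma noetherian_if_noetherian_set:
  assumes B: "noetherian_set B" "subring_set B" and onto: "carrier R \<subseteq> pr ` B"
  shows "noetherian_ring R"
proof (rule noetherian_ringI)
  have idB: "ideal_of B (pr -` Q \<inter> B)" if Q: "ideal Q R" for Q
    using is_ideal_zero[OF pr_vimage_ideal(1)[OF Q]] is_ideal_add[OF pr_vimage_ideal(1)[OF Q]]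
      is_ideal_mult[OF pr_vimage_ideal(1)[OF Q]] subring_set_zero[OF B(2)] subring_set_add[OF B(2)] subring_set_mult[OF B(2)]
    unfolding ideal_of_def by blast
  fix Q assume Q: "ideal Q R"
  obtain H where H: "finite H" "H \<subseteq> pr -` Q \<inter> B" "\<And>J'. ideal_of B J' \<Longrightarrow> H \<subseteq> J' \<Longrightarrow> pr -` Q \<inter> B \<subseteq> J'"
    using B(1) idB[OF Q] unfolding noetherian_set_def by meson
  have sub: "pr ` H \<subseteq> carrier R" by auto
  have id: "ideal (Idl (pr ` H)) R" by (intro genideal_ideal sub)
  have "pr -` Q \<inter> B \<subseteq> pr -` (Idl (pr ` H)) \<inter> B"
    using genideal_self[OF sub] H(2) by (intro H(3) idB id) auto
  then have "Q \<subseteq> Idl (pr ` H)"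
    using onto ideal_subset_carrier[OF Q] by blast
  moreover have "Idl (pr ` H) \<subseteq> Q" using H(2) by (intro genideal_minimal Q) auto
  ultimately show "\<exists>A\<subseteq>carrier R. finite A \<and> Q = Idl A" using sub H(1) by (intro exI[of _ "pr ` H"]) auto
qed

lemma presented_ring_Quot:
  assumes I: "ideal I R" and H: "pr -` I = ideal_span H"
  shows "presented_ring (R Quot I) (\<lambda>a. I +> pr a) H"
proof -
  interpret I: ideal I R by (rule I)
  interpret Q: cring "R Quot I" by (rule I.quotient_is_cring[OF is_cring])
  have hom: "(+>) I \<in> ring_hom R (R Quot I)" by (rule I.rcos_ring_hom)
  show ?thesis
  proof unfold_locales
    show "I +> pr (a + b) = (I +> pr a) \<oplus>\<^bsub>R Quot I\<^esub> (I +> pr b)" for a b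
      using ring_hom_add[OF hom] by (simp add: pr_add)
    show "I +> pr (a * b) = (I +> pr a) \<otimes>\<^bsub>R Quot I\<^esub> (I +> pr b)" for a b
      using ring_hom_mult[OF hom] by (simp add: pr_mult)
    show "I +> pr 1 = \<one>\<^bsub>R Quot I\<^esub>" using ring_hom_one[OF hom] by (simp add: pr_one)
    have "carrier (R Quot I) = (\<lambda>x. I +> x) ` carrier R"
      unfolding FactRing_def by (auto simp: A_RCOSETS_def')
    then show "range (\<lambda>a. I +> pr a) = carrier (R Quot I)"
      unfolding pr_range[symmetric] by auto
    show "(I +> pr a = \<zero>\<^bsub>R Quot I\<^esub>) = (a \<in> ideal_span H)" for a
      unfolding H[symmetric] vimage_eq using I.a_rcos_const[of "pr a"] I.a_rcos_self[of "pr a"]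
      by (auto simp: FactRing_def)
  qed
qed

end

section \<open>Forests\<close>

text \<open>
  Walks that never turn back at once. Finding a walk in a forest is enough to know a distance:
  such walks are determined by their end points (\<open>nb_walk_unique\<close> below).
\<close>

fun nb_walk :: "'v set set \<Rightarrow> 'v list \<Rightarrow> bool" where
  "nb_walk E [] \<longleftrightarrow> False"
| "nb_walk E [a] \<longleftrightarrow> True"
| "nb_walk E [a, b] \<longleftrightarrow> {a, b} \<in> E"
| "nb_walk E (a # b # c # xs) \<longleftrightarrow> {a, b} \<in> E \<and> a \<noteq> c \<and> nb_walk E (b # c # xs)"

lemma nb_walk_Cons:
  "nb_walk E (a # b # xs) \<longleftrightarrow> {a, b} \<in> E \<and> (xs \<noteq> [] \<longrightarrow> a \<noteq> hd xs) \<and> nb_walk E (b # xs)"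
  by (cases xs) auto

lemma nb_walk_nth:
  assumes "nb_walk E xs"
  shows "Suc i < length xs \<Longrightarrow> {xs ! i, xs ! Suc i} \<in> E"
    and "Suc (Suc i) < length xs \<Longrightarrow> xs ! i \<noteq> xs ! Suc (Suc i)"
proof -
  have "(Suc i < length xs \<longrightarrow> {xs ! i, xs ! Suc i} \<in> E) \<and> (Suc (Suc i) < length xs \<longrightarrow> xs ! i \<noteq> xs ! Suc (Suc i))"
    using assms
  proof (induction E xs arbitrary: i rule: nb_walk.induct)
    case (4 E a b c xs)
    then show ?case by (cases i) auto
  qed auto
  then show "Suc i < length xs \<Longrightarrow> {xs ! i, xs ! Suc i} \<in> E"
    "Suc (Suc i) < length xs \<Longrightarrow> xs ! i \<noteq> xs ! Suc (Suc i)" by auto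
qed

lemma nb_walk_rev_append:
  assumes "nb_walk E (a # xs)" "nb_walk E (a # ys)" "xs \<noteq> [] \<Longrightarrow> ys \<noteq> [] \<Longrightarrow> hd xs \<noteq> hd ys"
  shows "nb_walk E (rev xs @ a # ys)"
  using assms
proof (induction xs arbitrary: a ys)
  case (Cons b xs)
  have "nb_walk E (b # a # ys)"
    using Cons.prems by (auto simp: nb_walk_Cons insert_commute)
  then have "nb_walk E (rev xs @ b # a # ys)"
    using Cons.prems by (intro Cons.IH) (auto simp: nb_walk_Cons)
  then show ?case by simp
qed simp

locale finite_forest =
  fixes V :: "'v set" and E :: "'v set set"
  assumes simple: "simple_graph V E" and acyclic: "\<nexists>vs. is_cycle E vs"
begin

lemma finite_V: "finite V"
  using simple by (simp add: simple_graph_def)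

lemma edge_neq: "{a, b} \<in> E \<Longrightarrow> a \<noteq> b"
  using simple by (auto simp: simple_graph_def)

lemma edge_in_V: "{a, b} \<in> E \<Longrightarrow> a \<in> V \<and> b \<in> V"
  using simple by (auto simp: simple_graph_def)

text \<open>
  Take a repetition of a vertex after the least number of steps. The vertices in between are
  distinct, and the number of steps is neither one, as there are no loops, nor two, as the walk
  does not turn back. So they form a cycle.
\<close>

lemma nb_walk_distinct:
  assumes w: "nb_walk E xs" shows "distinct xs"
proof (rule ccontr)
  assume "\<not> distinct xs"
  define bad where "bad k \<longleftrightarrow> (\<exists>i. i + k < length xs \<and> k > 0 \<and> xs ! i = xs ! (i + k))" for k
  obtain i j where "i < j" "j < length xs" "xs ! i = xs ! j"
    using \<open>\<not> distinct xs\<close> by (metis distinct_conv_nth nat_neq_iff)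
  then have "bad (j - i)" unfolding bad_def by (intro exI[of _ i]) auto
  then obtain k where k: "bad k" "\<And>k'. k' < k \<Longrightarrow> \<not> bad k'"
    using exists_least_iff[of bad] by blast
  then obtain i where i: "i + k < length xs" "k > 0" "xs ! i = xs ! (i + k)" by (auto simp: bad_def)
  have "k \<noteq> 1"
  proof
    assume "k = 1"
    then have "{xs ! i, xs ! Suc i} \<in> E" using nb_walk_nth(1)[OF w, of i] i by simp
    from edge_neq[OF this] show False using i \<open>k = 1\<close> by simp
  qed
  moreover have "k \<noteq> 2" using nb_walk_nth(2)[OF w, of i] i by auto
  ultimately have k3: "k \<ge> 3" using i by linarith
  define c where "c = take k (drop i xs)"
  have len: "length c = k" and nth: "\<And>t. t < k \<Longrightarrow> c ! t = xs ! (i + t)"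
    using i by (auto simp: c_def)
  have neq: "c ! s \<noteq> c ! t" if "s < t" "t < k" for s t
  proof
    assume "c ! s = c ! t"
    then have "bad (t - s)"
      unfolding bad_def using that i nth by (intro exI[of _ "i + s"]) auto
    moreover have "t - s < k" using that by simp
    ultimately show False using k(2) by blast
  qed
  then have "distinct c"
    by (simp add: distinct_conv_nth len) (metis nat_neq_iff)
  moreover have "{c ! t, c ! (Suc t mod k)} \<in> E" if "t < k" for t
  proof (cases "Suc t = k")
    case True
    then have c0: "c ! (Suc t mod k) = xs ! i" using i nth[of 0] by simp
    have e: "Suc (i + t) = i + k" using True by simp
    have "{xs ! (i + t), xs ! (i + k)} \<in> E"
      using nb_walk_nth(1)[OF w, of "i + t"] i(1) unfolding e by blast
    then show ?thesis using c0 nth[of t] that i(3) by simp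
  next
    case False
    then show ?thesis using nb_walk_nth(1)[OF w, of "i + t"] nth[of t] nth[of "Suc t"] i that by simp
  qed
  ultimately have "is_cycle E c" using k3 by (simp add: is_cycle_def len)
  then show False using acyclic by blast
qed

text \<open>
  After the common initial part, running back along one walk and then along the other does not
  turn back either, and repeats the end vertex.
\<close>

lemma nb_walk_unique:
  assumes "nb_walk E xs" "nb_walk E ys" "hd xs = hd ys" "last xs = last ys"
  shows "xs = ys"
  using assms
proof (induction xs arbitrary: ys)
  case (Cons a xs)
  obtain ys' where ys: "ys = a # ys'" using Cons.prems by (cases ys) auto
  have closed: "zs = []" if zs: "nb_walk E (z # zs)" "last (z # zs) = z" for z zs
  proof (rule ccontr)
    assume "zs \<noteq> []"
    then have "z \<in> set zs" using zs(2) last_in_set[of zs] by simp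
    then show False using nb_walk_distinct[OF zs(1)] by simp
  qed
  show ?case
  proof (cases "xs = [] \<or> ys' = []")
    case True
    then have "last (a # xs) = a \<or> last (a # ys') = a" by auto
    then have "last (a # xs) = a" "last (a # ys') = a" using Cons.prems(4) unfolding ys by auto
    then have "xs = []" "ys' = []"
      using closed[OF Cons.prems(1)] closed[OF Cons.prems(2)[unfolded ys]] by blast+
    then show ?thesis by (simp only: ys)
  next
    case False
    then obtain b xs' b' ys'' where *: "xs = b # xs'" "ys' = b' # ys''" by (meson neq_Nil_conv)
    show ?thesis
    proof (cases "b = b'")
      case True
      then show ?thesis using Cons.IH[of ys'] Cons.prems * unfolding ys by (simp add: nb_walk_Cons)
    next
      case False
      then have "nb_walk E (rev xs @ a # ys')"
        using Cons.prems * unfolding ys by (intro nb_walk_rev_append) auto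
      then have "distinct (rev xs @ a # ys')" by (rule nb_walk_distinct)
      moreover have ne: "xs \<noteq> []" "ys' \<noteq> []" using * by auto
      moreover have "last xs = last ys'" using Cons.prems(4) ne unfolding ys by simp
      ultimately have False
        using last_in_set[OF ne(1)] last_in_set[OF ne(2)] by (metis IntI distinct_append empty_iff list.set_intros(2) set_rev)
      then show ?thesis ..
    qed
  qed
qed simp

section \<open>Independent sets and joint vertices\<close>

abbreviation N :: "'v \<Rightarrow> 'v set" where
  "N \<equiv> closed_nbhd E"

abbreviation joints :: "'v set" where
  "joints \<equiv> joint_vertices V E"

definition near :: "'v \<Rightarrow> 'v \<Rightarrow> bool" where
  "near a b \<longleftrightarrow> a \<noteq> b \<and> (\<exists>v\<in>V. a \<in> N v \<and> b \<in> N v)"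

lemma near_sym: "near a b \<longleftrightarrow> near b a"
  by (auto simp: near_def)

lemma near_irrefl: "\<not> near a a"
  by (simp add: near_def)

lemma mem_closed_nbhd: "a \<in> N v \<longleftrightarrow> a = v \<or> {v, a} \<in> E"
  by (auto simp: closed_nbhd_def nbhd_def)

lemma nearI: "v \<in> V \<Longrightarrow> a \<in> N v \<Longrightarrow> b \<in> N v \<Longrightarrow> a \<noteq> b \<Longrightarrow> near a b"
  by (auto simp: near_def)

lemma near_iff: "near a b \<longleftrightarrow> a \<noteq> b \<and> ({a, b} \<in> E \<or> (\<exists>c. {a, c} \<in> E \<and> {c, b} \<in> E))"
  unfolding near_def mem_closed_nbhd by (metis edge_in_V insert_commute)

text \<open>
  Near vertices, and equal ones, are joined by a walk with at most three vertices that does not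
  turn back; a longer one would contradict uniqueness.
\<close>

lemma not_near_if_far:
  assumes "nb_walk E xs" "length xs \<ge> 4"
  shows "\<not> near (hd xs) (last xs)" "hd xs \<noteq> last xs"
proof -
  have short: False if "nb_walk E ys" "length ys \<le> 3" "hd ys = hd xs" "last ys = last xs" for ys
    using nb_walk_unique[OF assms(1) that(1)] that assms(2) by auto
  show neq: "hd xs \<noteq> last xs" using short[of "[hd xs]"] by auto
  show "\<not> near (hd xs) (last xs)"
  proof
    assume "near (hd xs) (last xs)"
    then consider "{hd xs, last xs} \<in> E" | c where "{hd xs, c} \<in> E" "{c, last xs} \<in> E"
      unfolding near_iff by blast
    then show False
    proof cases
      case 1
      then show False using short[of "[hd xs, last xs]"] by simp
    next
      case 2
      then show False using short[of "[hd xs, c, last xs]"] neq by simp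
    qed
  qed
qed

definition indep :: "'v set \<Rightarrow> bool" where
  "indep X \<longleftrightarrow> X \<subseteq> V \<and> (\<forall>a\<in>X. \<forall>b\<in>X. \<not> near a b)"

definition max_indep :: "'v set \<Rightarrow> bool" where
  "max_indep X \<longleftrightarrow> indep X \<and> (\<forall>v\<in>V - X. \<exists>x\<in>X. near v x)"

lemma indep_finite: "indep X \<Longrightarrow> finite X"
  unfolding indep_def using finite_V finite_subset by blast

lemma indep_insert: "indep X \<Longrightarrow> v \<in> V \<Longrightarrow> (\<And>x. x \<in> X \<Longrightarrow> \<not> near v x) \<Longrightarrow> indep (insert v X)"
  unfolding indep_def using near_sym near_irrefl by blast

lemma extend_indep:
  assumes X: "indep X" and U: "U \<subseteq> V"
  shows "\<exists>Y. X \<subseteq> Y \<and> Y \<subseteq> X \<union> U \<and> indep Y \<and> (\<forall>v\<in>U - Y. \<exists>y\<in>Y. near v y)"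
proof -
  define C where "C = {Y. X \<subseteq> Y \<and> Y \<subseteq> X \<union> U \<and> indep Y}"
  have fin: "finite C" by (rule finite_subset[of _ "Pow V"]) (auto simp: C_def indep_def finite_V)
  have "X \<in> C" using X by (simp add: C_def)
  then obtain Y where Y: "Y \<in> C" "\<And>Z. Z \<in> C \<Longrightarrow> Y \<subseteq> Z \<Longrightarrow> Y = Z"
    using finite_has_maximal[OF fin] by blast
  have YC: "X \<subseteq> Y" "Y \<subseteq> X \<union> U" "indep Y" using Y(1) by (auto simp: C_def)
  have "\<exists>y\<in>Y. near v y" if v: "v \<in> U - Y" for v
  proof (rule ccontr)
    assume *: "\<not> ?thesis"
    have "indep (insert v Y)" using YC(3) v U * by (intro indep_insert) auto
    then have "insert v Y \<in> C" using YC v by (auto simp: C_def)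
    then have "Y = insert v Y" using Y(2) by blast
    then show False using v by blast
  qed
  then show ?thesis using YC by blast
qed

lemma extend_max_indep:
  assumes "indep X" shows "\<exists>Y. X \<subseteq> Y \<and> max_indep Y"
  using extend_indep[OF assms order_refl] by (auto simp: max_indep_def)

lemma leaf_nbhd:
  assumes "vdeg E l = 1" "{w, l} \<in> E" shows "{l, v} \<in> E \<longleftrightarrow> v = w"
proof -
  obtain x where x: "nbhd E l = {x}" using assms(1) by (auto simp: vdeg_def card_1_singleton_iff)
  have "w \<in> nbhd E l" using assms(2) by (simp add: nbhd_def insert_commute)
  then have "nbhd E l = {w}" using x by auto
  then show ?thesis by (auto simp: nbhd_def)
qed

text \<open>
  A leaf sees exactly the closed neighborhood of its joint vertex, which is a clique; leaves are
  the simplicial vertices behind the exchanges below.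
\<close>

lemma near_leaf:
  assumes "vdeg E l = 1" "{w, l} \<in> E" shows "near l v \<longleftrightarrow> v \<in> N w \<and> v \<noteq> l"
  unfolding near_iff mem_closed_nbhd leaf_nbhd[OF assms] by auto

lemma joint_iff: "w \<in> joints \<longleftrightarrow> (\<exists>l. {w, l} \<in> E \<and> vdeg E l = 1)"
  unfolding joint_vertices_def nbhd_def using edge_in_V by auto

end

text \<open>
  A tree with exactly two vertices is excluded because there both vertices are leaves and joint
  vertices at once.
\<close>

locale tree = finite_forest V E for V :: "'v set" and E :: "'v set set" +
  assumes connected: "connected_graph V E"
    and deg_pos: "\<And>v. v \<in> V \<Longrightarrow> 1 \<le> vdeg E v"
    and card_V: "card V \<noteq> 2"
begin

lemma edge_across:
  assumes "u \<in> V" "v \<in> V" "u \<in> A" "v \<notin> A"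
  shows "\<exists>a b. a \<in> A \<and> b \<notin> A \<and> {a, b} \<in> E"
proof -
  have "(u, v) \<in> {(a, b). {a, b} \<in> E}\<^sup>*" using connected assms by (simp add: connected_graph_def)
  then show ?thesis using assms(3,4) by (induction rule: rtrancl_induct) auto
qed

lemma leaf_nbr_not_leaf:
  assumes "vdeg E l = 1" "{w, l} \<in> E" shows "vdeg E w \<noteq> 1"
proof
  assume w: "vdeg E w = 1"
  have lw: "{l, w} \<in> E" using assms(2) by (simp add: insert_commute)
  have V: "l \<in> V" "w \<in> V" "l \<noteq> w" using edge_in_V[OF lw] edge_neq[OF lw] by auto
  have "V \<subseteq> {l, w}"
  proof
    fix v assume v: "v \<in> V"
    show "v \<in> {l, w}"
    proof (rule ccontr)
      assume "v \<notin> {l, w}"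
      then obtain a b where "a \<in> {l, w}" "b \<notin> {l, w}" "{a, b} \<in> E"
        using edge_across[OF V(1) v, of "{l, w}"] by blast
      then show False using leaf_nbhd[OF assms] leaf_nbhd[OF w lw] by auto
    qed
  qed
  then have "V = {l, w}" using V by blast
  then show False using card_V V by simp
qed

lemma joint_not_leaf: "w \<in> joints \<Longrightarrow> vdeg E w \<noteq> 1"
  unfolding joint_iff using leaf_nbr_not_leaf by blast

lemma ex_other_nbr:
  assumes "v \<in> V" "vdeg E v \<noteq> 1" shows "\<exists>z. {v, z} \<in> E \<and> z \<noteq> a"
proof (rule ccontr)
  assume "\<not> ?thesis"
  then have "nbhd E v \<subseteq> {a}" by (auto simp: nbhd_def)
  then have "vdeg E v \<le> 1" unfolding vdeg_def using card_mono[of "{a}"] by force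
  then show False using deg_pos[OF assms(1)] assms(2) by linarith
qed

text \<open>
  Without joint vertices there would be no leaves, and a walk that does not turn back could be
  prolonged for ever, although its vertices are distinct.
\<close>

lemma ex_joint: "\<exists>w. w \<in> joints"
proof (rule ccontr)
  assume no: "\<not> ?thesis"
  have nl: "vdeg E v \<noteq> 1" if "v \<in> V" for v
  proof
    assume "vdeg E v = 1"
    then have "nbhd E v \<noteq> {}" by (auto simp: vdeg_def)
    then obtain w where "{w, v} \<in> E" by (auto simp: nbhd_def insert_commute)
    then show False using no \<open>vdeg E v = 1\<close> by (auto simp: joint_iff)
  qed
  obtain v where v: "v \<in> V" using connected by (auto simp: connected_graph_def)
  have "\<exists>xs. nb_walk E xs \<and> length xs = Suc n \<and> set xs \<subseteq> V" for n
  proof (induction n)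
    case 0
    then show ?case using v by (intro exI[of _ "[v]"]) auto
  next
    case (Suc n)
    then obtain a xs where xs: "nb_walk E (a # xs)" "length xs = n" "set (a # xs) \<subseteq> V"
      by (auto simp: length_Suc_conv)
    obtain z where z: "{a, z} \<in> E" "xs \<noteq> [] \<Longrightarrow> z \<noteq> hd xs"
      using ex_other_nbr[of a "hd xs"] xs(3) nl by auto
    then have "nb_walk E (z # a # xs)" using xs by (auto simp: nb_walk_Cons insert_commute)
    then show ?case using xs edge_in_V[OF z(1)] by (intro exI[of _ "z # a # xs"]) auto
  qed
  then obtain xs where xs: "nb_walk E xs" "length xs = Suc (card V)" "set xs \<subseteq> V" by blast
  then show False
    using distinct_card[OF nb_walk_distinct[OF xs(1)]] card_mono[OF finite_V xs(3)] by simp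
qed

text \<open>
  Suppose that \<open>j\<close> is in the closed neighborhoods of two joint vertices. In a maximal
  independent set through \<open>j\<close> it is the only member in either neighborhood, so it can
  be exchanged for a leaf at each of the two joint vertices.
\<close>

lemma unmixed_imp_joint_le_one:
  assumes unmixed: "\<And>X Y. max_indep X \<Longrightarrow> max_indep Y \<Longrightarrow> card X = card Y"
    and j: "j \<in> V" and w: "w \<in> N j" "w \<in> joints"
    and w': "w' \<in> N j" "w' \<in> joints"
  shows "w = w'"
proof (rule ccontr)
  assume neq: "w \<noteq> w'"
  obtain l l' where l: "{w, l} \<in> E" "vdeg E l = 1" and l': "{w', l'} \<in> E" "vdeg E l' = 1"
    using w w' by (auto simp: joint_iff)
  have lw: "w \<noteq> l'" "w' \<noteq> l" using joint_not_leaf l l' w w' by auto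
  have jw: "j \<in> N w" "j \<in> N w'" using w w' by (auto simp: mem_closed_nbhd insert_commute)
  have l_nbr: "{v, l} \<in> E \<longleftrightarrow> v = w" "{v, l'} \<in> E \<longleftrightarrow> v = w'" for v
    using leaf_nbhd[OF l(2,1), of v] leaf_nbhd[OF l'(2,1), of v] by (simp_all add: insert_commute[of v])
  have "l \<noteq> l'" using neq l_nbr l(1) l'(1) by metis
  have jl: "j \<noteq> l" "j \<noteq> l'" using jw lw neq l_nbr by (auto simp: mem_closed_nbhd)
  have "indep {j}" using j by (auto simp: indep_def near_irrefl)
  then obtain X where X: "j \<in> X" "max_indep X" using extend_max_indep by blast
  have Xi: "indep X" using X by (simp add: max_indep_def)
  have wV: "w \<in> V" "w' \<in> V" "l \<in> V" "l' \<in> V" using edge_in_V[OF l(1)] edge_in_V[OF l'(1)] by auto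
  have nX: "\<not> near j x" if "x \<in> X" for x using Xi that X(1) by (auto simp: indep_def)
  have lX: "\<not> near l x" if "x \<in> X - {j}" for x
    using near_leaf[OF l(2,1)] nearI[OF wV(1) jw(1)] nX that by blast
  have lX': "\<not> near l' x" if "x \<in> X - {j}" for x
    using near_leaf[OF l'(2,1)] nearI[OF wV(2) jw(2)] nX that by blast
  have "\<not> near l l'" using near_leaf[OF l(2,1), of l'] lw neq l_nbr by (auto simp: mem_closed_nbhd)
  have "indep (X - {j})" using Xi by (auto simp: indep_def)
  then have "indep (insert l' (X - {j}))" using lX' wV by (intro indep_insert) auto
  then have ind: "indep (insert l (insert l' (X - {j})))"
    by (rule indep_insert) (use lX \<open>\<not> near l l'\<close> wV in auto)
  then obtain Y where Y: "insert l (insert l' (X - {j})) \<subseteq> Y" "max_indep Y" using extend_max_indep by blast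
  have "near l j" "near l' j" using near_leaf[OF l(2,1)] near_leaf[OF l'(2,1)] jw jl by auto
  then have "l \<notin> X" "l' \<notin> X" using nX near_sym by blast+
  have finX: "finite X" using indep_finite Xi .
  have "card (insert l (insert l' (X - {j}))) = Suc (Suc (card (X - {j})))"
    using \<open>l \<notin> X\<close> \<open>l' \<notin> X\<close> \<open>l \<noteq> l'\<close> finX by simp
  also have "\<dots> = Suc (card X)" using X(1) finX by (metis card_Suc_Diff1)
  finally have "Suc (card X) \<le> card Y"
    using card_mono[OF _ Y(1)] Y(2) indep_finite by (auto simp: max_indep_def)
  then show False using unmixed[OF X(2) Y(2)] by simp
qed

text \<open>
  Suppose that some vertices have no joint vertex in their closed neighborhood. By connectedness
  one of them, \<open>u\<close>, is adjacent to a vertex \<open>c\<close> that is adjacent to a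
  joint vertex \<open>w\<close>. Let \<open>l\<close> be a leaf at \<open>w\<close>. The aim is an
  independent set \<open>Y\<close> away from \<open>u\<close> and \<open>c\<close> such that
  \<open>Y \<union> {c}\<close> is maximal independent. As \<open>u\<close> and \<open>l\<close>
  are not near, \<open>Y \<union> {u, l}\<close> is independent too, and larger.

  The vertices that are near \<open>u\<close> but not near \<open>c\<close> need care, since
  \<open>Y\<close> must dominate them. They are the vertices \<open>z\<close> on walks \<open>u,
  q, z\<close> with \<open>q \<noteq> c\<close>. Such a \<open>z\<close> is not a leaf, because
  \<open>q\<close> is not a joint vertex, so it has a neighbor \<open>y \<noteq> q\<close>. These
  vertices \<open>y\<close> are pairwise far apart and far from \<open>u\<close> and
  \<open>c\<close>, and \<open>Y\<close> is an extension of the set of them.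
\<close>

lemma unmixed_imp_near_joint:
  assumes unmixed: "\<And>X Y. max_indep X \<Longrightarrow> max_indep Y \<Longrightarrow> card X = card Y"
    and "v \<in> V"
  shows "N v \<inter> joints \<noteq> {}"
proof
  assume v: "N v \<inter> joints = {}"
  define U where "U = {v \<in> V. N v \<inter> joints = {}}"
  obtain w0 where w0: "w0 \<in> joints" using ex_joint by blast
  then have "w0 \<in> V" "w0 \<notin> U" by (auto simp: U_def joint_vertices_def mem_closed_nbhd)
  then obtain u c where uc: "u \<in> U" "c \<notin> U" "{u, c} \<in> E"
    using edge_across[of v w0 U] v \<open>v \<in> V\<close> by (auto simp: U_def)
  have u: "u \<in> V" "\<And>w. w \<in> joints \<Longrightarrow> w \<noteq> u \<and> {u, w} \<notin> E"
    using uc(1) by (auto simp: U_def mem_closed_nbhd)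
  have c: "c \<in> V" using edge_in_V uc(3) by blast
  obtain w where w: "w \<in> joints" "w \<in> N c" using uc(2) c by (auto simp: U_def)
  then have cw: "{c, w} \<in> E" using u(2) uc(3) by (auto simp: mem_closed_nbhd)
  obtain l where l: "{w, l} \<in> E" "vdeg E l = 1" using w by (auto simp: joint_iff)
  have V: "w \<in> V" "l \<in> V" using edge_in_V[OF l(1)] by auto
  have "u \<noteq> w" using u w by blast
  have "c \<noteq> l" using leaf_nbhd[OF l(2,1), of u] uc(3) \<open>u \<noteq> w\<close> by (auto simp: insert_commute)
  have "nb_walk E [u, c, w, l]" using uc cw l \<open>u \<noteq> w\<close> \<open>c \<noteq> l\<close> by auto
  from not_near_if_far[OF this] have ul: "\<not> near u l" "u \<noteq> l" by auto
  define I where "I = {(q, z). {u, q} \<in> E \<and> q \<noteq> c \<and> {q, z} \<in> E \<and> z \<noteq> u}"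
  have "\<forall>p\<in>I. \<exists>y. {snd p, y} \<in> E \<and> y \<noteq> fst p"
  proof
    fix p assume "p \<in> I"
    then obtain q z where p: "p = (q, z)" "{u, q} \<in> E" "{q, z} \<in> E" by (auto simp: I_def)
    have "vdeg E z \<noteq> 1" using u(2)[of q] p by (auto simp: joint_iff)
    then show "\<exists>y. {snd p, y} \<in> E \<and> y \<noteq> fst p"
      using ex_other_nbr[of z q] edge_in_V[OF p(3)] p(1) by auto
  qed
  from bchoice[OF this] obtain y where y': "\<forall>p\<in>I. {snd p, y p} \<in> E \<and> y p \<noteq> fst p" ..
  have y: "{z, y (q, z)} \<in> E \<and> y (q, z) \<noteq> q" if "(q, z) \<in> I" for q z
    using bspec[OF y' that] by simp
  define Y0 where "Y0 = y ` I"
  define ball where "ball v = {x. x = v \<or> near v x}" for v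
  define Z where "Z = {v \<in> V. v \<notin> ball c \<and> v \<notin> ball u}"
  have Y0Z: "y (q, z) \<in> Z" if qz: "(q, z) \<in> I" for q z
  proof -
    have "nb_walk E [u, q, z, y (q, z)]" "nb_walk E [c, u, q, z, y (q, z)]"
      using qz y[OF qz] uc(3) by (auto simp: I_def insert_commute)
    then have "y (q, z) \<notin> ball u" "y (q, z) \<notin> ball c"
      using not_near_if_far[of "[u, q, z, y (q, z)]"] not_near_if_far[of "[c, u, q, z, y (q, z)]"]
      by (auto simp: ball_def)
    then show ?thesis using edge_in_V y[OF qz] by (auto simp: Z_def)
  qed
  have "indep Y0"
    unfolding indep_def
  proof (intro conjI ballI)
    show "Y0 \<subseteq> V" using Y0Z by (auto simp: Y0_def Z_def)
    fix a b assume "a \<in> Y0" "b \<in> Y0"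
    then obtain q z q' z' where ab: "a = y (q, z)" "b = y (q', z')" "(q, z) \<in> I" "(q', z') \<in> I"
      by (auto simp: Y0_def)
    show "\<not> near a b"
    proof (cases "q = q'")
      case False
      have "nb_walk E [a, z, q, u, q', z', b]"
        using ab y[OF ab(3)] y[OF ab(4)] False by (auto simp: I_def insert_commute)
      from not_near_if_far(1)[OF this] show ?thesis by simp
    next
      case True
      show ?thesis
      proof (cases "z = z'")
        case True
        then show ?thesis using ab \<open>q = q'\<close> near_irrefl by simp
      next
        case False
        have "nb_walk E [a, z, q, z', b]"
          using ab y[OF ab(3)] y[OF ab(4)] False True by (auto simp: I_def insert_commute)
        from not_near_if_far(1)[OF this] show ?thesis by simp
      qed
    qed
  qed
  have "Z \<subseteq> V" by (auto simp: Z_def)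
  from extend_indep[OF \<open>indep Y0\<close> this] obtain Y where
    Y: "Y0 \<subseteq> Y" "Y \<subseteq> Y0 \<union> Z" "indep Y" and Ydom: "\<forall>v\<in>Z - Y. \<exists>y\<in>Y. near v y"
    by (elim exE conjE) (rule that)
  have "Y \<subseteq> Z" using Y(2) Y0Z by (auto simp: Y0_def)
  then have Yc: "\<not> near c x" "x \<noteq> c" and Yu: "\<not> near u x" "x \<noteq> u" if "x \<in> Y" for x
    using that by (auto simp: Z_def ball_def)
  have ind2: "indep (insert c Y)" using Y(3) c Yc by (intro indep_insert) auto
  have "max_indep (insert c Y)"
    unfolding max_indep_def
  proof (intro conjI ballI ind2)
    fix v assume v: "v \<in> V - insert c Y"
    show "\<exists>x\<in>insert c Y. near v x"
    proof (rule ccontr)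
      assume no: "\<not> ?thesis"
      then have vc: "\<not> near v c" "v \<noteq> c" using v by auto
      have "v \<in> ball u"
      proof (rule ccontr)
        assume "v \<notin> ball u"
        then have "v \<in> Z - Y" using v vc near_sym by (auto simp: Z_def ball_def)
        then show False using Ydom no by blast
      qed
      moreover have "v \<noteq> u" using vc uc(3) near_iff[of u c] edge_neq by auto
      ultimately have "near v u" using near_sym by (auto simp: ball_def)
      moreover have "{v, u} \<notin> E"
        using nearI[OF u(1), of v c] vc uc(3) by (auto simp: mem_closed_nbhd insert_commute)
      ultimately obtain q where q: "{v, q} \<in> E" "{q, u} \<in> E" unfolding near_iff by blast
      have "q \<noteq> c" using vc q(1) near_iff by blast
      then have "(q, v) \<in> I" using q \<open>v \<noteq> u\<close> by (auto simp: I_def insert_commute)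
      then have "{v, y (q, v)} \<in> E" "y (q, v) \<in> Y" using y Y(1) by (auto simp: Y0_def)
      then show False using no near_iff[of v "y (q, v)"] edge_neq by blast
    qed
  qed
  moreover have lY: "\<not> near l x" if "x \<in> Y" for x
  proof
    assume "near l x"
    then have "x \<in> N w" using near_leaf[OF l(2,1)] by blast
    moreover have "c \<in> N w" using cw by (auto simp: mem_closed_nbhd insert_commute)
    ultimately show False using nearI[OF V(1), of c x] Yc[OF that] by blast
  qed
  have "near l c" using near_leaf[OF l(2,1), of c] cw \<open>c \<noteq> l\<close> by (auto simp: mem_closed_nbhd insert_commute)
  then have "l \<notin> Y" using Yc near_sym by blast
  have "indep (insert l Y)" using Y(3) V lY by (intro indep_insert) auto
  then have "indep (insert u (insert l Y))" by (rule indep_insert) (use ul u(1) Yu in auto)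
  then obtain X where X: "insert u (insert l Y) \<subseteq> X" "max_indep X" using extend_max_indep by blast
  ultimately have "card X = card (insert c Y)" using unmixed by blast
  moreover have "finite Y" "c \<notin> Y" "u \<notin> Y" using indep_finite[OF Y(3)] Yc Yu by auto
  moreover have "card (insert u (insert l Y)) = Suc (Suc (card Y))"
    using \<open>finite Y\<close> \<open>u \<notin> Y\<close> \<open>l \<notin> Y\<close> ul(2) by simp
  moreover have "card (insert u (insert l Y)) \<le> card X"
    using card_mono[OF _ X(1)] X(2) indep_finite by (auto simp: max_indep_def)
  ultimately show False by simp
qed

lemma unmixed_imp_card_joint:
  assumes "\<And>X Y. max_indep X \<Longrightarrow> max_indep Y \<Longrightarrow> card X = card Y" and "j \<in> V"
  shows "card (N j \<inter> joints) = 1"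
proof -
  obtain w where w: "w \<in> N j \<inter> joints"
    using unmixed_imp_near_joint[OF assms] by blast
  then have "N j \<inter> joints = {w}"
    using unmixed_imp_joint_le_one[OF assms] by blast
  then show ?thesis by simp
qed

end

section \<open>Regular elements attached to a clique\<close>

lemma span_image_finite:
  assumes "finite A" "x \<in> ideal_span (f ` A)"
  shows "\<exists>c. x = (\<Sum>j\<in>A. c j * f j)"
  using assms
proof (induction A arbitrary: x)
  case (insert a A)
  then obtain k where "x - k * f a \<in> ideal_span (f ` A)" by (auto simp: ideals.span_insert)
  then obtain c where c: "x - k * f a = (\<Sum>j\<in>A. c j * f j)" using insert.IH by blast
  have "(\<Sum>j\<in>A. (c(a := k)) j * f j) = (\<Sum>j\<in>A. c j * f j)"
    using insert.hyps by (intro sum.cong) auto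
  then have "x = (\<Sum>j\<in>insert a A. (c(a := k)) j * f j)"
    using insert.hyps c by (simp add: algebra_simps)
  then show ?case by blast
qed auto

lemma poly_diff_in_ideal:
  assumes B: "is_ideal B" and xy: "x - y \<in> B" shows "poly q x - poly q y \<in> B"
proof (induction q)
  case (pCons a q)
  have "poly (pCons a q) x - poly (pCons a q) y = x * (poly q x - poly q y) + poly q y * (x - y)"
    by (simp add: algebra_simps)
  also have "\<dots> \<in> B" by (intro is_ideal_add[OF B] is_ideal_mult[OF B] xy pCons.IH)
  finally show ?case .
qed (simp add: is_ideal_zero[OF B])

text \<open>
  The ideals \<open>B i\<close> stand for the colon ideals of \<open>J\<close> by \<open>x
  i\<close>, and \<open>J\<close> turns out to be their intersection. Modulo \<open>B i\<close>
  all \<open>x j\<close> with \<open>j \<noteq> i\<close> vanish and the sum becomes \<open>x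
  i\<close>, so \<open>a\<close> lies in every \<open>B i\<close>. Membership in \<open>B
  l\<close> means that \<open>a\<close> is, modulo \<open>J\<close>, a combination of the \<open>x
  j\<close> with \<open>j \<noteq> l\<close>. Membership in the other \<open>B i\<close> then puts
  each term of this combination into \<open>J\<close>.
\<close>

lemma regular_mod_clique_sum:
  assumes C: "finite C" "l \<in> C" and J: "is_ideal J"
    and B: "\<And>i. i \<in> C \<Longrightarrow> is_ideal (B i)" "\<And>i. i \<in> C \<Longrightarrow> J \<subseteq> B i"
    and xB: "\<And>i b. i \<in> C \<Longrightarrow> b \<in> B i \<Longrightarrow> x i * b \<in> J"
    and xj: "\<And>i j. i \<in> C \<Longrightarrow> j \<in> C \<Longrightarrow> i \<noteq> j \<Longrightarrow> x j \<in> B i"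
    and reg: "\<And>i. i \<in> C \<Longrightarrow> regular_mod (x i) (B i)" "\<And>i. i \<in> C \<Longrightarrow> regular_mod (poly q (x i)) (B i)"
    and Bl: "B l \<subseteq> ideal_span (x ` (C - {l}) \<union> J)"
  shows "regular_mod (poly q (\<Sum>i\<in>C. x i)) J"
  unfolding regular_mod_def
proof (intro allI impI)
  fix a assume a: "poly q (\<Sum>i\<in>C. x i) * a \<in> J"
  have aB: "a \<in> B i" if i: "i \<in> C" for i
  proof -
    have "(\<Sum>j\<in>C - {i}. x j) \<in> B i"
      using i by (intro is_ideal_sum[OF B(1)[OF i]]) (auto intro: xj)
    moreover have "(\<Sum>j\<in>C. x j) - x i = (\<Sum>j\<in>C - {i}. x j)"
      using i C by (simp add: sum_diff1)
    ultimately have "poly q (\<Sum>j\<in>C. x j) - poly q (x i) \<in> B i"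
      by (intro poly_diff_in_ideal[OF B(1)[OF i]]) simp
    then have "(poly q (\<Sum>j\<in>C. x j) - poly q (x i)) * a \<in> B i"
      by (rule is_ideal_mult_right[OF B(1)[OF i]])
    moreover have "poly q (\<Sum>j\<in>C. x j) * a \<in> B i" using a B(2)[OF i] by blast
    ultimately have "poly q (\<Sum>j\<in>C. x j) * a - (poly q (\<Sum>j\<in>C. x j) - poly q (x i)) * a \<in> B i"
      using is_ideal_diff[OF B(1)[OF i]] by blast
    then have "poly q (x i) * a \<in> B i" by (simp add: algebra_simps)
    then show ?thesis using reg(2)[OF i] by (simp add: regular_mod_def)
  qed
  obtain y z where yz: "a = y + z" "y \<in> ideal_span (x ` (C - {l}))" "z \<in> ideal_span J"
    using aB[OF C(2)] Bl unfolding ideals.span_Un by blast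
  have zJ: "z \<in> J" using yz(3) J ideals.span_eq_iff by blast
  have "finite (C - {l})" using C by simp
  from span_image_finite[OF this yz(2)] obtain c where c: "y = (\<Sum>j\<in>C - {l}. c j * x j)" ..
  have "c i * x i \<in> J" if i: "i \<in> C - {l}" for i
  proof -
    have iC: "i \<in> C" using i by simp
    note Bi = B(1)[OF iC]
    have "z \<in> B i" using zJ B(2)[OF iC] by blast
    have "y = a - z" using yz(1) by simp
    then have "y \<in> B i" using is_ideal_diff[OF Bi aB[OF iC] \<open>z \<in> B i\<close>] by simp
    moreover have "y = c i * x i + (\<Sum>j\<in>C - {l} - {i}. c j * x j)"
      unfolding c using i C(1) by (simp add: sum.remove)
    moreover have "(\<Sum>j\<in>C - {l} - {i}. c j * x j) \<in> B i"
    proof (rule is_ideal_sum[OF Bi], rule is_ideal_mult[OF Bi])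
      fix j assume "j \<in> C - {l} - {i}"
      then show "x j \<in> B i" using xj[OF iC, of j] by auto
    qed
    ultimately have "c i * x i \<in> B i" using is_ideal_diff[OF Bi] by fastforce
    then have "x i * c i \<in> B i" by (simp add: mult.commute)
    then have "c i \<in> B i" using reg(1)[OF iC] by (simp add: regular_mod_def)
    then have "x i * c i \<in> J" by (rule xB[OF iC])
    then show ?thesis by (simp add: mult.commute)
  qed
  then have "y \<in> J" unfolding c by (rule is_ideal_sum[OF J])
  from is_ideal_add[OF J this zJ] show "a \<in> J" by (simp only: yz(1))
qed

section \<open>The neighborhood ideal of a tree\<close>

context tree
begin

text \<open>
  Generators of the preimage of the neighborhood ideal in the type of all polynomials. The
  variables outside \<open>V\<close> generate the kernel of the retraction.
\<close>

definition edge_gens :: "('v, 'k::field) mpol set" where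
  "edge_gens = {mvar a * mvar b | a b. near a b} \<union> mvar ` (- V)"

lemma edge_gens_cases [consumes 1, case_names near outside]:
  assumes "p \<in> edge_gens"
  obtains a b where "near a b" "p = mvar a * mvar b" | j where "j \<notin> V" "p = mvar j"
  using assms by (auto simp: edge_gens_def)

abbreviation (input) nbhd_two_ideal :: "('v, 'k::field) mpol set" where
  "nbhd_two_ideal \<equiv> nbhd_ideal V E (\<lambda>i. 2)"

lemma presented_mpoly_ring:
  "presented_ring (mpoly_ring V :: ('v, 'k::field) mpol ring) (restr V) (mvar ` (- V))"
proof -
  interpret cring "mpoly_ring V :: ('v, 'k) mpol ring" by (rule cring_mpoly_ring)
  show ?thesis
  proof unfold_locales
    show "range (restr V) = carrier (mpoly_ring V :: ('v, 'k) mpol ring)"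
      using restr_in_carrier restr_id by (metis (no_types, lifting) image_iff range_subsetD rangeI subsetI subset_antisym image_subsetI)
    fix a :: "('v, 'k) mpol"
    show "restr V a = \<zero>\<^bsub>mpoly_ring V\<^esub> \<longleftrightarrow> a \<in> ideal_span (mvar ` (- V))"
    proof
      assume "restr V a = \<zero>\<^bsub>mpoly_ring V\<^esub>"
      then show "a \<in> ideal_span (mvar ` (- V))" using diff_restr[of a V] by (simp add: mpoly_ring_def)
    next
      have "ideal_span (mvar ` (- V)) \<subseteq> {a :: ('v, 'k) mpol. restr V a = 0}"
        by (rule ideals.span_minimal) (auto simp: restr_simps intro!: ideals.subspaceI)
      then show "a \<in> ideal_span (mvar ` (- V)) \<Longrightarrow> restr V a = \<zero>\<^bsub>mpoly_ring V\<^esub>"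
        by (auto simp: mpoly_ring_def)
    qed
  qed (simp_all add: mpoly_ring_def restr_simps)
qed

lemma nbhd_two_ideal:
  "ideal nbhd_two_ideal (mpoly_ring V :: ('v, 'k::field) mpol ring)"
  "restr V -` (nbhd_two_ideal :: ('v, 'k) mpol set) = ideal_span edge_gens"
proof -
  let ?S = "mpoly_ring V :: ('v, 'k) mpol ring"
  interpret S: presented_ring ?S "restr V" "mvar ` (- V)" by (rule presented_mpoly_ring)
  define A where "A i = {sqfree_monom W :: ('v, 'k) mpol | W. W \<subseteq> N i \<and> card W = 2}" for i
  let ?Jp = "restr V ` ideal_span edge_gens :: ('v, 'k) mpol set"
  have I_eq: "nbhd_two_ideal = Idl\<^bsub>?S\<^esub> (\<Union>i\<in>V. Idl\<^bsub>?S\<^esub> (A i))"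
    by (simp add: nbhd_ideal_def A_def)
  have A_iff: "p \<in> A i \<longleftrightarrow> (\<exists>a b. a \<noteq> b \<and> a \<in> N i \<and> b \<in> N i \<and> p = mvar a * mvar b)"
    (is "_ \<longleftrightarrow> ?prod p i") for p i
  proof
    assume "p \<in> A i"
    then obtain W where W: "p = sqfree_monom W" "W \<subseteq> N i" "card W = 2" by (auto simp: A_def)
    then obtain a b where "W = {a, b}" "a \<noteq> b" by (auto simp: card_2_iff)
    then show "?prod p i" using W by (auto simp: sqfree_monom_def)
  next
    assume "?prod p i"
    then obtain a b where ab: "a \<noteq> b" "a \<in> N i" "b \<in> N i" "p = mvar a * mvar b" by blast
    then show "p \<in> A i" unfolding A_def
      by (intro CollectI exI[of _ "{a, b}"]) (auto simp: sqfree_monom_def)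
  qed
  have cl: "N i \<subseteq> V" if "i \<in> V" for i
    using that edge_in_V by (auto simp: mem_closed_nbhd)
  have A_restr: "restr V p = p" "p \<in> edge_gens" if p: "p \<in> A i" and i: "i \<in> V" for p i
  proof -
    from p obtain a b where ab: "a \<noteq> b" "a \<in> N i" "b \<in> N i" "p = mvar a * mvar b"
      unfolding A_iff by blast
    have "a \<in> V" "b \<in> V" using ab(2,3) cl[OF i] by auto
    then show "restr V p = p" by (simp add: ab(4) restr_simps)
    show "p \<in> edge_gens" using ab(4) nearI[OF i ab(2,3,1)] by (auto simp: edge_gens_def)
  qed
  have Ac: "A i \<subseteq> carrier ?S" if "i \<in> V" for i
    using A_restr(1)[OF _ that] restr_in_carrier by (metis subsetI)
  have IA: "ideal (Idl\<^bsub>?S\<^esub> (A i)) ?S" if "i \<in> V" for i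
    by (intro S.genideal_ideal Ac that)
  have UAc: "(\<Union>i\<in>V. Idl\<^bsub>?S\<^esub> (A i)) \<subseteq> carrier ?S"
    using S.ideal_subset_carrier[OF IA] by blast
  show id: "ideal nbhd_two_ideal ?S"
    unfolding I_eq by (rule S.genideal_ideal[OF UAc])
  have AI: "A i \<subseteq> nbhd_two_ideal" if "i \<in> V" for i
    using S.genideal_self[OF Ac[OF that]] S.genideal_self[OF UAc] that unfolding I_eq by blast
  note vi = S.pr_vimage_ideal[OF id]
  have "ideal_span (edge_gens :: ('v, 'k) mpol set) \<subseteq> restr V -` nbhd_two_ideal"
  proof (intro ideals.span_minimal vi subsetI)
    fix p :: "('v, 'k) mpol" assume "p \<in> edge_gens"
    then show "p \<in> restr V -` nbhd_two_ideal"
    proof (cases rule: edge_gens_cases)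
      case near
      then obtain i where i: "i \<in> V" "p \<in> A i" unfolding near_def A_iff by blast
      then have "p \<in> nbhd_two_ideal" using AI by blast
      then show ?thesis using A_restr(1)[OF i(2,1)] by simp
    next
      case outside
      then show ?thesis using vi(2) ideals.span_base[of p "mvar ` (- V)"] by auto
    qed
  qed
  moreover have "nbhd_two_ideal \<subseteq> ?Jp"
    unfolding I_eq
  proof (intro S.genideal_minimal S.pr_image_ideal is_ideal_span UN_least)
    fix i assume i: "i \<in> V"
    show "A i \<subseteq> ?Jp"
    proof
      fix p assume "p \<in> A i"
      from A_restr[OF this i] show "p \<in> ?Jp" using ideals.span_base by (metis image_eqI)
    qed
  qed
  then have "restr V -` nbhd_two_ideal \<subseteq> restr V -` ?Jp" by auto
  moreover have "restr V -` ?Jp = ideal_span edge_gens"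
    by (intro S.pr_vimage_image is_ideal_span) (auto simp: edge_gens_def intro: ideals.span_base)
  ultimately show "restr V -` nbhd_two_ideal = ideal_span (edge_gens :: ('v, 'k) mpol set)" by blast
qed

lemma presented_quot_ring:
  "presented_ring (mpoly_ring V Quot (nbhd_two_ideal :: ('v, 'k::field) mpol set))
     (\<lambda>p. nbhd_two_ideal +>\<^bsub>mpoly_ring V\<^esub> restr V p) edge_gens"
  by (rule presented_ring.presented_ring_Quot[OF presented_mpoly_ring nbhd_two_ideal])

text \<open>
  The variables outside a prime above the ideal belong to an independent set; this bounds chains
  of primes.
\<close>

lemma edge_gens_prime:
  assumes "prime_set P" "edge_gens \<subseteq> P"
  shows "indep {j \<in> V. mvar j \<notin> P}" "j \<notin> V \<Longrightarrow> mvar j \<in> P"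
proof -
  show "indep {j \<in> V. mvar j \<notin> P}"
    unfolding indep_def
  proof (intro conjI ballI notI)
    fix a b assume ab: "a \<in> {j \<in> V. mvar j \<notin> P}" "b \<in> {j \<in> V. mvar j \<notin> P}" "near a b"
    have "mvar a * mvar b \<in> P" using ab(3) assms(2) by (auto simp: edge_gens_def)
    then show False using prime_setD[OF assms(1)] ab by blast
  qed auto
  show "j \<notin> V \<Longrightarrow> mvar j \<in> P" using assms(2) by (auto simp: edge_gens_def)
qed

lemma edge_gens_subset_vanish:
  assumes "indep X" shows "edge_gens \<subseteq> vanish X"
proof
  fix p :: "('v, 'k::field) mpol" assume "p \<in> edge_gens"
  then show "p \<in> vanish X"
  proof (cases rule: edge_gens_cases)
    case (near a b)
    then have "a \<notin> X \<or> b \<notin> X" using assms by (auto simp: indep_def)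
    then show ?thesis using near by (auto simp: vanish_def restr_simps)
  next
    case outside
    then show ?thesis using assms by (auto simp: mvar_in_vanish indep_def)
  qed
qed

end

section \<open>Depth and height at the origin\<close>

text \<open>
  A flag of coordinate subspaces.
\<close>

lemma vanish_tower:
  assumes "finite X"
  shows "\<exists>ps. prime_tower (ps @ [vanish {}]) \<and> length ps = card X \<and>
     (\<forall>Q\<in>set (ps @ [vanish {}]). (vanish X :: ('v::linorder, 'k::field) mpol set) \<subseteq> Q)"
  using assms
proof (induction X)
  case empty
  show ?case by (intro exI[of _ "[]"]) (auto simp: prime_tower_def prime_vanish)
next
  case (insert x X)
  then obtain ps where ps: "prime_tower (ps @ [vanish {} :: ('v, 'k) mpol set])" "length ps = card X"
    "\<forall>Q\<in>set (ps @ [vanish {}]). (vanish X :: ('v, 'k) mpol set) \<subseteq> Q" by blast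
  have "mvar x \<in> (vanish X :: ('v, 'k) mpol set)" "mvar x \<notin> (vanish (insert x X) :: ('v, 'k) mpol set)"
    using insert.hyps by (simp_all add: mvar_in_vanish)
  then have "(vanish (insert x X) :: ('v, 'k) mpol set) \<subset> vanish X"
    using vanish_mono[of X "insert x X"] by blast
  then have lt: "vanish (insert x X) \<subset> Q" if "Q \<in> set (ps @ [vanish {}])" for Q :: "('v, 'k) mpol set"
    using ps(3) that by blast
  have "prime_tower (vanish (insert x X) # (ps @ [vanish {} :: ('v, 'k) mpol set]))"
    using ps(1) lt prime_vanish unfolding prime_tower_def by (auto simp del: set_append)
  then show ?case
    using ps(2) lt insert.hyps by (intro exI[of _ "vanish (insert x X) # ps"]) auto
qed

lemma vanish_empty_inverse:
  assumes "y \<notin> vanish {}" shows "\<exists>z. y * z - 1 \<in> (vanish {} :: ('v, 'k::field) mpol set)"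
proof -
  obtain c where c: "restr {} y = const c" using restr_empty by blast
  then have "c \<noteq> 0" using assms by (auto simp: vanish_def const_simps)
  then have "restr {} (y * const (inverse c) - 1) = 0"
    using const_unit[of c] by (simp add: restr_simps c mult.commute)
  then show ?thesis by (auto simp: vanish_def)
qed

text \<open>
  A linear order of the variables orders the monomials, which makes the polynomials an integral
  domain.
\<close>

locale ordered_tree = tree V E for V :: "'v::linorder set" and E :: "'v set set"
begin

text \<open>
  Height and depth at the origin: a flag of coordinate subspaces inside that of \<open>X\<close>
  bounds the height from below. For the depth, the monomial of \<open>Y\<close> is killed by every
  variable \<open>j\<close> outside \<open>Y\<close>, as \<open>j\<close> is near some member of
  \<open>Y\<close>; hence the tower of a regular sequence starts at an ideal with at most
  \<open>card Y\<close> free variables.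
\<close>

lemma cohen_macaulay_imp_unmixed:
  assumes CM: "cohen_macaulay (mpoly_ring V Quot (nbhd_two_ideal :: ('v, 'k::field) mpol set))"
    and X: "max_indep X" and Y: "max_indep Y"
  shows "card X \<le> card Y"
proof -
  let ?R = "mpoly_ring V Quot (nbhd_two_ideal :: ('v, 'k) mpol set)"
  let ?pr = "\<lambda>p :: ('v, 'k) mpol. nbhd_two_ideal +>\<^bsub>mpoly_ring V\<^esub> restr V p"
  interpret R: presented_ring ?R ?pr edge_gens by (rule presented_quot_ring)
  have Xi: "indep X" and Yi: "indep Y" using X Y by (auto simp: max_indep_def)
  let ?M = "vanish {} :: ('v, 'k) mpol set"
  have "edge_gens \<subseteq> ?M" using edge_gens_subset_vanish[of "{}"] by (simp add: indep_def)
  then have max: "maximalideal (?pr ` ?M) ?R"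
    by (intro R.pr_image_maximal prime_vanish vanish_empty_inverse)
  obtain ps where ps: "prime_tower (ps @ [?M])" "length ps = card X"
    "\<forall>Q\<in>set (ps @ [?M]). (vanish X :: ('v, 'k) mpol set) \<subseteq> Q"
    using vanish_tower[OF indep_finite[OF Xi]] by blast
  have "enat (card X) \<le> prime_height ?R (?pr ` ?M)"
    unfolding ps(2)[symmetric]
    using ps(3) edge_gens_subset_vanish[OF Xi] by (intro R.prime_height_ge ps(1)) blast
  also have "\<dots> = ideal_depth ?R (?pr ` ?M)" using CM max by (simp add: cohen_macaulay_def)
  also have "\<dots> \<le> enat (card Y)"
  proof (rule R.ideal_depth_le)
    fix fs assume fs: "regular_seq edge_gens fs" "set fs \<subseteq> ?pr -` (?pr ` ?M)"
    have fsM: "set fs \<subseteq> ?M"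
      using fs(2) R.pr_vimage_image[OF prime_set_ideal[OF prime_vanish] \<open>edge_gens \<subseteq> ?M\<close>] by simp
    define u :: "('v, 'k) mpol" where "u = (\<Prod>j\<in>Y. mvar j)"
    have finY: "finite Y" by (rule indep_finite[OF Yi])
    have "u \<noteq> 0" using finY by (simp add: u_def)
    \<comment> \<open>A factor outside the origin has a nonzero constant term, which survives the restriction to \<open>Y\<close>.\<close>
    have su: "s * u \<notin> ideal_span edge_gens" if s: "s \<notin> ?M" for s
    proof
      assume "s * u \<in> ideal_span edge_gens"
      moreover have "ideal_span edge_gens \<subseteq> (vanish Y :: ('v, 'k) mpol set)"
        by (intro ideals.span_minimal edge_gens_subset_vanish Yi prime_set_ideal prime_vanish)
      ultimately have "restr Y s * restr Y u = 0" by (auto simp: vanish_def restr_simps)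
      moreover have "restr Y u = u" by (simp add: u_def ring_map_prod[OF ring_map_restr])
      ultimately have "restr Y s = 0" using \<open>u \<noteq> 0\<close> by simp
      then have "restr {} s = 0" using restr_restr[of "{}" Y s] by (simp add: restr_simps)
      then show False using s by (simp add: vanish_def)
    qed
    have noeth: "noetherian_over (edge_gens :: ('v, 'k) mpol set)"
      using CM by (intro R.noetherian_imp_noetherian_over) (simp add: cohen_macaulay_def)
    let ?Q = "local_annihilator ?M edge_gens u"
    have "tower ?Q fs"
      by (rule regular_seq_imp_tower[OF noeth prime_vanish fsM fs(1) su])
    moreover have "mvar j \<in> ?Q" if j: "j \<notin> Y" for j
    proof -
      have "mvar j * u \<in> ideal_span edge_gens"
      proof (cases "j \<in> V")
        case True
        then obtain y where y: "y \<in> Y" "near j y" using Y j by (auto simp: max_indep_def)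
        have "mvar j * u = (\<Prod>i\<in>Y - {y}. mvar i) * (mvar j * mvar y)"
          unfolding u_def using y(1) finY by (simp add: prod.remove mult_ac)
        moreover have "mvar j * mvar y \<in> (edge_gens :: ('v, 'k) mpol set)" using y(2) by (auto simp: edge_gens_def)
        ultimately show ?thesis using ideals.span_scale[OF ideals.span_base] by metis
      next
        case False
        then have "mvar j \<in> (edge_gens :: ('v, 'k) mpol set)" by (auto simp: edge_gens_def)
        then show ?thesis using ideals.span_scale[OF ideals.span_base, of "mvar j" edge_gens u]
          by (simp add: mult.commute)
      qed
      then show ?thesis by (intro local_annihilatorI[OF prime_set_one[OF prime_vanish]]) simp
    qed
    ultimately have "length fs \<le> card Y" by (rule tower_length_le[OF finY])
    then show "enat (length fs) \<le> enat (card Y)" by simp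
  qed
  finally show ?thesis by simp
qed

end

section \<open>The regular sequence of neighborhood sums\<close>

context tree
begin

abbreviation nbhd_sum :: "'v \<Rightarrow> ('v, 'k::field) mpol" where
  "nbhd_sum w \<equiv> (\<Sum>i\<in>N w. mvar i)"

lemma closed_nbhd_subset: "w \<in> V \<Longrightarrow> N w \<subseteq> V"
  using edge_in_V by (auto simp: mem_closed_nbhd)

text \<open>
  The clique is the closed neighborhood of \<open>w\<close>. The colon ideal of the variable
  \<open>i\<close> is generated by \<open>H i\<close>: the variables near \<open>i\<close> and the
  generators that do not involve \<open>i\<close>. For the leaf \<open>l\<close>, the variables
  near it are just the other members of the clique, as \<open>regular_mod_clique_sum\<close>
  demands.
\<close>

lemma regular_mod_nbhd_sum:
  fixes q :: "('v, 'k::field) mpol poly"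
  assumes w: "w \<in> joints" and q: "q \<in> polys_in (range const)" "q \<noteq> 0"
    and T: "\<And>i. i \<in> N w \<Longrightarrow> T \<subseteq> free_of i"
  shows "regular_mod (poly q (nbhd_sum w)) (ideal_span (edge_gens \<union> T))"
proof -
  obtain l where l: "{w, l} \<in> E" "vdeg E l = 1" using w by (auto simp: joint_iff)
  have wV: "w \<in> V" using edge_in_V[OF l(1)] by simp
  let ?C = "N w"
  have C: "?C \<subseteq> V" by (rule closed_nbhd_subset[OF wV])
  let ?J = "ideal_span (edge_gens \<union> T)"
  define H where "H i = mvar ` {j. near i j} \<union> T \<union> {g \<in> edge_gens. g \<in> free_of i}" for i
  have Hfree: "H i \<subseteq> free_of i" if "i \<in> ?C" for i
    using T[OF that] near_irrefl unfolding H_def by (auto intro: mvar_free_of)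
  have X: "[:0, 1:] \<in> polys_in (range (const :: 'k \<Rightarrow> ('v, 'k) mpol))"
  proof -
    have "(0 :: ('v, 'k) mpol) \<in> range const" "(1 :: ('v, 'k) mpol) \<in> range const"
      using subring_set_zero[OF subring_range_const] subring_set_one[OF subring_range_const] by auto
    then show ?thesis by (auto simp: polys_in_def coeff_pCons split: nat.splits)
  qed
  show ?thesis
  proof (rule regular_mod_clique_sum[where l = l and B = "\<lambda>i. ideal_span (H i)"])
    show "finite ?C" using C finite_V finite_subset by blast
    show "l \<in> ?C" using l by (simp add: mem_closed_nbhd)
    show "is_ideal ?J" by (rule is_ideal_span)
    fix i assume i: "i \<in> ?C"
    show "is_ideal (ideal_span (H i))" by (rule is_ideal_span)
    show "?J \<subseteq> ideal_span (H i)"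
    proof (rule ideals.span_minimal[OF _ is_ideal_span], rule subsetI)
      fix g assume "g \<in> edge_gens \<union> T"
      then consider "g \<in> T" | a b where "near a b" "g = mvar a * mvar b" "g \<in> edge_gens" | j where "j \<notin> V" "g = mvar j" "g \<in> edge_gens"
        by (auto simp: edge_gens_def)
      then show "g \<in> ideal_span (H i)"
      proof cases
        case 1
        then show ?thesis by (auto simp: H_def intro: ideals.span_base)
      next
        case 2
        show ?thesis
        proof (cases "a = i \<or> b = i")
          case True
          then have "mvar a \<in> H i \<or> mvar b \<in> H i" using 2(1) near_sym by (auto simp: H_def)
          then show ?thesis
            unfolding 2(2) using is_ideal_mult[OF is_ideal_span] is_ideal_mult_right[OF is_ideal_span] ideals.span_base by blast
        next
          case False
          then have "g \<in> free_of i" unfolding 2(2)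
            by (intro subring_set_mult[OF subring_free_of] mvar_free_of) auto
          then show ?thesis using 2(3) by (auto simp: H_def intro: ideals.span_base)
        qed
      next
        case 3
        then have "g \<in> free_of i" using i C by (auto intro!: mvar_free_of)
        then show ?thesis using 3(3) by (auto simp: H_def intro: ideals.span_base)
      qed
    qed
    show "regular_mod (mvar i) (ideal_span (H i))"
      using regular_mod_free_of[OF Hfree[OF i] X] by simp
    show "regular_mod (poly q (mvar i)) (ideal_span (H i))"
      by (rule regular_mod_free_of[OF Hfree[OF i] q])
    show "mvar j \<in> ideal_span (H i)" if "j \<in> ?C" "i \<noteq> j" for j
      using nearI[OF wV i that] by (auto simp: H_def intro: ideals.span_base)
    have "ideal_span (H i) \<subseteq> {b. mvar i * b \<in> ?J}"
    proof (rule ideals.span_minimal, rule subsetI)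
      fix g assume "g \<in> H i"
      then consider j where "near i j" "g = mvar j" | "g \<in> edge_gens \<union> T" by (auto simp: H_def)
      then show "g \<in> {b. mvar i * b \<in> ?J}"
      proof cases
        case 1
        then have "mvar i * g \<in> edge_gens" by (auto simp: edge_gens_def)
        then show ?thesis by (auto intro: ideals.span_base)
      qed (auto intro: ideals.span_base ideals.span_scale)
    next
      show "is_ideal {b. mvar i * b \<in> ?J}"
        by (rule ideals.subspaceI)
          (auto simp: distrib_left mult.left_commute intro: ideals.span_zero ideals.span_add ideals.span_scale)
    qed
    then show "b \<in> ideal_span (H i) \<Longrightarrow> mvar i * b \<in> ?J" for b by blast
  next
    have "H l \<subseteq> mvar ` (?C - {l}) \<union> ?J"
    proof
      fix g assume "g \<in> H l"
      then consider j where "near l j" "g = mvar j" | "g \<in> edge_gens \<union> T" by (auto simp: H_def)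
      then show "g \<in> mvar ` (?C - {l}) \<union> ?J"
      proof cases
        case 1
        then show ?thesis using near_leaf[OF l(2,1)] by auto
      qed (auto intro: ideals.span_base)
    qed
    then show "ideal_span (H l) \<subseteq> ideal_span (mvar ` (?C - {l}) \<union> ?J)"
      by (rule ideals.span_mono)
  qed
qed

text \<open>
  Disjoint neighborhoods have sums without common variables, so the members \<open>D\<close>
  already treated are free of the variables of the next neighborhood.
\<close>

lemma regular_seq_nbhd_sums:
  fixes q :: "'v \<Rightarrow> ('v, 'k::field) mpol poly"
  assumes disj: "\<And>v w w'. w \<in> joints \<Longrightarrow> w' \<in> joints \<Longrightarrow>
      v \<in> N w \<Longrightarrow> v \<in> N w' \<Longrightarrow> w = w'"
    and q: "\<And>w. w \<in> joints \<Longrightarrow> q w \<in> polys_in (range const) \<and> q w \<noteq> 0"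
    and ws: "set ws \<subseteq> joints" "distinct ws"
    and P: "is_ideal P" "1 \<notin> P" "edge_gens \<subseteq> P" "\<And>w. w \<in> joints \<Longrightarrow> poly (q w) (nbhd_sum w) \<in> P"
  shows "regular_seq edge_gens (map (\<lambda>w. poly (q w) (nbhd_sum w)) ws)"
proof -
  let ?f = "\<lambda>w. poly (q w) (nbhd_sum w)"
  have free: "?f w' \<in> free_of i"
    if "w' \<in> joints" "w \<in> joints" "w \<noteq> w'" "i \<in> N w" for w w' i
  proof (rule poly_polys_in_subring[OF subring_free_of])
    show "q w' \<in> polys_in (free_of i)"
    proof -
      have "(range const :: ('v, 'k) mpol set) \<subseteq> free_of i"
        by (intro image_subsetI const_free_of)
      then show ?thesis using q[OF that(1)] unfolding polys_in_def by blast
    qed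
    show "nbhd_sum w' \<in> free_of i"
      using disj that by (intro subring_set_sum[OF subring_free_of] mvar_free_of) blast
  qed
  have "regular_seq (edge_gens \<union> ?f ` D) (map ?f ws)" if "D \<subseteq> joints" "D \<inter> set ws = {}" for D
    using that ws
  proof (induction ws arbitrary: D)
    case Nil
    have "ideal_span (edge_gens \<union> ?f ` D) \<subseteq> P"
      using Nil.prems P by (intro ideals.span_minimal) auto
    then show ?case using P(2) by auto
  next
    case (Cons w ws)
    have "regular_mod (?f w) (ideal_span (edge_gens \<union> ?f ` D))"
    proof (rule regular_mod_nbhd_sum)
      show "w \<in> joints" "q w \<in> polys_in (range const)" "q w \<noteq> 0"
        using Cons.prems q by auto
      show "?f ` D \<subseteq> free_of i" if "i \<in> N w" for i
        using Cons.prems free that by force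
    qed
    moreover have "regular_seq (edge_gens \<union> ?f ` insert w D) (map ?f ws)"
      using Cons.prems by (intro Cons.IH) auto
    ultimately show ?case by simp
  qed
  from this[of "{}"] show ?thesis by simp
qed

lemma restr_in_adjoin_list:
  assumes "set vs = V"
  shows "restr V y \<in> adjoin_list (range const) (map mvar vs)"
proof -
  let ?B = "adjoin_list (range const) (map mvar vs) :: ('v, 'k::field) mpol set"
  note B = subring_adjoin_list[OF subring_range_const, of "map mvar vs"]
  show ?thesis
  proof (induction y rule: mpol_induct)
    case (const c)
    then show ?case using subset_adjoin_list[OF subring_range_const] by auto
  next
    case (mvar j)
    then show ?case
      using set_subset_adjoin_list[OF subring_range_const, of "map mvar vs"] assms subring_set_zero[OF B] by auto
  qed (simp_all add: restr_simps subring_set_add[OF B] subring_set_mult[OF B])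
qed

text \<open>
  Two vertices in the neighborhood of the same joint vertex are equal or near.
\<close>

lemma card_indep_le:
  assumes cover: "\<And>j. j \<in> V \<Longrightarrow> N j \<inter> joints \<noteq> {}" and X: "indep X"
  shows "card X \<le> card (joints)"
proof -
  have "\<forall>j\<in>X. \<exists>w. w \<in> N j \<inter> joints"
  proof
    fix j assume "j \<in> X"
    then have "j \<in> V" using X by (auto simp: indep_def)
    then show "\<exists>w. w \<in> N j \<inter> joints" using cover by blast
  qed
  from bchoice[OF this] obtain f where f: "\<forall>j\<in>X. f j \<in> N j \<inter> joints" ..
  have inj: "inj_on f X"
  proof (rule inj_onI, rule ccontr)
    fix a b assume ab: "a \<in> X" "b \<in> X" "f a = f b" "a \<noteq> b"
    have "f a \<in> V" using f ab by (auto simp: joint_vertices_def)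
    moreover have "a \<in> N (f a)" "b \<in> N (f a)"
      using bspec[OF f ab(1)] bspec[OF f ab(2)] ab(3) by (auto simp: mem_closed_nbhd insert_commute)
    ultimately have "near a b" using ab(4) by (rule nearI)
    then show False using X ab by (auto simp: indep_def)
  qed
  have "f ` X \<subseteq> joints" using f by blast
  moreover have "finite (joints)" using finite_V by (simp add: joint_vertices_def)
  ultimately show ?thesis by (rule card_inj_on_le[OF inj])
qed

text \<open>
  At each maximal ideal both depth and height are equal to the number of joint vertices: the
  sequence of neighborhood sums bounds the depth from below, independent sets bound the height
  from above, and the depth is at most the height.
\<close>

lemma cohen_macaulay_if_card_joint:
  assumes card1: "\<And>j. j \<in> V \<Longrightarrow> card (N j \<inter> joints) = 1"
  shows "cohen_macaulay (mpoly_ring V Quot (nbhd_two_ideal :: ('v, 'k::field) mpol set))"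
proof -
  let ?R = "mpoly_ring V Quot (nbhd_two_ideal :: ('v, 'k) mpol set)"
  let ?pr = "\<lambda>p :: ('v, 'k) mpol. nbhd_two_ideal +>\<^bsub>mpoly_ring V\<^esub> restr V p"
  interpret R: presented_ring ?R ?pr edge_gens by (rule presented_quot_ring)
  obtain vs where vs: "set vs = V" "distinct vs" using finite_distinct_list[OF finite_V] by blast
  let ?B = "adjoin_list (range const) (map mvar vs) :: ('v, 'k) mpol set"
  have WV: "joints \<subseteq> V" by (auto simp: joint_vertices_def)
  have finW: "finite joints" using finite_subset[OF WV finite_V] .
  have cover: "N j \<inter> joints \<noteq> {}" if "j \<in> V" for j using card1[OF that] by auto
  have disj: "w = w'" if "w \<in> joints" "w' \<in> joints" "v \<in> N w" "v \<in> N w'" for v w w'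
  proof -
    have "v \<in> V" using closed_nbhd_subset that WV by blast
    then obtain x where "N v \<inter> joints = {x}" using card1 by (metis card_1_singletonE)
    moreover have "w \<in> N v" "w' \<in> N v"
      using that by (auto simp: mem_closed_nbhd insert_commute)
    ultimately show ?thesis using that(1,2) by (metis IntI singletonD)
  qed
  have field: "noetherian_set (range const :: ('v, 'k) mpol set)"
  proof (rule noetherian_set_field)
    fix a :: "('v, 'k) mpol" assume "a \<in> range const" "a \<noteq> 0"
    then obtain c where "a = const c" by blast
    moreover from this \<open>a \<noteq> 0\<close> have "c \<noteq> 0" using const_simps(1) by blast
    ultimately show "\<exists>b\<in>range const. b * a = 1"
      using const_unit[of c] by (intro bexI[of _ "const (inverse c)"]) auto
  qed
  have "noetherian_ring ?R"
  proof (rule R.noetherian_if_noetherian_set)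
    show "noetherian_set ?B" by (rule noetherian_adjoin_list[OF subring_range_const field])
    show "subring_set ?B" by (rule subring_adjoin_list[OF subring_range_const])
    show "carrier ?R \<subseteq> ?pr ` ?B"
    proof
      fix x assume "x \<in> carrier ?R"
      then obtain p where p: "x = ?pr p" using R.pr_cases by blast
      have "?pr p = ?pr (restr V p)" by (simp add: restr_restr)
      then show "x \<in> ?pr ` ?B" using restr_in_adjoin_list[OF vs(1), of p] p by (metis image_eqI)
    qed
  qed
  moreover have "ideal_depth ?R Q = prime_height ?R Q" if Q: "maximalideal Q ?R" for Q
  proof (rule antisym)
    show "ideal_depth ?R Q \<le> prime_height ?R Q"
      by (rule R.ideal_depth_le_prime_height[OF R.maximalideal_prime[OF Q]])
    define P where "P = ?pr -` Q"
    note P = R.pr_vimage_maximal[OF Q, folded P_def]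
    note Pi = prime_set_ideal[OF P(1)]
    have "\<exists>f\<in>polys_in (range const). f \<notin> polys_in P \<and> poly f t \<in> P" for t
    proof (rule zariski[OF subring_range_const P(1)])
      show "y \<notin> P \<Longrightarrow> \<exists>z. y * z - 1 \<in> P" for y by (rule P(3))
      fix y :: "('v, 'k) mpol"
      have "ideal_span (mvar ` (- V)) \<subseteq> P"
        using edge_gens_prime(2)[OF P(1,2)] by (intro ideals.span_minimal Pi) auto
      then show "\<exists>b\<in>?B. y - b \<in> P"
        using diff_restr[of y V] restr_in_adjoin_list[OF vs(1), of y] by blast
    qed
    then have "\<forall>w. \<exists>f. f \<in> polys_in (range const) \<and> f \<notin> polys_in P \<and> poly f (nbhd_sum w) \<in> P" by blast
    from choice[OF this] obtain q where
      q: "\<And>w. q w \<in> polys_in (range const)" "\<And>w. q w \<notin> polys_in P" "\<And>w. poly (q w) (nbhd_sum w) \<in> P"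
      by blast
    have q0: "q w \<noteq> 0" for w using q(2)[of w] is_ideal_zero[OF ideal_polys_in[OF Pi]] by auto
    obtain ws where ws: "set ws = joints" "distinct ws" using finite_distinct_list[OF finW] by blast
    let ?fs = "map (\<lambda>w. poly (q w) (nbhd_sum w)) ws"
    have "regular_seq edge_gens ?fs"
      by (rule regular_seq_nbhd_sums[OF disj _ _ ws(2) Pi prime_set_one[OF P(1)] P(2)])
        (use q q0 ws in auto)
    moreover have "set ?fs \<subseteq> ?pr -` Q" using q(3) by (auto simp: P_def[symmetric])
    ultimately have "enat (length ?fs) \<le> ideal_depth ?R Q" by (rule R.ideal_depth_ge)
    moreover have "length ?fs = card joints" using distinct_card[OF ws(2)] ws(1) by simp
    moreover have "prime_height ?R Q \<le> enat (card joints)"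
    proof (rule R.prime_height_le)
      fix P0 :: "('v, 'k) mpol set" and ps assume P0: "prime_tower (P0 # ps)" "edge_gens \<subseteq> P0"
      obtain ys where ys: "length ys = length ps" "tower P0 ys" using prime_tower_imp_tower[OF P0(1)] by blast
      have prime: "prime_set P0" using P0(1) by (simp add: prime_tower_def)
      note F = edge_gens_prime[OF prime P0(2)]
      have "length ys \<le> card {j \<in> V. mvar j \<notin> P0}"
        by (rule tower_length_le[OF _ ys(2)]) (use F(2) finite_V in auto)
      also have "\<dots> \<le> card joints" by (rule card_indep_le[OF cover F(1)])
      finally show "length ps \<le> card joints" using ys(1) by simp
    qed
    ultimately show "prime_height ?R Q \<le> ideal_depth ?R Q" by simp
  qed
  ultimately show ?thesis
    using R.is_cring by (simp add: cohen_macaulay_def)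
qed

end

section \<open>Cohen--Macaulay quotients and joint vertices\<close>

context ordered_tree
begin

theorem cohen_macaulay_iff:
  "cohen_macaulay (mpoly_ring V Quot (nbhd_two_ideal :: ('v, 'k::field) mpol set)) \<longleftrightarrow>
     (\<forall>j\<in>V. card (N j \<inter> joints) = 1)" (is "?CM \<longleftrightarrow> _")
proof
  assume CM: ?CM
  have "card X = card Y" if "max_indep X" "max_indep Y" for X Y
    using cohen_macaulay_imp_unmixed[OF CM] that by (metis antisym)
  then show "\<forall>j\<in>V. card (N j \<inter> joints) = 1"
    using unmixed_imp_card_joint by blast
next
  assume "\<forall>j\<in>V. card (N j \<inter> joints) = 1"
  then show ?CM by (intro cohen_macaulay_if_card_joint) blast
qed

end

theorem theorem4p10:
  fixes n :: nat and E :: "nat set set"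
  assumes "is_tree {1..n} E"
    and no_isolated: "\<forall>i\<in>{1..n}. 1 \<le> vdeg E i"
    and not_single_edge: "n \<noteq> 2"
  shows "cohen_macaulay ((mpoly_ring {1..n} :: ((nat \<Rightarrow>\<^sub>0 nat) \<Rightarrow>\<^sub>0 'k::field) ring)
            Quot (nbhd_ideal {1..n} E (\<lambda>i. 2)))
         \<longleftrightarrow> (\<forall>j\<in>{1..n}. card (closed_nbhd E j \<inter> joint_vertices {1..n} E) = 1)"
proof -
  interpret ordered_tree "{1..n}" E
    using assms by unfold_locales (auto simp: is_tree_def)
  show ?thesis
    by (rule cohen_macaulay_iff)
qed

end
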